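(* There exists an absolute constant $\mathcal{G}>0$ such that the following holds. Suppose the data model and assumptions (A1), (A2'), (A3), (N2) of the context hold with $\ell = 1/10$, with $$C_\nu = \frac{\mathcal{G}\, c\sqrt{n}}{\max\{m,\; n\,\|(\mathbf{A}^* )^\dagger\|_\infty\}}\quad\text{for some } 0\le c\le 1,$$ and with $\mathbf{N}^{(0)}=0$. Then there is a choice of parameters $\alpha,\eta,r$ such that for every $0<\epsilon,\delta<1$ and $N=\mathrm{poly}(n,m,1/\epsilon,1/\delta)$ the following holds with probability at least $1-\delta$: after $T=O(\ln\frac1\epsilon)$ iterations, the Purification algorithm (see context) outputs a matrix of the form $\mathbf{A}=\mathbf{A}^*(\mathbf{\Sigma}+\mathbf{E})+\mathbf{N}$, where $\mathbf{\Sigma}$ is diagonal with $\mathbf{\Sigma}\succeq(1-\ell)\mathbf{I}$, $\mathbf{E}$ is off-diagonal (zero diagonal) with $\|\mathbf{E}\|_1\le \epsilon+c$, and $\|\mathbf{N}\|_1\le c$.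
   Context: Norms: for a matrix $\mathbf{M}$, $\|\mathbf{M}\|_1=\max_j\sum_i|\mathbf{M}_{i,j}|$, $\|\mathbf{M}\|_\infty=\max_i\sum_j|\mathbf{M}_{i,j}|$, $\|\mathbf{M}\|_s=\max\{\|\mathbf{M}\|_1,\|\mathbf{M}\|_\infty\}$. Data model: $\mathbf{A}^*\in\mathbb{R}^{m\times n}$ is a fixed unknown matrix, and data points are i.i.d. copies of $y=\mathbf{A}^*x^*+\nu$, where $x^*\in\mathbb{R}^n$ is a random non-negative vector and $\nu\in\mathbb{R}^m$ is a random noise vector (possibly dependent on $x^*$). (A1) The columns of $\mathbf{A}^*$ are linearly independent. (A2') The coordinates $x_i^*$ are independent, and $x_i^*=1$ with probability $s/n$ and $x_i^*=0$ otherwise, for a constant $s>0$. (A3) The initialization is $\mathbf{A}^{(0)}=\mathbf{A}^*(\mathbf{\Sigma}^{(0)}+\mathbf{E}^{(0)})+\mathbf{N}^{(0)}$ with $\mathbf{\Sigma}^{(0)}$ diagonal, $\mathbf{E}^{(0)}$ off-diagonal, $\mathbf{\Sigma}^{(0)}\succeq(1-\ell)\mathbf{I}$, $\|\mathbf{E}^{(0)}\|_s\le\ell$ ($\mathbf{N}^{(0)}$ is the component of $\mathbf{A}^{(0)}$ outside the column space of $\mathbf{A}^*$). (N2) (Unbiased noise) $\max_i|\nu_i|\le C_\nu$ almost surely, and $\mathbb{E}[\nu\mid x^*]=0$. $(\mathbf{A}^* )^\dagger$ denotes a matrix with $(\mathbf{A}^* )^\dagger\mathbf{A}^*=\mathbf{I}$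 having minimum $\|\cdot\|_\infty$ among such matrices. ReLU: $\phi_\alpha(z)=\max\{z-\alpha,0\}$, applied entrywise to vectors. Purification algorithm. Input: $\mathbf{A}^{(0)}$, threshold $\alpha$, step size $\eta$, scaling factor $r$, sample size $N$, number of iterations $T$. For $t=0,\dots,T-1$: draw fresh examples $y_1,\dots,y_N$; let $\mathbf{A}^\dagger$ be a pseudo-inverse of $\mathbf{A}^{(t)}$ (i.e. $\mathbf{A}^\dagger\mathbf{A}^{(t)}=\mathbf{I}$) with minimum $\|\mathbf{A}^\dagger\|_\infty$; decode each example $y$ as $x=\phi_\alpha(\mathbf{A}^\dagger y)$; set $$\mathbf{A}^{(t+1)}=(1-\eta)\mathbf{A}^{(t)}+r\eta\,\hat{\mathbb{E}}\big[(y-y')(x-x')^\top\big],$$ where $\hat{\mathbb{E}}$ is over independent uniform $y,y'$ from $\{y_1,\dots,y_N\}$ and $x,x'$ are their decodings. Output $\mathbf{A}=\mathbf{A}^{(T)}$. "$N=\mathrm{poly}(\cdot)$" means $N$ is a suitable (large enough) polynomial in the listed quantities.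
   Formalization: The result is stated for n at least a threshold depending only on the constant s; without this it fails, e.g. for s = n = 2, c = 0, where x* is constant, so the updates only rescale the matrix and cannot shrink E while keeping Σ ⪰ (1−ℓ)I. *)

theory Defs
  imports
    "HOL-Probability.Probability"
    "Jordan_Normal_Form.DL_Rank"
begin

text \<open>
  The dimensions \<open>m\<close> and \<open>n\<close> are natural numbers, not types, because the constants of the final
  statement have to be chosen uniformly in them.  Matrices and vectors are therefore those of
  \<open>Jordan_Normal_Form\<close>, with 0-based indices.
\<close>

section \<open>Matrix notions\<close>

text \<open>The three norms are only meant for matrices with at least one row and one column.\<close>

definition norm_one :: "real mat \<Rightarrow> real" where
  "norm_one M = Max ((\<lambda>j. \<Sum>i<dim_row M. \<bar>M $$ (i, j)\<bar>) ` {..<dim_col M})"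

definition norm_infty :: "real mat \<Rightarrow> real" where
  "norm_infty M = Max ((\<lambda>i. \<Sum>j<dim_col M. \<bar>M $$ (i, j)\<bar>) ` {..<dim_row M})"

definition norm_s :: "real mat \<Rightarrow> real" where
  "norm_s M = max (norm_one M) (norm_infty M)"

definition zero_diagonal :: "real mat \<Rightarrow> bool" where
  "zero_diagonal M \<longleftrightarrow> (\<forall>i. i < dim_row M \<longrightarrow> i < dim_col M \<longrightarrow> M $$ (i, i) = 0)"

text \<open>
  The order \<open>\<succeq>\<close> on symmetric matrices: the difference is positive semidefinite.  The order
  \<open>\<le>\<close> of the library on matrices is the entrywise one.
\<close>

definition loewner_ge :: "real mat \<Rightarrow> real mat \<Rightarrow> bool" where
  "loewner_ge A B \<longleftrightarrow>
     (\<exists>n. A \<in> carrier_mat n n \<and> B \<in> carrier_mat n n \<and>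
          transpose_mat (A - B) = A - B \<and>
          (\<forall>v\<in>carrier_vec n. 0 \<le> v \<bullet> ((A - B) *\<^sub>v v)))"

text \<open>The independence notion of the library is about sets, so repeated columns are excluded.\<close>

definition lin_indpt_cols :: "real mat \<Rightarrow> bool" where
  "lin_indpt_cols A \<longleftrightarrow>
     distinct (cols A) \<and>
     LinearCombinations.module.lin_indpt class_ring (module_vec TYPE(real) (dim_row A))
       (set (cols A))"

definition is_min_left_inverse :: "real mat \<Rightarrow> real mat \<Rightarrow> bool" where
  "is_min_left_inverse A P \<longleftrightarrow>
     P \<in> carrier_mat (dim_col A) (dim_row A) \<and> P * A = 1\<^sub>m (dim_col A) \<and>
     (\<forall>Q\<in>carrier_mat (dim_col A) (dim_row A).
        Q * A = 1\<^sub>m (dim_col A) \<longrightarrow> norm_infty P \<le> norm_infty Q)"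


section \<open>Data model\<close>

text \<open>
  The data model is given by the joint law \<open>D\<close> of the pair consisting of the code and the noise.
  Vectors of random coordinates live in the product spaces \<open>\<Pi>\<^sub>M i\<in>{..<n}. borel\<close>.  Working with the
  law loses no generality, and unlike an arbitrary probability space it does not involve a type
  parameter on which the constants of the final statement could depend.
\<close>

type_synonym latent = "(nat \<Rightarrow> real) \<times> (nat \<Rightarrow> real)"

definition latent_space :: "nat \<Rightarrow> nat \<Rightarrow> latent measure" where
  "latent_space n m = (\<Pi>\<^sub>M i\<in>{..<n}. borel) \<Otimes>\<^sub>M (\<Pi>\<^sub>M i\<in>{..<m}. borel)"

definition latent_law :: "nat \<Rightarrow> nat \<Rightarrow> latent measure \<Rightarrow> bool" where
  "latent_law n m D \<longleftrightarrow> prob_space D \<and> sets D = sets (latent_space n m)"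

definition data_point :: "real mat \<Rightarrow> latent \<Rightarrow> real vec" where
  "data_point Astar \<omega> =
     Astar *\<^sub>v Matrix.vec (dim_col Astar) (fst \<omega>) + Matrix.vec (dim_row Astar) (snd \<omega>)"

definition bernoulli_code :: "nat \<Rightarrow> real \<Rightarrow> latent measure \<Rightarrow> bool" where
  "bernoulli_code n s D \<longleftrightarrow>
     prob_space.indep_vars D (\<lambda>_. borel) (\<lambda>i \<omega>. fst \<omega> i) {..<n} \<and>
     (\<forall>i<n. measure D {\<omega> \<in> space D. fst \<omega> i = 1} = s / real n \<and>
            measure D {\<omega> \<in> space D. fst \<omega> i = 0} = 1 - s / real n)"

text \<open>
  The conditional expectation given the code is the one given the sigma-algebra that the code
  generates.
\<close>

definition unbiased_noise :: "nat \<Rightarrow> nat \<Rightarrow> real \<Rightarrow> latent measure \<Rightarrow> bool" where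
  "unbiased_noise n m C D \<longleftrightarrow>
     (AE \<omega> in D. \<forall>i<m. \<bar>snd \<omega> i\<bar> \<le> C) \<and>
     (\<forall>i<m. AE \<omega> in D.
        real_cond_exp D (vimage_algebra (space D) fst (\<Pi>\<^sub>M i\<in>{..<n}. borel))
          (\<lambda>\<omega>. snd \<omega> i) \<omega> = 0)"

definition initialization ::
  "real mat \<Rightarrow> real \<Rightarrow> real mat \<Rightarrow> real mat \<Rightarrow> real mat \<Rightarrow> real mat \<Rightarrow> bool" where
  "initialization Astar l A0 \<Sigma> E N \<longleftrightarrow>
     (let m = dim_row Astar; n = dim_col Astar in
        \<Sigma> \<in> carrier_mat n n \<and> E \<in> carrier_mat n n \<and> N \<in> carrier_mat m n \<and>
        A0 = Astar * (\<Sigma> + E) + N \<and>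
        diagonal_mat \<Sigma> \<and> zero_diagonal E \<and>
        loewner_ge \<Sigma> ((1 - l) \<cdot>\<^sub>m 1\<^sub>m n) \<and> norm_s E \<le> l)"


section \<open>Purification algorithm\<close>

definition relu :: "real \<Rightarrow> real \<Rightarrow> real" where
  "relu \<alpha> z = max (z - \<alpha>) 0"

definition decode :: "real \<Rightarrow> real mat \<Rightarrow> real vec \<Rightarrow> real vec" where
  "decode \<alpha> P y = map_vec (relu \<alpha>) (P *\<^sub>v y)"

text \<open>
  The empirical expectation of \<open>(y - y') (x - x')\<^sup>T\<close> over two independent uniform draws from the
  \<open>N\<close> examples, i.e. the average over all \<open>N\<^sup>2\<close> ordered pairs.
\<close>

definition empirical_corr ::
  "nat \<Rightarrow> nat \<Rightarrow> nat \<Rightarrow> (nat \<Rightarrow> real vec) \<Rightarrow> (nat \<Rightarrow> real vec) \<Rightarrow> real mat" where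
  "empirical_corr m n N y x =
     Matrix.mat m n (\<lambda>(i, j).
       (\<Sum>k<N. \<Sum>l<N. (y k - y l) $ i * (x k - x l) $ j) / (real N)\<^sup>2)"

definition purification_step ::
  "real \<Rightarrow> real \<Rightarrow> real \<Rightarrow> nat \<Rightarrow> real mat \<Rightarrow> real mat \<Rightarrow> (nat \<Rightarrow> real vec) \<Rightarrow> real mat" where
  "purification_step \<alpha> \<eta> r N A P y =
     (1 - \<eta>) \<cdot>\<^sub>m A +
     (r * \<eta>) \<cdot>\<^sub>m empirical_corr (dim_row A) (dim_col A) N y (\<lambda>k. decode \<alpha> P (y k))"

text \<open>
  A minimum-norm left inverse need not be unique, so a run of the algorithm is a relation:
  \<open>purification \<alpha> \<eta> r N A0 y t A\<close> means that \<open>A\<close> can be the iterate after \<open>t\<close> iterations, where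
  \<open>y t 0, \<dots>, y t (N - 1)\<close> are the examples drawn in iteration \<open>t\<close>.
\<close>

inductive purification ::
  "real \<Rightarrow> real \<Rightarrow> real \<Rightarrow> nat \<Rightarrow> real mat \<Rightarrow> (nat \<Rightarrow> nat \<Rightarrow> real vec) \<Rightarrow> nat \<Rightarrow> real mat \<Rightarrow> bool"
  for \<alpha> \<eta> r :: real and N :: nat and A0 :: "real mat" and y :: "nat \<Rightarrow> nat \<Rightarrow> real vec"
  where
    start: "purification \<alpha> \<eta> r N A0 y 0 A0"
  | step: "purification \<alpha> \<eta> r N A0 y t A \<Longrightarrow> is_min_left_inverse A P \<Longrightarrow>
           purification \<alpha> \<eta> r N A0 y (Suc t) (purification_step \<alpha> \<eta> r N A P (y t))"

definition purified :: "real mat \<Rightarrow> real \<Rightarrow> real \<Rightarrow> real \<Rightarrow> real mat \<Rightarrow> bool" where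
  "purified Astar l e c A \<longleftrightarrow>
     (let m = dim_row Astar; n = dim_col Astar in
        \<exists>\<Sigma> E N.
          \<Sigma> \<in> carrier_mat n n \<and> E \<in> carrier_mat n n \<and> N \<in> carrier_mat m n \<and>
          A = Astar * (\<Sigma> + E) + N \<and>
          diagonal_mat \<Sigma> \<and> zero_diagonal E \<and>
          loewner_ge \<Sigma> ((1 - l) \<cdot>\<^sub>m 1\<^sub>m n) \<and> norm_one E \<le> e \<and> norm_one N \<le> c)"

text \<open>
  The law of the latent variables behind the \<open>N\<close> fresh i.i.d. examples of each of the \<open>T\<close>
  iterations.
\<close>

definition sample_law :: "latent measure \<Rightarrow> nat \<Rightarrow> nat \<Rightarrow> (nat \<times> nat \<Rightarrow> latent) measure" where
  "sample_law D T N = (\<Pi>\<^sub>M tk\<in>{..<T} \<times> {..<N}. D)"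

text \<open>
  With probability at least \<open>p\<close>, the algorithm never gets stuck (a minimum-norm left inverse exists
  in each iteration) and all its possible outputs after \<open>T\<close> iterations satisfy \<open>Q\<close>.  The set of
  samples with this property need not be measurable, hence the measurable subset \<open>S\<close>.
\<close>

definition purification_succeeds ::
  "real mat \<Rightarrow> latent measure \<Rightarrow> real \<Rightarrow> real \<Rightarrow> real \<Rightarrow> nat \<Rightarrow> real mat \<Rightarrow> nat \<Rightarrow>
   (real mat \<Rightarrow> bool) \<Rightarrow> real \<Rightarrow> bool" where
  "purification_succeeds Astar D \<alpha> \<eta> r N A0 T Q p \<longleftrightarrow>
     (\<exists>S\<in>sets (sample_law D T N).
        measure (sample_law D T N) S \<ge> p \<and>
        (\<forall>\<omega>\<in>S. let run = purification \<alpha> \<eta> r N A0 (\<lambda>t k. data_point Astar (\<omega> (t, k))) in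
           (\<forall>t<T. \<forall>A. run t A \<longrightarrow> (\<exists>P. is_min_left_inverse A P)) \<and>
           (\<forall>A. run T A \<longrightarrow> Q A)))"

end

theory Submission
  imports Defs
begin

text \<open>
  Take \<open>\<alpha> = 1/5\<close>, \<open>\<eta> = 1/10\<close>, \<open>r = n/s\<close>, and write an iterate as \<open>A = A\<^sup>*(\<Sigma> + E) + R\<close> with decoding
  matrix \<open>W = P A\<^sup>*\<close>.  Since \<open>W(\<Sigma> + E) = I - P R\<close> and \<open>E\<close> is small in both norms, the off-diagonal
  row and column sums of \<open>W\<close> are \<open>O(\<parallel>E\<parallel>\<^sub>s)\<close>, and the threshold makes the decoded coordinate \<open>x\<^sub>j\<close>
  vanish whenever the true one does.  Hence the covariance of \<open>x\<^sub>i\<^sup>*\<close> and \<open>x\<^sub>j\<close> is of order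
  \<open>(s/n)\<^sup>2 \<bar>W\<^sub>j\<^sub>i\<bar>\<close> for \<open>i \<noteq> j\<close>, but of order \<open>s/n\<close> for \<open>i = j\<close>: after multiplication by \<open>r\<close> the off-diagonal
  part contracts geometrically while the diagonal is kept above \<open>9/10\<close>.  As the noise has conditional
  mean zero, it correlates with \<open>x\<^sub>j\<close> only through its own effect on the decoding, which is of order
  \<open>c/\<surd>n\<close>; this keeps \<open>R\<close> small.

  The decoding matrix depends on the earlier samples and on the choice of the pseudo-inverse, so the
  samples have to be representative for all decoding matrices at once.  This follows from
  Hoeffding's inequality on a grid of ReLU units.
\<close>

text \<open>The update transposes: entry (\<open>h\<close>, \<open>j\<close>) of the new
  off-diagonal part is driven by \<open>W j h\<close>, so row sums of the next \<open>E\<close> are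
  governed by column sums of \<open>W\<close>, and conversely. Hence the invariant bounds
  \<open>E\<close> in both norms, although the conclusion speaks of column sums alone. Row sums of
  \<open>W\<close> are also what the threshold 1/5 must dominate. The diagonal of \<Sigma> is
  bounded only from below, so \<open>W j j\<close> may be tiny and coordinate \<open>j\<close> may
  be decoded as 0. A large \<open>S j\<close> can then afford to shrink by the factor 9/10, whereas
  a small one forces \<open>W j j\<close> to be near 1; this is the dichotomy at 26/25. The minimum
  norm serves to compare \<open>P\<close> with an explicit left inverse X \<open>Adag\<close> of the
  iterate, where X inverts the nearly diagonal matrix \<open>Adag * A\<close>. This bounds
  \<open>P\<close> by twice \<open>norm_infty Adag\<close>, and with it the noise in every decoded
  coordinate. That noise adds a term of order c s / sqrt n to each row and column of the
  off-diagonal part, since n entries of order (s/n) c / sqrt n are summed. Therefore n has to be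
  large in terms of s, beyond making s/n small.\<close>

section \<open>Uniform concentration of ReLU units\<close>

lemma sample_mean_concentration:
  fixes D :: "'a measure" and f :: "'a \<Rightarrow> real" and I :: "'b set"
  assumes D: "prob_space D" and I: "finite I" and J: "J \<subseteq> I" "J \<noteq> {}"
    and f[measurable]: "f \<in> borel_measurable D" and B: "\<And>x. x \<in> space D \<Longrightarrow> \<bar>f x\<bar> \<le> B" and "B > 0" "\<tau> \<ge> 0"
  shows "measure (\<Pi>\<^sub>M i\<in>I. D) {\<omega> \<in> space (\<Pi>\<^sub>M i\<in>I. D).
            \<bar>(\<Sum>i\<in>J. f (\<omega> i)) - real (card J) * (\<integral>x. f x \<partial>D)\<bar> \<ge> real (card J) * \<tau>}
         \<le> 2 * exp (- (real (card J) * \<tau>\<^sup>2 / (2 * B\<^sup>2)))"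
proof -
  interpret D: prob_space D by fact
  interpret P: product_prob_space "\<lambda>_. D" I by unfold_locales
  have fJ: "finite J" using I J finite_subset by blast
  have cJ: "card J > 0" using fJ J by (simp add: card_gt_0_iff)
  have e: "(\<integral>\<omega>. f (\<omega> i) \<partial>(\<Pi>\<^sub>M i\<in>I. D)) = (\<integral>x. f x \<partial>D)" if "i \<in> J" for i
  proof -
    have iI: "i \<in> I" using that J by auto
    have "(\<integral>x. f x \<partial>D) = (\<integral>x. f x \<partial>(distr (\<Pi>\<^sub>M i\<in>I. D) D (\<lambda>\<omega>. \<omega> i)))"
      using P.PiM_component[OF iI] by simp
    also have "\<dots> = (\<integral>\<omega>. f (\<omega> i) \<partial>(\<Pi>\<^sub>M i\<in>I. D))"
      using iI by (intro integral_distr) auto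
    finally show ?thesis by simp
  qed
  \<comment> \<open>Independence amounts to equality of the joint law with the product of the
    marginals, and for the coordinates of a product measure both are the product measure itself. The
    criterion wants a nonempty index set; the fact that supplies it merely happens to be named
    \<open>False\<close>.\<close>
  have ind0: "P.indep_vars (\<lambda>_. D) (\<lambda>i \<omega>. \<omega> i) I"
  proof -
    have False: "I \<noteq> {}" using J by auto
    have "distr (\<Pi>\<^sub>M i\<in>I. D) (\<Pi>\<^sub>M i\<in>I. D) (\<lambda>x. \<lambda>i\<in>I. x i) = distr (\<Pi>\<^sub>M i\<in>I. D) (\<Pi>\<^sub>M i\<in>I. D) (\<lambda>x. x)"
      by (intro distr_cong) (auto simp: space_PiM PiE_restrict)
    moreover have "(\<Pi>\<^sub>M i\<in>I. distr (\<Pi>\<^sub>M i\<in>I. D) D (\<lambda>\<omega>. \<omega> i)) = (\<Pi>\<^sub>M i\<in>I. D)"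
      by (intro PiM_cong refl distr_PiM_component D) auto
    ultimately show ?thesis
      by (subst P.indep_vars_iff_distr_eq_PiM'[OF False]) auto
  qed
  have ind1: "P.indep_vars (\<lambda>_. borel) (\<lambda>i \<omega>. f (\<omega> i)) J"
    by (rule P.indep_vars_compose2[OF P.indep_vars_subset[OF ind0 J(1)]]) simp
  interpret H: Hoeffding_ineq "\<Pi>\<^sub>M i\<in>I. D" J "\<lambda>i \<omega>. f (\<omega> i)" "\<lambda>_. -B" "\<lambda>_. B" "\<Sum>i\<in>J. (\<integral>\<omega>. f (\<omega> i) \<partial>(\<Pi>\<^sub>M i\<in>I. D))"
  proof (unfold_locales)
    show "finite J" by fact
    show "P.indep_vars (\<lambda>_. borel) (\<lambda>i \<omega>. f (\<omega> i)) J" by fact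
    fix i assume i: "i \<in> J"
    show "AE \<omega> in Pi\<^sub>M I (\<lambda>_. D). f (\<omega> i) \<in> {- B..B}"
    proof (rule AE_I2)
      fix \<omega> assume "\<omega> \<in> space (Pi\<^sub>M I (\<lambda>_. D))"
      then have "\<omega> i \<in> space D" using i J by (auto simp: space_PiM)
      from B[OF this] show "f (\<omega> i) \<in> {- B..B}" by auto
    qed
  qed simp
  have mu: "(\<Sum>i\<in>J. (\<integral>\<omega>. f (\<omega> i) \<partial>(\<Pi>\<^sub>M i\<in>I. D))) = real (card J) * (\<integral>x. f x \<partial>D)"
    using e by simp
  have s: "(\<Sum>i\<in>J. (B - - B)\<^sup>2) = real (card J) * (4 * B\<^sup>2)" by (simp add: power2_eq_square)
  have "(\<Sum>i\<in>J. (B - - B)\<^sup>2) > 0" unfolding s using cJ \<open>B > 0\<close> by simp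
  from H.Hoeffding_ineq_abs_ge[OF _ this, of "real (card J) * \<tau>"] \<open>\<tau> \<ge> 0\<close>
  have "measure (\<Pi>\<^sub>M i\<in>I. D) {\<omega> \<in> space (\<Pi>\<^sub>M i\<in>I. D).
            \<bar>(\<Sum>i\<in>J. f (\<omega> i)) - real (card J) * (\<integral>x. f x \<partial>D)\<bar> \<ge> real (card J) * \<tau>}
         \<le> 2 * exp (- 2 * (real (card J) * \<tau>)\<^sup>2 / (real (card J) * (4 * B\<^sup>2)))"
    unfolding mu s by simp
  also have "- 2 * (real (card J) * \<tau>)\<^sup>2 / (real (card J) * (4 * B\<^sup>2)) = - (real (card J) * \<tau>\<^sup>2 / (2 * B\<^sup>2))"
    using cJ \<open>B > 0\<close> by (simp add: field_simps power2_eq_square)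
  finally show ?thesis .
qed

text \<open>Union bound over the \<open>T\<close> iterations and the members of \<open>F\<close>.
  Each average belongs to one iteration, so Hoeffding's inequality is applied to the slice of index
  pairs with first component \<open>t\<close>. The almost sure set \<open>D0\<close> is built into
  the good event, so that later arguments can be pointwise on the samples.\<close>

lemma finite_family_concentration:
  fixes D :: "'a measure" and F :: "('a \<Rightarrow> real) set"
  assumes D: "prob_space D" and F: "finite F" "\<And>f. f \<in> F \<Longrightarrow> f \<in> borel_measurable D"
    and B: "\<And>f x. f \<in> F \<Longrightarrow> x \<in> space D \<Longrightarrow> \<bar>f x\<bar> \<le> B" and "B > 0" "\<tau> > 0" "N > 0"
    and D0: "D0 \<in> sets D" "AE x in D. x \<in> D0"
    and bound: "2 * real T * real (card F) * exp (- (real N * \<tau>\<^sup>2 / (2 * B\<^sup>2))) \<le> \<delta>"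
  shows "\<exists>S\<in>sets (\<Pi>\<^sub>M tk\<in>{..<T} \<times> {..<N}. D). measure (\<Pi>\<^sub>M tk\<in>{..<T} \<times> {..<N}. D) S \<ge> 1 - \<delta> \<and>
           (\<forall>\<omega>\<in>S. \<forall>t<T. (\<forall>k<N. \<omega> (t, k) \<in> D0) \<and>
              (\<forall>f\<in>F. \<bar>(\<Sum>k<N. f (\<omega> (t, k))) / real N - (\<integral>x. f x \<partial>D)\<bar> \<le> \<tau>))"
proof -
  let ?I = "{..<T} \<times> {..<N}"
  let ?P = "\<Pi>\<^sub>M tk\<in>?I. D"
  interpret D: prob_space D by fact
  interpret P: product_prob_space "\<lambda>_. D" ?I by unfold_locales
  define bad where "bad t f = {\<omega> \<in> space ?P.
      \<bar>(\<Sum>k<N. f (\<omega> (t, k))) - real N * (\<integral>x. f x \<partial>D)\<bar> \<ge> real N * \<tau>}" for t f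
  have bad_sets: "bad t f \<in> sets ?P" if "t < T" "f \<in> F" for t f
  proof -
    have [measurable]: "f \<in> borel_measurable D" using F that by auto
    have [measurable]: "(\<lambda>\<omega>. \<omega> (t, k)) \<in> measurable ?P D" if "k \<in> {..<N}" for k
      using that \<open>t < T\<close> by (intro measurable_component_singleton) auto
    show ?thesis unfolding bad_def by measurable
  qed
  have bad_le: "measure ?P (bad t f) \<le> 2 * exp (- (real N * \<tau>\<^sup>2 / (2 * B\<^sup>2)))" if "t < T" "f \<in> F" for t f
  proof -
    have inj: "inj_on (Pair t) {..<N}" by (auto simp: inj_on_def)
    have c: "card (Pair t ` {..<N}) = N" using card_image[OF inj] by simp
    have s: "(\<Sum>i\<in>Pair t ` {..<N}. f (\<omega> i)) = (\<Sum>k<N. f (\<omega> (t, k)))" for \<omega>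
      by (subst sum.reindex[OF inj]) simp
    have "measure (\<Pi>\<^sub>M i\<in>?I. D) {\<omega> \<in> space (\<Pi>\<^sub>M i\<in>?I. D).
            \<bar>(\<Sum>i\<in>Pair t ` {..<N}. f (\<omega> i)) - real (card (Pair t ` {..<N})) * (\<integral>x. f x \<partial>D)\<bar>
              \<ge> real (card (Pair t ` {..<N})) * \<tau>}
         \<le> 2 * exp (- (real (card (Pair t ` {..<N})) * \<tau>\<^sup>2 / (2 * B\<^sup>2)))"
      by (rule sample_mean_concentration[OF D]) (use that F B \<open>B > 0\<close> \<open>\<tau> > 0\<close> \<open>N > 0\<close> in auto)
    then show ?thesis unfolding c s bad_def .
  qed
  define Bad where "Bad = (\<Union>p\<in>{..<T} \<times> F. bad (fst p) (snd p))"
  have Bad_sets: "Bad \<in> sets ?P" unfolding Bad_def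
    by (intro sets.finite_UN) (use F bad_sets in auto)
  have "measure ?P Bad \<le> (\<Sum>p\<in>{..<T} \<times> F. measure ?P (bad (fst p) (snd p)))"
    unfolding Bad_def by (intro P.finite_measure_subadditive_finite) (use F bad_sets in auto)
  also have "\<dots> \<le> (\<Sum>p\<in>{..<T} \<times> F. 2 * exp (- (real N * \<tau>\<^sup>2 / (2 * B\<^sup>2))))"
    by (intro sum_mono) (use bad_le in auto)
  also have "\<dots> = 2 * real T * real (card F) * exp (- (real N * \<tau>\<^sup>2 / (2 * B\<^sup>2)))"
    by (simp add: card_cartesian_product)
  finally have Bad_le: "measure ?P Bad \<le> \<delta>" using bound by simp
  define G where "G = {\<omega> \<in> space ?P. \<forall>i\<in>?I. \<omega> i \<in> D0}"
  have G_sets: "G \<in> sets ?P"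
    unfolding G_def
    by (intro sets.sets_Collect_finite_All measurable_sets_Collect[OF measurable_component_singleton]) (use D0 in auto)
  have "AE \<omega> in ?P. \<forall>i\<in>?I. \<omega> i \<in> D0"
    by (intro AE_finite_allI AE_PiM_component D D0) auto
  then have "AE \<omega> in ?P. \<omega> \<in> G" by (rule AE_mp) (auto simp: G_def)
  then have G1: "measure ?P G = 1" using P.prob_eq_1[OF G_sets] by simp
  have "measure ?P (G - Bad) \<ge> measure ?P G - measure ?P Bad"
  proof -
    have "measure ?P G \<le> measure ?P (G - Bad) + measure ?P Bad"
      using P.finite_measure_mono[of G "(G - Bad) \<union> Bad"] measure_Un_le[of "G - Bad" ?P Bad] G_sets Bad_sets
      by auto
    then show ?thesis by simp
  qed
  with G1 Bad_le have 1: "measure ?P (G - Bad) \<ge> 1 - \<delta>" by simp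
  show ?thesis
  proof (intro bexI[of _ "G - Bad"] conjI 1 ballI allI impI)
    show "G - Bad \<in> sets ?P" using G_sets Bad_sets by auto
    fix \<omega> t assume \<omega>: "\<omega> \<in> G - Bad" and t: "t < T"
    show "\<omega> (t, k) \<in> D0" if "k < N" for k using \<omega> t that by (auto simp: G_def)
    fix f assume f: "f \<in> F"
    have "\<omega> \<notin> bad t f" using \<omega> t f by (force simp: Bad_def)
    moreover have "\<omega> \<in> space ?P" using \<omega> by (auto simp: G_def)
    ultimately have "\<bar>(\<Sum>k<N. f (\<omega> (t, k))) - real N * (\<integral>x. f x \<partial>D)\<bar> < real N * \<tau>"
      by (auto simp: bad_def)
    then have "\<bar>(\<Sum>k<N. f (\<omega> (t, k))) - real N * (\<integral>x. f x \<partial>D)\<bar> / real N \<le> \<tau>"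
      using \<open>N > 0\<close> by (simp add: field_simps)
    then show "\<bar>(\<Sum>k<N. f (\<omega> (t, k))) / real N - (\<integral>x. f x \<partial>D)\<bar> \<le> \<tau>"
      using \<open>N > 0\<close> by (simp add: abs_if field_simps split: if_splits)
  qed
qed

section \<open>ReLU units and their discretisation\<close>

lemma relu_nonneg: "0 \<le> relu \<alpha> y" by (simp add: relu_def)

lemma relu_lipschitz: "\<bar>relu \<alpha> y - relu \<alpha> z\<bar> \<le> \<bar>y - z\<bar>" by (auto simp: relu_def)

lemma relu_le_abs: "0 \<le> \<alpha> \<Longrightarrow> relu \<alpha> y \<le> \<bar>y\<bar>" by (auto simp: relu_def)

lemma relu_abs_le: "0 \<le> \<alpha> \<Longrightarrow> \<bar>relu \<alpha> y\<bar> \<le> \<bar>y\<bar>" by (auto simp: relu_def)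

lemma measurable_relu[measurable]: "relu \<alpha> \<in> borel_measurable borel"
  unfolding relu_def[abs_def] by measurable

text \<open>A unit is Lipschitz in its weights, uniformly over inputs from [-1, 1]. This is what
  lets control on a finite grid of weights extend to all weights.\<close>

lemma relu_units_perturb:
  assumes "\<And>i. i < M \<Longrightarrow> \<bar>\<theta> i - \<theta>' i\<bar> \<le> h" "\<And>i. i < M \<Longrightarrow> \<bar>z i\<bar> \<le> 1"
  shows "\<bar>relu \<alpha> (\<Sum>i<M. \<theta> i * z i) - relu \<alpha> (\<Sum>i<M. \<theta>' i * z i)\<bar> \<le> real M * h"
proof -
  have "\<bar>relu \<alpha> (\<Sum>i<M. \<theta> i * z i) - relu \<alpha> (\<Sum>i<M. \<theta>' i * z i)\<bar> \<le> \<bar>(\<Sum>i<M. \<theta> i * z i) - (\<Sum>i<M. \<theta>' i * z i)\<bar>"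
    by (rule relu_lipschitz)
  also have "\<dots> = \<bar>\<Sum>i<M. (\<theta> i - \<theta>' i) * z i\<bar>" by (simp add: sum_subtractf left_diff_distrib)
  also have "\<dots> \<le> (\<Sum>i<M. \<bar>(\<theta> i - \<theta>' i) * z i\<bar>)" by (rule sum_abs)
  also have "\<dots> \<le> (\<Sum>i<M. h)"
  proof (rule sum_mono)
    fix i assume "i \<in> {..<M}"
    then have "\<bar>\<theta> i - \<theta>' i\<bar> * \<bar>z i\<bar> \<le> h * 1" using assms by (intro mult_mono) force+
    then show "\<bar>(\<theta> i - \<theta>' i) * z i\<bar> \<le> h" by (simp add: abs_mult)
  qed
  finally show ?thesis by simp
qed

lemma relu_unit_bound:
  assumes "0 \<le> \<alpha>" "\<And>i. i < M \<Longrightarrow> \<bar>\<theta> i\<bar> \<le> b" "\<And>i. i < M \<Longrightarrow> \<bar>z i\<bar> \<le> 1"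
  shows "\<bar>relu \<alpha> (\<Sum>i<M. \<theta> i * z i)\<bar> \<le> real M * b"
  using relu_units_perturb[of M \<theta> "\<lambda>_. 0" b z \<alpha>] assms by (simp add: relu_def)

text \<open>Each weight is rounded down to a multiple of \<open>h\<close>. The \<open>+ 1\<close> in
  the bound on \<open>K\<close> absorbs the floor, which can undershoot - 2 / h by up to 1.\<close>

lemma grid_approximation:
  fixes h :: real
  assumes h: "0 < h" and K: "2 / h + 1 \<le> real K" and \<theta>: "\<And>i. i < M \<Longrightarrow> \<bar>\<theta> i\<bar> \<le> 2"
  obtains g where "g \<in> {..<M} \<rightarrow>\<^sub>E {- int K..int K}" "\<And>i. i < M \<Longrightarrow> \<bar>\<theta> i - h * of_int (g i)\<bar> \<le> h"
proof
  let ?g = "\<lambda>i\<in>{..<M}. \<lfloor>\<theta> i / h\<rfloor>"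
  show "?g \<in> {..<M} \<rightarrow>\<^sub>E {- int K..int K}"
  proof -
    have "- int K \<le> \<lfloor>\<theta> i / h\<rfloor> \<and> \<lfloor>\<theta> i / h\<rfloor> \<le> int K" if i: "i < M" for i
    proof -
      have "\<bar>\<theta> i / h\<bar> \<le> 2 / h" using \<theta>[OF i] h by (simp add: divide_right_mono)
      then have "- real K + 1 \<le> \<theta> i / h" "\<theta> i / h \<le> real K - 1" using K by linarith+
      then show ?thesis by linarith
    qed
    then show ?thesis by auto
  qed
  fix i assume i: "i < M"
  have "h * of_int \<lfloor>\<theta> i / h\<rfloor> \<le> \<theta> i" "\<theta> i < h * of_int \<lfloor>\<theta> i / h\<rfloor> + h"
    using floor_divide_lower[OF h, of "\<theta> i"] floor_divide_upper[OF h, of "\<theta> i"] by (simp_all add: algebra_simps)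
  then show "\<bar>\<theta> i - h * of_int (?g i)\<bar> \<le> h" using i by simp
qed


text \<open>The tolerance is spent in three equal parts: Hoeffding deviation at a grid point, and
  the passage to the grid point once in the expectation and once in the sample mean. With mesh
  \<tau> / (3 M) a grid axis has 2 K + 1 <= 12 M / \<tau> + 5 <= 17 M / \<tau> points, which gives
  the base of the power. The grid stays within 3 in each coordinate, so the functions are bounded by
  3 M, and (\<tau>/3)^2 / (2 (3 M)^2) is the exponent with 162.\<close>

lemma relu_units_concentration:
  fixes D :: "'a measure" and z :: "nat \<Rightarrow> 'a \<Rightarrow> real"
  assumes D: "prob_space D" and z: "\<And>i. i < M \<Longrightarrow> z i \<in> borel_measurable D"
    and z1: "\<And>i x. i < M \<Longrightarrow> x \<in> space D \<Longrightarrow> \<bar>z i x\<bar> \<le> 1"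
    and D0: "D0 \<in> sets D" "AE x in D. x \<in> D0"
    and "0 \<le> \<alpha>" "M > 0" "N > 0" "0 < \<tau>" "\<tau> \<le> 1"
    and bound: "6 * real T * real M * (17 * real M / \<tau>) ^ M * exp (- (real N * \<tau>\<^sup>2 / (162 * (real M)\<^sup>2))) \<le> \<delta>"
  defines "u \<equiv> \<lambda>\<theta> x. relu \<alpha> (\<Sum>i<M. \<theta> i * z i x)"
  defines "near \<equiv> \<lambda>\<omega> t f. \<bar>(\<Sum>k<N. f (\<omega> (t, k))) / real N - (\<integral>x. f x \<partial>D)\<bar> \<le> \<tau>"
  shows "\<exists>S\<in>sets (\<Pi>\<^sub>M tk\<in>{..<T} \<times> {..<N}. D). measure (\<Pi>\<^sub>M tk\<in>{..<T} \<times> {..<N}. D) S \<ge> 1 - \<delta> \<and>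
           (\<forall>\<omega>\<in>S. \<forall>t<T. (\<forall>k<N. \<omega> (t, k) \<in> D0) \<and> (\<forall>i<M. near \<omega> t (z i)) \<and>
              (\<forall>\<theta>. (\<forall>i<M. \<bar>\<theta> i\<bar> \<le> 2) \<longrightarrow>
                 near \<omega> t (u \<theta>) \<and> (\<forall>i<M. near \<omega> t (\<lambda>x. z i x * u \<theta> x))))"
proof -
  interpret D: prob_space D by fact
  note [measurable] = z
  define h where "h = \<tau> / (3 * real M)"
  define K where "K = nat \<lceil>2 / h\<rceil> + 1"
  have h: "0 < h" "h \<le> 1/3" using \<open>M > 0\<close> \<open>0 < \<tau>\<close> \<open>\<tau> \<le> 1\<close> by (auto simp: h_def field_simps)
  have Mh: "real M * h = \<tau> / 3" using \<open>M > 0\<close> by (simp add: h_def)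
  have K: "2 / h + 1 \<le> real K" "real K \<le> 2 / h + 2" using h by (auto simp: K_def) linarith+
  \<comment> \<open>The index \<open>M\<close> encodes the constant factor 1, so that the units and
    their products with a coordinate form a single family.\<close>
  define w where "w b x = (if b < M then z b x else 1)" for b x
  have w_meas[measurable]: "w b \<in> borel_measurable D" for b
    by (cases "b < M") (simp_all add: w_def[abs_def])
  have w1: "\<bar>w b x\<bar> \<le> 1" if "x \<in> space D" for b x using z1 that by (auto simp: w_def)
  define net where "net = {..<M} \<rightarrow>\<^sub>E {- int K..int K}"
  define \<Theta> where "\<Theta> g i = h * of_int (g i)" for g :: "nat \<Rightarrow> int" and i :: nat
  define F where "F = z ` {..<M} \<union> (\<lambda>(b, g) x. w b x * u (\<Theta> g) x) ` ({..M} \<times> net)"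
  have net: "finite net" "card net = (2 * K + 1) ^ M"
    unfolding net_def by (auto intro!: finite_PiE simp: card_PiE nat_add_distrib nat_mult_distrib)
  have F_fin: "finite F" using net by (auto simp: F_def)
  have u_meas: "u \<theta> \<in> borel_measurable D" for \<theta>
    unfolding u_def by measurable
  note [measurable] = u_meas
  have \<Theta>_bound: "\<bar>\<Theta> g i\<bar> \<le> 3" if "g \<in> net" "i < M" for g i
  proof -
    have "\<bar>g i\<bar> \<le> int K" using that by (force simp: net_def PiE_iff abs_le_iff)
    then have "real_of_int \<bar>g i\<bar> \<le> real K" by linarith
    then have "h * \<bar>real_of_int (g i)\<bar> \<le> h * (2 / h + 2)" using K h by (intro mult_left_mono) auto
    also have "h * (2 / h + 2) \<le> 3" using h by (simp add: field_simps)
    finally show ?thesis using h by (simp add: \<Theta>_def abs_mult)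
  qed
  have u_bound: "\<bar>u \<theta> x\<bar> \<le> real M * b" if "\<And>i. i < M \<Longrightarrow> \<bar>\<theta> i\<bar> \<le> b" "x \<in> space D" for \<theta> x b
    unfolding u_def using that z1 \<open>0 \<le> \<alpha>\<close> by (intro relu_unit_bound) auto
  have F_bound: "\<bar>f x\<bar> \<le> 3 * real M" if f: "f \<in> F" and x: "x \<in> space D" for f x
  proof (cases "f \<in> z ` {..<M}")
    case True
    then show ?thesis using z1 x \<open>M > 0\<close> by fastforce
  next
    case False
    then obtain b g where bg: "g \<in> net" "f = (\<lambda>x. w b x * u (\<Theta> g) x)" using f by (auto simp: F_def)
    have "\<bar>w b x\<bar> * \<bar>u (\<Theta> g) x\<bar> \<le> 1 * (real M * 3)"
      by (intro mult_mono w1 u_bound x) (use \<Theta>_bound bg in auto)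
    then show ?thesis by (simp add: bg abs_mult)
  qed
  have F_card: "real (card F) \<le> 3 * real M * (17 * real M / \<tau>) ^ M"
  proof -
    let ?a = "(17 * real M / \<tau>) ^ M"
    have "card F \<le> card (z ` {..<M}) + card ((\<lambda>(b, g) x. w b x * u (\<Theta> g) x) ` ({..M} \<times> net))"
      unfolding F_def by (rule card_Un_le)
    also have "\<dots> \<le> card {..<M} + card ({..M} \<times> net)"
      using net by (intro add_mono card_image_le) auto
    also have "\<dots> = M + (M + 1) * (2 * K + 1) ^ M" using net by (simp add: card_cartesian_product)
    finally have "real (card F) \<le> real M + (real M + 1) * (2 * real K + 1) ^ M"
      by (subst (asm) of_nat_le_iff[where ?'a = real, symmetric]) (simp add: algebra_simps)
    also have "\<dots> \<le> real M * ?a + (real M + real M) * ?a"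
    proof (intro add_mono mult_mono power_mono)
      have "2 * real K + 1 \<le> 12 * real M / \<tau> + 5" using K \<open>M > 0\<close> \<open>\<tau> > 0\<close> by (simp add: h_def field_simps)
      also have "5 \<le> 5 * real M / \<tau>" using \<open>M > 0\<close> \<open>\<tau> > 0\<close> \<open>\<tau> \<le> 1\<close> by (simp add: field_simps)
      finally show "2 * real K + 1 \<le> 17 * real M / \<tau>" by (simp add: field_simps)
      have "1 \<le> 17 * real M / \<tau>" using \<open>M > 0\<close> \<open>\<tau> > 0\<close> \<open>\<tau> \<le> 1\<close> by (simp add: field_simps)
      then have "1 \<le> ?a" by (rule one_le_power)
      then show "real M \<le> real M * ?a" using mult_left_mono[of 1 ?a "real M"] by simp
    qed (use \<open>M > 0\<close> in auto)
    finally show ?thesis by simp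
  qed
  have "2 * real T * real (card F) * exp (- (real N * (\<tau> / 3)\<^sup>2 / (2 * (3 * real M)\<^sup>2))) 
    \<le> 2 * real T * (3 * real M * (17 * real M / \<tau>) ^ M) * exp (- (real N * (\<tau> / 3)\<^sup>2 / (2 * (3 * real M)\<^sup>2)))"
    using F_card by (intro mult_right_mono mult_left_mono) auto
  also have "\<dots> \<le> \<delta>" using bound by (simp add: power_divide power_mult_distrib mult_ac)
  finally have bd: "2 * real T * real (card F) * exp (- (real N * (\<tau> / 3)\<^sup>2 / (2 * (3 * real M)\<^sup>2))) \<le> \<delta>" .
  obtain S where S: "S\<in>sets (\<Pi>\<^sub>M tk\<in>{..<T} \<times> {..<N}. D)" "measure (\<Pi>\<^sub>M tk\<in>{..<T} \<times> {..<N}. D) S \<ge> 1 - \<delta>"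
    and S0: "\<And>\<omega> t k. \<omega> \<in> S \<Longrightarrow> t < T \<Longrightarrow> k < N \<Longrightarrow> \<omega> (t, k) \<in> D0"
    and SF: "\<And>\<omega> t f. \<omega> \<in> S \<Longrightarrow> t < T \<Longrightarrow> f \<in> F \<Longrightarrow> \<bar>(\<Sum>k<N. f (\<omega> (t, k))) / real N - (\<integral>x. f x \<partial>D)\<bar> \<le> \<tau> / 3"
  proof -
    have "f \<in> borel_measurable D" if "f \<in> F" for f
      using that z w_meas u_meas by (auto simp: F_def)
    then have "\<exists>S\<in>sets (\<Pi>\<^sub>M tk\<in>{..<T} \<times> {..<N}. D). measure (\<Pi>\<^sub>M tk\<in>{..<T} \<times> {..<N}. D) S \<ge> 1 - \<delta> \<and>
      (\<forall>\<omega>\<in>S. \<forall>t<T. (\<forall>k<N. \<omega> (t, k) \<in> D0) \<and>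
              (\<forall>f\<in>F. \<bar>(\<Sum>k<N. f (\<omega> (t, k))) / real N - (\<integral>x. f x \<partial>D)\<bar> \<le> \<tau> / 3))"
      by (intro finite_family_concentration[where B = "3 * real M"] D F_fin F_bound D0 bd)
        (use \<open>M > 0\<close> \<open>\<tau> > 0\<close> \<open>N > 0\<close> in auto)
    then show thesis using that by blast
  qed
  have D0_space: "x \<in> space D" if "x \<in> D0" for x using that D0 sets.sets_into_space by blast
  have key: "near \<omega> t (\<lambda>x. w b x * u \<theta> x)" if \<omega>: "\<omega> \<in> S" "t < T" "b \<le> M" and \<theta>: "\<forall>i<M. \<bar>\<theta> i\<bar> \<le> 2" for \<omega> t b \<theta>
  proof -
    obtain g where g: "g \<in> net" "\<And>i. i < M \<Longrightarrow> \<bar>\<theta> i - \<Theta> g i\<bar> \<le> h"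
      using grid_approximation[OF h(1) K(1), of M \<theta>] \<theta> unfolding net_def \<Theta>_def by blast
    let ?f = "\<lambda>x. w b x * u \<theta> x" and ?g = "\<lambda>x. w b x * u (\<Theta> g) x"
    have diff: "\<bar>?f x - ?g x\<bar> \<le> \<tau> / 3" if "x \<in> space D" for x
    proof -
      have "\<bar>u \<theta> x - u (\<Theta> g) x\<bar> \<le> real M * h"
        unfolding u_def using g z1 that by (intro relu_units_perturb) auto
      then have "\<bar>w b x\<bar> * \<bar>u \<theta> x - u (\<Theta> g) x\<bar> \<le> 1 * (\<tau> / 3)"
        using w1[OF that] Mh by (intro mult_mono) auto
      then show ?thesis by (simp add: abs_mult right_diff_distrib flip: abs_mult)
    qed
    have int: "integrable D ?f" "integrable D ?g"
    proof -
      show "integrable D ?f"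
      proof (rule D.integrable_const_bound[of _ "1 * (real M * 2)"])
        show "AE x in D. norm (?f x) \<le> 1 * (real M * 2)"
          unfolding real_norm_def abs_mult
          by (intro AE_I2 mult_mono w1 u_bound) (use \<theta> in auto)
      qed measurable
      show "integrable D ?g"
      proof (rule D.integrable_const_bound[of _ "1 * (real M * 3)"])
        show "AE x in D. norm (?g x) \<le> 1 * (real M * 3)"
          unfolding real_norm_def abs_mult
          by (intro AE_I2 mult_mono w1 u_bound) (use \<Theta>_bound g in auto)
      qed measurable
    qed
    have "\<bar>(\<integral>x. ?f x \<partial>D) - (\<integral>x. ?g x \<partial>D)\<bar> = \<bar>\<integral>x. ?f x - ?g x \<partial>D\<bar>" using int by simp
    also have "\<dots> \<le> (\<integral>x. \<bar>?f x - ?g x\<bar> \<partial>D)" using integral_abs_bound by blast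
    also have "\<dots> \<le> (\<integral>x. \<tau> / 3 \<partial>D)" using int diff by (intro integral_mono) auto
    finally have 1: "\<bar>(\<integral>x. ?f x \<partial>D) - (\<integral>x. ?g x \<partial>D)\<bar> \<le> \<tau> / 3" by (simp add: D.prob_space)
    have "\<bar>(\<Sum>k<N. ?f (\<omega> (t, k))) - (\<Sum>k<N. ?g (\<omega> (t, k)))\<bar> \<le> (\<Sum>k<N. \<bar>?f (\<omega> (t, k)) - ?g (\<omega> (t, k))\<bar>)"
      by (simp only: sum_subtractf[symmetric] sum_abs)
    also have "\<dots> \<le> (\<Sum>k<N. \<tau> / 3)" by (intro sum_mono diff D0_space S0) (use \<omega> in auto)
    finally have 2: "\<bar>(\<Sum>k<N. ?f (\<omega> (t, k))) / real N - (\<Sum>k<N. ?g (\<omega> (t, k))) / real N\<bar> \<le> \<tau> / 3"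
      using \<open>N > 0\<close> by (simp add: abs_if field_simps split: if_splits)
    have "?g \<in> F" unfolding F_def using g \<omega> by (intro UnI2 image_eqI[of _ _ "(b, g)"]) auto
    from SF[OF \<omega>(1,2) this] 1 2 show ?thesis unfolding near_def by linarith
  qed
  show ?thesis
  proof (intro bexI[OF _ S(1)] conjI S(2) ballI allI impI)
    fix \<omega> t assume \<omega>: "\<omega> \<in> S" "t < T"
    show "\<omega> (t, k) \<in> D0" if "k < N" for k using S0 \<omega> that by auto
    show "near \<omega> t (z i)" if "i < M" for i
      using SF[OF \<omega>, of "z i"] that \<open>\<tau> > 0\<close> unfolding near_def F_def by fastforce
    fix \<theta> :: "nat \<Rightarrow> real" assume \<theta>: "\<forall>i<M. \<bar>\<theta> i\<bar> \<le> 2"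
    show "near \<omega> t (u \<theta>)" using key[OF \<omega> _ \<theta>, of M] by (simp add: w_def)
    show "near \<omega> t (\<lambda>x. z i x * u \<theta> x)" if "i < M" for i using key[OF \<omega> _ \<theta>, of i] that by (simp add: w_def)
  qed
qed

section \<open>Covariances in the data model\<close>

locale sparse_model = prob_space D for D :: "latent measure" +
  fixes n m :: nat and s C :: real
  assumes sets_D: "sets D = sets (latent_space n m)"
    and bern: "bernoulli_code n s D"
    and unb: "unbiased_noise n m C D"
    and C_nonneg: "0 \<le> C" and s_pos: "0 < s" and s_le: "s \<le> real n"
begin

definition p where "p = s / real n"

lemma n_pos: "0 < n" using s_pos s_le by (cases n) auto

lemma p_pos: "0 < p" and p_le: "p \<le> 1"
  using n_pos s_pos s_le by (auto simp: p_def field_simps)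

lemma measurable_fst_D[measurable]: "fst \<in> measurable D (\<Pi>\<^sub>M i\<in>{..<n}. borel)"
  by (subst measurable_cong_sets[OF sets_D refl]) (simp add: latent_space_def)

lemma measurable_snd_D[measurable]: "snd \<in> measurable D (\<Pi>\<^sub>M i\<in>{..<m}. borel)"
  by (subst measurable_cong_sets[OF sets_D refl]) (simp add: latent_space_def)

lemma measurable_code[measurable]: "i < n \<Longrightarrow> (\<lambda>\<omega>. fst \<omega> i) \<in> borel_measurable D"
  by (rule measurable_compose[OF measurable_fst_D measurable_component_singleton]) simp

lemma measurable_noise[measurable]: "i < m \<Longrightarrow> (\<lambda>\<omega>. snd \<omega> i) \<in> borel_measurable D"
  by (rule measurable_compose[OF measurable_snd_D measurable_component_singleton]) simp

text \<open>The law of the code prescribes only probabilities, so the space also contains points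
  whose code is not binary. All pointwise estimates are made on this almost sure event
  instead.\<close>

definition typical where
  "typical = {\<omega> \<in> space D. (\<forall>i<n. fst \<omega> i = 0 \<or> fst \<omega> i = 1) \<and> (\<forall>i<m. \<bar>snd \<omega> i\<bar> \<le> C)}"

lemma typical_sets: "typical \<in> sets D"
proof -
  have "typical = {\<omega> \<in> space D. (\<forall>i\<in>{..<n}. fst \<omega> i = 0 \<or> fst \<omega> i = 1) \<and> (\<forall>i\<in>{..<m}. \<bar>snd \<omega> i\<bar> \<le> C)}"
    by (auto simp: typical_def)
  also have "\<dots> \<in> sets D" by measurable
  finally show ?thesis .
qed

lemma AE_code: "i < n \<Longrightarrow> AE \<omega> in D. fst \<omega> i = 0 \<or> fst \<omega> i = 1"
proof -
  assume i: "i < n"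
  let ?A = "{\<omega> \<in> space D. fst \<omega> i = 1}" and ?B = "{\<omega> \<in> space D. fst \<omega> i = 0}"
  have [measurable]: "?A \<in> sets D" "?B \<in> sets D" using i by measurable
  have "prob (?A \<union> ?B) = prob ?A + prob ?B" by (intro finite_measure_Union) auto
  also have "\<dots> = 1" using bern i by (simp add: bernoulli_code_def)
  finally have "AE \<omega> in D. \<omega> \<in> ?A \<union> ?B" using prob_eq_1[of "?A \<union> ?B"] by auto
  then show ?thesis by eventually_elim auto
qed

lemma AE_typical: "AE \<omega> in D. \<omega> \<in> typical"
proof -
  have "AE \<omega> in D. \<forall>i\<in>{..<n}. fst \<omega> i = 0 \<or> fst \<omega> i = 1"
    by (intro AE_finite_allI AE_code) auto
  moreover have "AE \<omega> in D. \<forall>i<m. \<bar>snd \<omega> i\<bar> \<le> C" using unb by (simp add: unbiased_noise_def)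
  ultimately show ?thesis using AE_space by eventually_elim (auto simp: typical_def)
qed

lemma integrable_typical:
  fixes f :: "latent \<Rightarrow> real"
  assumes "f \<in> borel_measurable D" "\<And>\<omega>. \<omega> \<in> typical \<Longrightarrow> \<bar>f \<omega>\<bar> \<le> B"
  shows "integrable D f"
  by (rule integrable_const_bound[of _ B]) (use AE_typical assms in \<open>auto elim: eventually_mono\<close>)

lemma integral_mono_typical:
  fixes f g :: "latent \<Rightarrow> real"
  assumes "integrable D f" "integrable D g" "\<And>\<omega>. \<omega> \<in> typical \<Longrightarrow> f \<omega> \<le> g \<omega>"
  shows "(\<integral>\<omega>. f \<omega> \<partial>D) \<le> (\<integral>\<omega>. g \<omega> \<partial>D)"
  by (rule integral_mono_AE) (use AE_typical assms in \<open>auto elim: eventually_mono\<close>)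

lemma integral_cong_typical:
  fixes f g :: "latent \<Rightarrow> real"
  assumes "f \<in> borel_measurable D" "g \<in> borel_measurable D" "\<And>\<omega>. \<omega> \<in> typical \<Longrightarrow> f \<omega> = g \<omega>"
  shows "(\<integral>\<omega>. f \<omega> \<partial>D) = (\<integral>\<omega>. g \<omega> \<partial>D)"
  by (rule integral_cong_AE) (use AE_typical assms in \<open>auto elim: eventually_mono\<close>)

lemma code_typical: "\<omega> \<in> typical \<Longrightarrow> i < n \<Longrightarrow> fst \<omega> i = 0 \<or> fst \<omega> i = 1"
  and code_abs_le: "\<omega> \<in> typical \<Longrightarrow> i < n \<Longrightarrow> \<bar>fst \<omega> i\<bar> \<le> 1"
  and noise_abs_le: "\<omega> \<in> typical \<Longrightarrow> k < m \<Longrightarrow> \<bar>snd \<omega> k\<bar> \<le> C"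
  by (auto simp: typical_def)

lemma integrable_code: "i < n \<Longrightarrow> integrable D (\<lambda>\<omega>. fst \<omega> i)"
  by (rule integrable_typical[of _ 1]) (auto simp: code_abs_le)

lemma expectation_code: "i < n \<Longrightarrow> (\<integral>\<omega>. fst \<omega> i \<partial>D) = p"
proof -
  assume i: "i < n"
  let ?A = "{\<omega> \<in> space D. fst \<omega> i = 1}"
  have [measurable]: "?A \<in> sets D" using i by measurable
  have "(\<integral>\<omega>. fst \<omega> i \<partial>D) = (\<integral>\<omega>. indicator ?A \<omega> \<partial>D)"
    by (rule integral_cong_typical) (use i in \<open>auto simp: typical_def indicator_def\<close>)
  also have "\<dots> = prob ?A" by simp
  finally show ?thesis using bern i by (simp add: bernoulli_code_def p_def)
qed

lemma indep_code: "indep_vars (\<lambda>_. borel) (\<lambda>i \<omega>. fst \<omega> i) {..<n}"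
  using bern by (simp add: bernoulli_code_def)

text \<open>Disjoint blocks of independent coordinates are independent. The \<open>restrict\<close>
  makes it visible that the second factor depends on the coordinates other than \<open>i\<close>
  alone.\<close>

lemma expectation_code_times:
  assumes i: "i < n" and h[measurable]: "h \<in> borel_measurable (\<Pi>\<^sub>M k\<in>{..<n} - {i}. borel)"
    and int: "integrable D (\<lambda>\<omega>. h (restrict (fst \<omega>) ({..<n} - {i})))"
  shows "(\<integral>\<omega>. fst \<omega> i * h (restrict (fst \<omega>) ({..<n} - {i})) \<partial>D)
       = p * (\<integral>\<omega>. h (restrict (fst \<omega>) ({..<n} - {i})) \<partial>D)"
proof -
  let ?g = "\<lambda>x :: nat \<Rightarrow> real. x i"
  have "indep_var (PiM {i} (\<lambda>_. borel)) (\<lambda>\<omega>. restrict (\<lambda>i. fst \<omega> i) {i})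
          (PiM ({..<n} - {i}) (\<lambda>_. borel)) (\<lambda>\<omega>. restrict (\<lambda>i. fst \<omega> i) ({..<n} - {i}))"
    by (rule indep_var_restrict[OF indep_code]) (use i in auto)
  then have "indep_var borel (?g \<circ> (\<lambda>\<omega>. restrict (\<lambda>i. fst \<omega> i) {i}))
          borel (h \<circ> (\<lambda>\<omega>. restrict (\<lambda>i. fst \<omega> i) ({..<n} - {i})))"
    by (rule indep_var_compose) (auto intro: h)
  then have "indep_var borel (\<lambda>\<omega>. fst \<omega> i) borel (\<lambda>\<omega>. h (restrict (fst \<omega>) ({..<n} - {i})))"
    by (simp add: comp_def)
  from indep_var_lebesgue_integral[OF this integrable_code[OF i] int] show ?thesis
    using expectation_code[OF i] by simp
qed

lemma expectation_code_pair:
  assumes "i < n" "j < n" "i \<noteq> j"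
  shows "(\<integral>\<omega>. fst \<omega> i * fst \<omega> j \<partial>D) = p\<^sup>2"
  using expectation_code_times[of i "\<lambda>x. x j"] assms integrable_code[of j] expectation_code[of j]
  by (simp add: power2_eq_square)

text \<open>A factor that is measurable with respect to the code can be pulled out of the
  conditional expectation of the noise, which is 0.\<close>

lemma expectation_noise_times:
  assumes k: "k < m" and h[measurable]: "h \<in> borel_measurable (\<Pi>\<^sub>M k\<in>{..<n}. borel)"
    and B: "\<And>\<omega>. \<omega> \<in> typical \<Longrightarrow> \<bar>h (fst \<omega>)\<bar> \<le> B"
  shows "(\<integral>\<omega>. snd \<omega> k * h (fst \<omega>) \<partial>D) = 0"
proof -
  let ?F = "vimage_algebra (space D) fst (\<Pi>\<^sub>M i\<in>{..<n}. borel)"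
  have sub: "subalgebra D ?F"
    unfolding subalgebra_def
    by (auto simp: sets_vimage_algebra2 measurable_space[OF measurable_fst_D] intro!: measurable_sets[OF measurable_fst_D])
  interpret S: finite_measure_subalgebra D ?F
    by unfold_locales (rule sub)
  have f: "(\<lambda>\<omega>. h (fst \<omega>)) \<in> borel_measurable ?F"
    by (intro measurable_compose[OF measurable_vimage_algebra1 h]) (use measurable_space[OF measurable_fst_D] in auto)
  have int: "integrable D (\<lambda>\<omega>. h (fst \<omega>) * snd \<omega> k)"
    by (rule integrable_typical[of _ "B * C"]) (use k B noise_abs_le in \<open>auto simp: abs_mult intro!: mult_mono order_trans[OF abs_ge_zero B]\<close>)
  have "(\<integral>\<omega>. h (fst \<omega>) * snd \<omega> k \<partial>D) = (\<integral>\<omega>. h (fst \<omega>) * real_cond_exp D ?F (\<lambda>\<omega>. snd \<omega> k) \<omega> \<partial>D)"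
    using S.real_cond_exp_intg(2)[OF int f] k by simp
  also have "\<dots> = (\<integral>\<omega>. 0 \<partial>D)"
  proof (rule integral_cong_AE)
    have "AE \<omega> in D. real_cond_exp D ?F (\<lambda>\<omega>. snd \<omega> k) \<omega> = 0"
      using unb k by (simp add: unbiased_noise_def)
    then show "AE \<omega> in D. h (fst \<omega>) * real_cond_exp D ?F (\<lambda>\<omega>. snd \<omega> k) \<omega> = 0"
      by eventually_elim simp
  qed measurable
  finally show ?thesis by (simp add: mult.commute)
qed

lemma expectation_noise: "k < m \<Longrightarrow> (\<integral>\<omega>. snd \<omega> k \<partial>D) = 0"
  using expectation_noise_times[of k "\<lambda>_. 1" 1] by simp


text \<open>One coordinate of the decoding of a data point: \<open>w\<close> is the corresponding
  row of \<open>P * Astar\<close> and \<open>u\<close> that of \<open>P\<close>. Keeping both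
  abstract turns the covariance estimates into statements about a single unit.\<close>

definition decoded :: "real \<Rightarrow> (nat \<Rightarrow> real) \<Rightarrow> (nat \<Rightarrow> real) \<Rightarrow> latent \<Rightarrow> real" where
  "decoded \<alpha> w u \<omega> = relu \<alpha> ((\<Sum>k<n. w k * fst \<omega> k) + (\<Sum>k<m. u k * snd \<omega> k))"

lemma measurable_decoded[measurable]: "decoded \<alpha> w u \<in> borel_measurable D"
  unfolding decoded_def[abs_def] by measurable

lemma noise_contribution:
  assumes "\<omega> \<in> typical" "(\<Sum>k<m. \<bar>u k\<bar>) * C \<le> \<xi>"
  shows "\<bar>\<Sum>k<m. u k * snd \<omega> k\<bar> \<le> \<xi>"
proof -
  have "\<bar>\<Sum>k<m. u k * snd \<omega> k\<bar> \<le> (\<Sum>k<m. \<bar>u k * snd \<omega> k\<bar>)" by (rule sum_abs)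
  also have "\<dots> \<le> (\<Sum>k<m. \<bar>u k\<bar> * C)"
    using noise_abs_le[OF assms(1)] by (intro sum_mono) (auto simp: abs_mult intro!: mult_left_mono)
  finally show ?thesis using assms(2) by (simp add: sum_distrib_right)
qed

lemma code_contribution:
  assumes "\<omega> \<in> typical" "K \<subseteq> {..<n}"
  shows "\<bar>\<Sum>k\<in>K. w k * fst \<omega> k\<bar> \<le> (\<Sum>k\<in>K. \<bar>w k\<bar>)"
proof -
  have "\<bar>\<Sum>k\<in>K. w k * fst \<omega> k\<bar> \<le> (\<Sum>k\<in>K. \<bar>w k * fst \<omega> k\<bar>)" by (rule sum_abs)
  also have "\<dots> \<le> (\<Sum>k\<in>K. \<bar>w k\<bar>)"
  proof (rule sum_mono)
    fix k assume "k \<in> K"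
    then have "\<bar>w k\<bar> * \<bar>fst \<omega> k\<bar> \<le> \<bar>w k\<bar> * 1" using code_abs_le[OF assms(1)] assms(2) by (intro mult_left_mono) auto
    then show "\<bar>w k * fst \<omega> k\<bar> \<le> \<bar>w k\<bar>" by (simp add: abs_mult)
  qed
  finally show ?thesis .
qed

section \<open>A unit whose threshold dominates all of its input except that from coordinate
  j\<close>

context
  fixes \<alpha> \<xi> :: real and w u :: "nat \<Rightarrow> real" and j :: nat
  assumes \<alpha>: "0 \<le> \<alpha>" and j: "j < n"
    and w: "(\<Sum>k\<in>{..<n} - {j}. \<bar>w k\<bar>) + \<xi> \<le> \<alpha>" and u: "(\<Sum>k<m. \<bar>u k\<bar>) * C \<le> \<xi>"
begin

lemma \<xi>_nonneg: "0 \<le> \<xi>"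
proof -
  have "0 \<le> (\<Sum>k<m. \<bar>u k\<bar>) * C" by (intro mult_nonneg_nonneg sum_nonneg C_nonneg) auto
  then show ?thesis using u by linarith
qed

lemma sum_split_j: "(\<Sum>k<n. w k * f k) = w j * f j + (\<Sum>k\<in>{..<n} - {j}. w k * f k)" for f :: "nat \<Rightarrow> real"
  using j by (simp add: sum.remove)

text \<open>Without its own coordinate the unit receives at most the off-diagonal weight plus \<xi>,
  which does not exceed the threshold. So the decoded support is contained in the true one, and
  every later expectation carries a factor p from \<open>fst \<omega> j\<close>.\<close>

lemma decoded_eq_0:
  assumes "\<omega> \<in> typical" "fst \<omega> j = 0"
  shows "decoded \<alpha> w u \<omega> = 0"
  using noise_contribution[OF assms(1) u] code_contribution[OF assms(1), of "{..<n} - {j}" w] assms(2) w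
  unfolding decoded_def sum_split_j relu_def by auto

lemma code_times_decoded:
  assumes "\<omega> \<in> typical"
  shows "fst \<omega> j * decoded \<alpha> w u \<omega> = decoded \<alpha> w u \<omega>"
  using decoded_eq_0[OF assms] code_typical[OF assms j] by auto

lemma decoded_abs_le:
  assumes "\<omega> \<in> typical"
  shows "\<bar>decoded \<alpha> w u \<omega>\<bar> \<le> (\<Sum>k<n. \<bar>w k\<bar>) + \<xi>"
proof -
  have "decoded \<alpha> w u \<omega> \<le> \<bar>(\<Sum>k<n. w k * fst \<omega> k) + (\<Sum>k<m. u k * snd \<omega> k)\<bar>" "0 \<le> decoded \<alpha> w u \<omega>"
    by (simp_all add: decoded_def relu_le_abs \<alpha> relu_nonneg)
  then show ?thesis
    using noise_contribution[OF assms u] code_contribution[OF assms order_refl, of w] by linarith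
qed

lemma integrable_decoded: "integrable D (decoded \<alpha> w u)"
  by (rule integrable_typical[OF _ decoded_abs_le]) auto

lemma integrable_times_decoded:
  assumes "f \<in> borel_measurable D" "\<And>\<omega>. \<omega> \<in> typical \<Longrightarrow> \<bar>f \<omega>\<bar> \<le> B"
  shows "integrable D (\<lambda>\<omega>. f \<omega> * decoded \<alpha> w u \<omega>)"
proof (rule integrable_typical[of _ "B * ((\<Sum>k<n. \<bar>w k\<bar>) + \<xi>)"])
  fix \<omega> assume \<omega>: "\<omega> \<in> typical"
  have "0 \<le> B" using assms(2)[OF \<omega>] by linarith
  then have "\<bar>f \<omega>\<bar> * \<bar>decoded \<alpha> w u \<omega>\<bar> \<le> B * ((\<Sum>k<n. \<bar>w k\<bar>) + \<xi>)"
    by (intro mult_mono assms \<omega> decoded_abs_le) auto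
  then show "\<bar>f \<omega> * decoded \<alpha> w u \<omega>\<bar> \<le> B * ((\<Sum>k<n. \<bar>w k\<bar>) + \<xi>)" by (simp add: abs_mult)
qed (use assms in measurable)

lemma expectation_decoded_nonneg: "0 \<le> (\<integral>\<omega>. decoded \<alpha> w u \<omega> \<partial>D)"
  by (simp add: decoded_def relu_nonneg)

text \<open>If coordinate \<open>j\<close> is active, the remaining input can lower the argument by
  at most \<alpha>, and the threshold subtracts \<alpha> once more; hence 2 \<alpha>. If it is
  inactive, the lower bound is 0.\<close>

lemma expectation_decoded_ge:
  "p * (w j - 2 * \<alpha>) \<le> (\<integral>\<omega>. decoded \<alpha> w u \<omega> \<partial>D)"
proof -
  have "(\<integral>\<omega>. fst \<omega> j * (w j - 2 * \<alpha>) \<partial>D) \<le> (\<integral>\<omega>. decoded \<alpha> w u \<omega> \<partial>D)"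
  proof (rule integral_mono_typical)
    fix \<omega> assume \<omega>: "\<omega> \<in> typical"
    from code_typical[OF \<omega> j] show "fst \<omega> j * (w j - 2 * \<alpha>) \<le> decoded \<alpha> w u \<omega>"
    proof
      assume 1: "fst \<omega> j = 1"
      then show ?thesis
        using noise_contribution[OF \<omega> u] code_contribution[OF \<omega>, of "{..<n} - {j}" w] w
        unfolding decoded_def sum_split_j relu_def by auto
    qed (simp add: decoded_def relu_nonneg)
  qed (use integrable_decoded integrable_code[OF j] in auto)
  then show ?thesis using expectation_code[OF j] by simp
qed

lemma covariance_code_decoded_same:
  "(\<integral>\<omega>. fst \<omega> j * decoded \<alpha> w u \<omega> \<partial>D) = (\<integral>\<omega>. decoded \<alpha> w u \<omega> \<partial>D)"
  by (rule integral_cong_typical) (use j code_times_decoded in auto)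

text \<open>The decoded value is compared with a variant Q from which coordinate \<open>i\<close>
  and the noise are deleted, and which is therefore uncorrelated with \<open>fst \<omega> i\<close>.
  The difference lives on the event that \<open>j\<close> is active and is at most \<bar>w i\<bar>
  times coordinate \<open>i\<close>, plus \<xi>. Both factors of p come from there: one from
  \<open>j\<close> being active, the other either from \<open>i\<close> being active or from the
  centring of \<open>fst \<omega> i\<close>.\<close>

lemma covariance_code_decoded_diff:
  assumes i: "i < n" "i \<noteq> j"
  shows "\<bar>(\<integral>\<omega>. fst \<omega> i * decoded \<alpha> w u \<omega> \<partial>D) - p * (\<integral>\<omega>. decoded \<alpha> w u \<omega> \<partial>D)\<bar> \<le> p\<^sup>2 * (\<bar>w i\<bar> + 2 * \<xi>)"
proof -
  let ?F = "decoded \<alpha> w u"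
  \<comment> \<open>The factor \<open>x j\<close> makes the comparison variable vanish together with
    the decoded value; it is admissible because \<open>j\<close> is among the coordinates other than
    \<open>i\<close>.\<close>
  define h where "h x = x j * relu \<alpha> (\<Sum>k\<in>{..<n} - {i}. w k * x k)" for x :: "nat \<Rightarrow> real"
  define Q where "Q \<omega> = h (restrict (fst \<omega>) ({..<n} - {i}))" for \<omega> :: latent
  have h_meas[measurable]: "h \<in> borel_measurable (\<Pi>\<^sub>M k\<in>{..<n} - {i}. borel)"
    unfolding h_def[abs_def] using i j
    by (intro borel_measurable_times measurable_compose[OF _ measurable_relu] borel_measurable_sum) auto
  have Q_eq: "Q \<omega> = fst \<omega> j * relu \<alpha> (\<Sum>k\<in>{..<n} - {i}. w k * fst \<omega> k)" for \<omega>
    unfolding Q_def h_def using i j by simp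
  have Q_meas[measurable]: "Q \<in> borel_measurable D"
    unfolding Q_eq[abs_def] using j by measurable
  have sum_split_i: "(\<Sum>k<n. w k * f k) = w i * f i + (\<Sum>k\<in>{..<n} - {i}. w k * f k)" for f :: "nat \<Rightarrow> real"
    using i by (simp add: sum.remove)
  have diff: "\<bar>?F \<omega> - Q \<omega>\<bar> \<le> fst \<omega> j * (\<bar>w i\<bar> * fst \<omega> i + \<xi>)" if \<omega>: "\<omega> \<in> typical" for \<omega>
    using code_typical[OF \<omega> j]
  proof
    assume 1: "fst \<omega> j = 1"
    have "\<bar>?F \<omega> - Q \<omega>\<bar> \<le> \<bar>w i * fst \<omega> i + (\<Sum>k<m. u k * snd \<omega> k)\<bar>"
      unfolding Q_eq decoded_def sum_split_i 1 mult_1 by (rule order_trans[OF relu_lipschitz]) simp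
    also have "\<dots> \<le> \<bar>w i * fst \<omega> i\<bar> + \<xi>" using noise_contribution[OF \<omega> u] by linarith
    also have "\<bar>w i * fst \<omega> i\<bar> = \<bar>w i\<bar> * fst \<omega> i" using code_typical[OF \<omega> i(1)] by (auto simp: abs_mult)
    finally show ?thesis using 1 by simp
  next
    assume "fst \<omega> j = 0"
    then show ?thesis using decoded_eq_0[OF \<omega>] by (simp add: Q_eq)
  qed
  have Q_int: "integrable D Q"
  proof (rule integrable_typical)
    fix \<omega> assume \<omega>: "\<omega> \<in> typical"
    have "\<bar>fst \<omega> j\<bar> * \<bar>relu \<alpha> (\<Sum>k\<in>{..<n} - {i}. w k * fst \<omega> k)\<bar> \<le> 1 * (\<Sum>k\<in>{..<n} - {i}. \<bar>w k\<bar>)"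
      using code_abs_le[OF \<omega> j] relu_abs_le[OF \<alpha>] code_contribution[OF \<omega>, of "{..<n} - {i}" w]
      by (intro mult_mono order_trans[OF relu_abs_le[OF \<alpha>]]) auto
    then show "\<bar>Q \<omega>\<bar> \<le> (\<Sum>k\<in>{..<n} - {i}. \<bar>w k\<bar>)" by (simp add: Q_eq abs_mult)
  qed simp
  have XQ_int: "integrable D (\<lambda>\<omega>. fst \<omega> i * Q \<omega>)"
  proof (rule Bochner_Integration.integrable_bound[OF Q_int])
    show "AE \<omega> in D. norm (fst \<omega> i * Q \<omega>) \<le> norm (Q \<omega>)"
      using AE_code[OF i(1)] by eventually_elim auto
  qed (use i in measurable)
  have XF_int: "integrable D (\<lambda>\<omega>. fst \<omega> i * ?F \<omega>)"
    by (rule integrable_times_decoded[of _ 1]) (use code_abs_le i in auto)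
  have EQ: "(\<integral>\<omega>. fst \<omega> i * Q \<omega> \<partial>D) = p * (\<integral>\<omega>. Q \<omega> \<partial>D)"
    using expectation_code_times[OF i(1) h_meas] Q_int unfolding Q_def by simp
  have XX_int: "integrable D (\<lambda>\<omega>. fst \<omega> i * fst \<omega> j)"
  proof (rule integrable_typical[of _ 1])
    show "\<bar>fst \<omega> i * fst \<omega> j\<bar> \<le> 1" if "\<omega> \<in> typical" for \<omega>
      using code_typical[OF that i(1)] code_typical[OF that j] by auto
  qed (use i j in measurable)
  \<comment> \<open>The covariance of coordinate \<open>i\<close> with Q is 0, so it may be
    subtracted freely.\<close>
  have "(\<integral>\<omega>. fst \<omega> i * ?F \<omega> \<partial>D) - p * (\<integral>\<omega>. ?F \<omega> \<partial>D)
      = (\<integral>\<omega>. fst \<omega> i * ?F \<omega> \<partial>D) - p * (\<integral>\<omega>. ?F \<omega> \<partial>D) - ((\<integral>\<omega>. fst \<omega> i * Q \<omega> \<partial>D) - p * (\<integral>\<omega>. Q \<omega> \<partial>D))"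
    using EQ by simp
  also have "\<dots> = (\<integral>\<omega>. fst \<omega> i * ?F \<omega> - p * ?F \<omega> - (fst \<omega> i * Q \<omega> - p * Q \<omega>) \<partial>D)"
    using XF_int XQ_int Q_int integrable_decoded by simp
  also have "\<dots> = (\<integral>\<omega>. (fst \<omega> i - p) * (?F \<omega> - Q \<omega>) \<partial>D)" by (simp add: algebra_simps)
  finally have "\<bar>(\<integral>\<omega>. fst \<omega> i * ?F \<omega> \<partial>D) - p * (\<integral>\<omega>. ?F \<omega> \<partial>D)\<bar>
      \<le> (\<integral>\<omega>. \<bar>(fst \<omega> i - p) * (?F \<omega> - Q \<omega>)\<bar> \<partial>D)"
    by (simp only: integral_abs_bound)
  also have "\<dots> \<le> (\<integral>\<omega>. (\<bar>w i\<bar> + \<xi>) * (fst \<omega> i * fst \<omega> j) + p * \<xi> * fst \<omega> j \<partial>D)"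
  proof (rule integral_mono_typical)
    have "integrable D (\<lambda>\<omega>. (fst \<omega> i * ?F \<omega> - p * ?F \<omega>) - (fst \<omega> i * Q \<omega> - p * Q \<omega>))"
      using XF_int XQ_int Q_int integrable_decoded by auto
    then show "integrable D (\<lambda>\<omega>. \<bar>(fst \<omega> i - p) * (?F \<omega> - Q \<omega>)\<bar>)"
      by (intro integrable_abs) (simp add: algebra_simps)
    show "integrable D (\<lambda>\<omega>. (\<bar>w i\<bar> + \<xi>) * (fst \<omega> i * fst \<omega> j) + p * \<xi> * fst \<omega> j)"
      using XX_int integrable_code[OF j] by auto
    fix \<omega> assume \<omega>: "\<omega> \<in> typical"
    have "\<bar>(fst \<omega> i - p) * (?F \<omega> - Q \<omega>)\<bar> \<le> \<bar>fst \<omega> i - p\<bar> * (fst \<omega> j * (\<bar>w i\<bar> * fst \<omega> i + \<xi>))"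
      using diff[OF \<omega>] by (simp add: abs_mult mult_left_mono)
    also have "\<dots> \<le> (\<bar>w i\<bar> + \<xi>) * (fst \<omega> i * fst \<omega> j) + p * \<xi> * fst \<omega> j"
    proof -
      \<comment> \<open>The two inequalities serve the cases \<open>fst \<omega> i = 1\<close>, with
        centring weight 1 - p, and \<open>fst \<omega> i = 0\<close>, where only the noise term
        remains, with weight p.\<close>
      have "(1 - p) * (\<bar>w i\<bar> + \<xi>) \<le> 1 * (\<bar>w i\<bar> + \<xi>)" using p_pos \<xi>_nonneg by (intro mult_right_mono) auto
      moreover have "0 \<le> p * \<xi>" using p_pos \<xi>_nonneg by simp
      ultimately show ?thesis
        using code_typical[OF \<omega> i(1)] code_typical[OF \<omega> j] p_pos p_le by auto
    qed
    finally show "\<bar>(fst \<omega> i - p) * (?F \<omega> - Q \<omega>)\<bar> \<le> (\<bar>w i\<bar> + \<xi>) * (fst \<omega> i * fst \<omega> j) + p * \<xi> * fst \<omega> j" .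
  qed
  also have "\<dots> = (\<bar>w i\<bar> + \<xi>) * p\<^sup>2 + p * \<xi> * p"
    using XX_int integrable_code[OF j] expectation_code_pair[OF i(1) j i(2)] expectation_code[OF j] by simp
  finally show ?thesis by (simp add: algebra_simps power2_eq_square)
qed

text \<open>Against the noise-free decoding, a function of the code alone, the noise integrates to
  0. What is left is the effect of the noise on the decoding: at most \<xi>, and only where
  coordinate \<open>j\<close> is active, which has probability p.\<close>

lemma covariance_noise_decoded:
  assumes k: "k < m"
  shows "\<bar>\<integral>\<omega>. snd \<omega> k * decoded \<alpha> w u \<omega> \<partial>D\<bar> \<le> C * p * \<xi>"
proof -
  let ?F = "decoded \<alpha> w u"
  define Q where "Q x = relu \<alpha> (\<Sum>k<n. w k * x k)" for x :: "nat \<Rightarrow> real"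
  have Q_meas[measurable]: "Q \<in> borel_measurable (\<Pi>\<^sub>M k\<in>{..<n}. borel)"
    unfolding Q_def[abs_def] by (intro measurable_compose[OF _ measurable_relu] borel_measurable_sum) auto
  have QD_meas[measurable]: "(\<lambda>\<omega>. Q (fst \<omega>)) \<in> borel_measurable D"
    using measurable_compose[OF measurable_fst_D Q_meas] .
  have Q_bound: "\<bar>Q (fst \<omega>)\<bar> \<le> (\<Sum>k<n. \<bar>w k\<bar>)" if "\<omega> \<in> typical" for \<omega>
    unfolding Q_def by (rule order_trans[OF relu_abs_le[OF \<alpha>] code_contribution[OF that order_refl]])
  have VQ_int: "integrable D (\<lambda>\<omega>. snd \<omega> k * Q (fst \<omega>))"
    by (rule integrable_typical[of _ "C * (\<Sum>k<n. \<bar>w k\<bar>)"])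
      (use k noise_abs_le Q_bound C_nonneg in \<open>auto simp: abs_mult intro!: mult_mono\<close>)
  have VF_int: "integrable D (\<lambda>\<omega>. snd \<omega> k * ?F \<omega>)"
    by (rule integrable_times_decoded[of _ C]) (use noise_abs_le k in auto)
  have "(\<integral>\<omega>. snd \<omega> k * ?F \<omega> \<partial>D) = (\<integral>\<omega>. snd \<omega> k * ?F \<omega> \<partial>D) - (\<integral>\<omega>. snd \<omega> k * Q (fst \<omega>) \<partial>D)"
    using expectation_noise_times[OF k Q_meas Q_bound] by simp
  also have "\<dots> = (\<integral>\<omega>. snd \<omega> k * ?F \<omega> - snd \<omega> k * Q (fst \<omega>) \<partial>D)"
    using VF_int VQ_int by simp
  finally have "\<bar>\<integral>\<omega>. snd \<omega> k * ?F \<omega> \<partial>D\<bar> \<le> (\<integral>\<omega>. \<bar>snd \<omega> k * ?F \<omega> - snd \<omega> k * Q (fst \<omega>)\<bar> \<partial>D)"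
    by (simp only: integral_abs_bound)
  also have "\<dots> \<le> (\<integral>\<omega>. (C * \<xi>) * fst \<omega> j \<partial>D)"
  proof (rule integral_mono_typical)
    show "integrable D (\<lambda>\<omega>. \<bar>snd \<omega> k * ?F \<omega> - snd \<omega> k * Q (fst \<omega>)\<bar>)" using VF_int VQ_int by auto
    show "integrable D (\<lambda>\<omega>. (C * \<xi>) * fst \<omega> j)" using integrable_code[OF j] by auto
    fix \<omega> assume \<omega>: "\<omega> \<in> typical"
    have "\<bar>?F \<omega> - Q (fst \<omega>)\<bar> \<le> \<xi> * fst \<omega> j"
      using code_typical[OF \<omega> j]
    proof
      assume 1: "fst \<omega> j = 1"
      have "\<bar>?F \<omega> - Q (fst \<omega>)\<bar> \<le> \<bar>\<Sum>k<m. u k * snd \<omega> k\<bar>"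
        unfolding Q_def decoded_def by (rule order_trans[OF relu_lipschitz]) simp
      then show ?thesis using noise_contribution[OF \<omega> u] 1 by simp
    next
      assume 0: "fst \<omega> j = 0"
      have "Q (fst \<omega>) = 0"
        using code_contribution[OF \<omega>, of "{..<n} - {j}" w] w \<xi>_nonneg 0
        unfolding Q_def sum_split_j relu_def by auto
      then show ?thesis using decoded_eq_0[OF \<omega> 0] 0 by simp
    qed
    then have "\<bar>snd \<omega> k\<bar> * \<bar>?F \<omega> - Q (fst \<omega>)\<bar> \<le> C * (\<xi> * fst \<omega> j)"
      using noise_abs_le[OF \<omega> k] C_nonneg by (intro mult_mono) auto
    then show "\<bar>snd \<omega> k * ?F \<omega> - snd \<omega> k * Q (fst \<omega>)\<bar> \<le> (C * \<xi>) * fst \<omega> j"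
      by (simp add: mult.assoc right_diff_distrib flip: abs_mult)
  qed
  also have "\<dots> = C * p * \<xi>" using expectation_code[OF j] by simp
  finally show ?thesis .
qed

end

end

section \<open>Matrix norms\<close>

lemma norm_infty_le_iff:
  assumes "A \<in> carrier_mat m n" "0 < m"
  shows "norm_infty A \<le> b \<longleftrightarrow> (\<forall>i<m. (\<Sum>j<n. \<bar>A $$ (i, j)\<bar>) \<le> b)"
  using assms unfolding norm_infty_def by (subst Max_le_iff) auto

lemma norm_one_le_iff:
  assumes "A \<in> carrier_mat m n" "0 < n"
  shows "norm_one A \<le> b \<longleftrightarrow> (\<forall>j<n. (\<Sum>i<m. \<bar>A $$ (i, j)\<bar>) \<le> b)"
  using assms unfolding norm_one_def by (subst Max_le_iff) auto

lemma row_sum_le_norm_infty: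
  assumes "A \<in> carrier_mat m n" "i < m"
  shows "(\<Sum>j<n. \<bar>A $$ (i, j)\<bar>) \<le> norm_infty A"
  using norm_infty_le_iff[OF assms(1), of "norm_infty A"] assms by auto

lemma norm_infty_nonneg:
  assumes "A \<in> carrier_mat m n" "0 < m"
  shows "0 \<le> norm_infty A"
  using order_trans[OF sum_nonneg row_sum_le_norm_infty[OF assms]] by auto

lemma mult_mat_index:
  assumes "A \<in> carrier_mat m k" "B \<in> carrier_mat k n" "i < m" "j < n"
  shows "(A * B) $$ (i, j) = (\<Sum>l<k. A $$ (i, l) * B $$ (l, j))"
  using assms by (auto simp: scalar_prod_def atLeast0LessThan intro!: sum.cong)

lemma norm_infty_mult_le:
  assumes A: "A \<in> carrier_mat m k" and B: "B \<in> carrier_mat k n" and m: "0 < m" "0 < k"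
  shows "norm_infty (A * B) \<le> norm_infty A * norm_infty B"
proof -
  have "(\<Sum>j<n. \<bar>(A * B) $$ (i, j)\<bar>) \<le> norm_infty A * norm_infty B" if i: "i < m" for i
  proof -
    have "(\<Sum>j<n. \<bar>(A * B) $$ (i, j)\<bar>) \<le> (\<Sum>j<n. \<Sum>l<k. \<bar>A $$ (i, l)\<bar> * \<bar>B $$ (l, j)\<bar>)"
    proof (rule sum_mono)
      fix j assume "j \<in> {..<n}"
      then have "(A * B) $$ (i, j) = (\<Sum>l<k. A $$ (i, l) * B $$ (l, j))" using mult_mat_index[OF A B i] by simp
      then show "\<bar>(A * B) $$ (i, j)\<bar> \<le> (\<Sum>l<k. \<bar>A $$ (i, l)\<bar> * \<bar>B $$ (l, j)\<bar>)"
        by (simp add: sum_abs flip: abs_mult)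
    qed
    also have "\<dots> = (\<Sum>l<k. \<bar>A $$ (i, l)\<bar> * (\<Sum>j<n. \<bar>B $$ (l, j)\<bar>))"
      by (subst sum.swap) (simp add: sum_distrib_left)
    also have "\<dots> \<le> (\<Sum>l<k. \<bar>A $$ (i, l)\<bar> * norm_infty B)"
      by (intro sum_mono mult_left_mono row_sum_le_norm_infty[OF B]) auto
    also have "\<dots> \<le> norm_infty A * norm_infty B"
      unfolding sum_distrib_right[symmetric]
      by (intro mult_right_mono row_sum_le_norm_infty[OF A i] norm_infty_nonneg[OF B m(2)])
    finally show ?thesis .
  qed
  then show ?thesis using norm_infty_le_iff[of "A * B" m n] A B m by auto
qed

section \<open>Minimum-norm left inverses\<close>

text \<open>Tychonoff's theorem. The length m is a variable, so vectors are functions on all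
  naturals; pinning the coordinates from m on to 0 keeps the box compact.\<close>

lemma compact_box_nat_functions:
  "compact {v :: nat \<Rightarrow> real. \<forall>k. \<bar>v k\<bar> \<le> (if k < m then b else 0)}"
proof -
  have "compactin (product_topology (\<lambda>k::nat. euclideanreal) UNIV) (PiE UNIV (\<lambda>k. {- (if k < m then b else 0)..(if k < m then b else 0)}))"
    by (subst compactin_PiE) auto
  moreover have "PiE UNIV (\<lambda>k. {- (if k < m then b else 0)..(if k < m then b else 0)})
      = {v :: nat \<Rightarrow> real. \<forall>k. \<bar>v k\<bar> \<le> (if k < m then b else 0)}"
    unfolding PiE_UNIV_domain by (auto simp: abs_le_iff minus_le_iff split: if_splits)
  ultimately show ?thesis by (simp add: euclidean_product_topology)
qed

text \<open>Minimisation of the l1 norm over an affine space. The known solution \<open>q0\<close>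
  has norm b, and any solution with an entry beyond b is already worse, so the search may be
  confined to a compact box.\<close>

lemma exists_min_abs_sum_solution:
  fixes A :: "nat \<Rightarrow> nat \<Rightarrow> real" and y q0 :: "nat \<Rightarrow> real"
  assumes q0: "\<And>j. j < n \<Longrightarrow> (\<Sum>k<m. q0 k * A k j) = y j"
  shows "\<exists>v. (\<forall>j<n. (\<Sum>k<m. v k * A k j) = y j) \<and>
     (\<forall>q. (\<forall>j<n. (\<Sum>k<m. q k * A k j) = y j) \<longrightarrow> (\<Sum>k<m. \<bar>v k\<bar>) \<le> (\<Sum>k<m. \<bar>q k\<bar>))"
proof -
  define b where "b = (\<Sum>k<m. \<bar>q0 k\<bar>)"
  let ?box = "{v :: nat \<Rightarrow> real. \<forall>k. \<bar>v k\<bar> \<le> (if k < m then b else 0)}"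
  define K where "K = ?box \<inter> (\<Inter>j\<in>{..<n}. {v. (\<Sum>k<m. v k * A k j) = y j})"
  have cont: "continuous_on UNIV (\<lambda>v :: nat \<Rightarrow> real. v k)" for k
    by (rule continuous_on_product_coordinates)
  have "closed {v. (\<Sum>k<m. v k * A k j) = y j}" for j
    by (intro closed_Collect_eq continuous_intros cont)
  then have comp: "compact K" unfolding K_def by (intro compact_Int_closed compact_box_nat_functions closed_INT) auto
  have le_b: "\<bar>q0 k\<bar> \<le> b" if "k < m" for k
    unfolding b_def using that by (intro member_le_sum) auto
  \<comment> \<open>Entries from m on enter neither the constraints nor the objective; replacing
    them by 0 moves a solution into the box.\<close>
  define cut where "cut q k = (if k < m then q k else 0)" for q :: "nat \<Rightarrow> real" and k
  have in_K: "cut q \<in> K" if "\<forall>j<n. (\<Sum>k<m. q k * A k j) = y j" "\<forall>k<m. \<bar>q k\<bar> \<le> b" for q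
    using that by (auto simp: K_def cut_def)
  have q0_K: "cut q0 \<in> K" using q0 le_b by (intro in_K) auto
  then have K_ne: "K \<noteq> {}" by auto
  have K_cont: "continuous_on K (\<lambda>v. \<Sum>k<m. \<bar>v k\<bar>)"
    by (rule continuous_on_subset[of UNIV]) (intro continuous_intros cont, simp)
  from continuous_attains_inf[OF comp K_ne K_cont]
  obtain v where "v \<in> K" "\<forall>q\<in>K. (\<Sum>k<m. \<bar>v k\<bar>) \<le> (\<Sum>k<m. \<bar>q k\<bar>)" ..
  then have v: "v \<in> K" "\<And>q. q \<in> K \<Longrightarrow> (\<Sum>k<m. \<bar>v k\<bar>) \<le> (\<Sum>k<m. \<bar>q k\<bar>)" by blast+
  have "(\<Sum>k<m. \<bar>v k\<bar>) \<le> (\<Sum>k<m. \<bar>q k\<bar>)" if q: "\<forall>j<n. (\<Sum>k<m. q k * A k j) = y j" for q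
  proof (cases "\<forall>k<m. \<bar>q k\<bar> \<le> b")
    case True
    from v(2)[OF in_K[OF q True]] show ?thesis by (simp add: cut_def)
  next
    case False
    then obtain k where "k < m" "b < \<bar>q k\<bar>" by force
    moreover have "\<bar>q k\<bar> \<le> (\<Sum>k<m. \<bar>q k\<bar>)" using \<open>k < m\<close> by (intro member_le_sum) auto
    moreover have "(\<Sum>k<m. \<bar>v k\<bar>) \<le> b"
      using v(2)[OF q0_K] by (simp add: cut_def b_def)
    ultimately show ?thesis by linarith
  qed
  with v(1) show ?thesis by (auto simp: K_def)
qed

text \<open>The equation for a left inverse decouples into one linear system per row, and the norm
  is the largest row sum, so minimising every row separately minimises the norm.\<close>

lemma exists_min_left_inverse:
  assumes A: "A \<in> carrier_mat m n" and n: "0 < n"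
    and Q: "Q \<in> carrier_mat n m" "Q * A = 1\<^sub>m n"
  shows "\<exists>P. is_min_left_inverse A P"
proof -
  have left_inv_iff: "P * A = 1\<^sub>m n \<longleftrightarrow> (\<forall>i<n. \<forall>j<n. (\<Sum>k<m. P $$ (i, k) * A $$ (k, j)) = (if i = j then 1 else 0))"
    if P: "P \<in> carrier_mat n m" for P
  proof
    assume "P * A = 1\<^sub>m n"
    then show "\<forall>i<n. \<forall>j<n. (\<Sum>k<m. P $$ (i, k) * A $$ (k, j)) = (if i = j then 1 else 0)"
      using mult_mat_index[OF P A] by auto
  next
    assume "\<forall>i<n. \<forall>j<n. (\<Sum>k<m. P $$ (i, k) * A $$ (k, j)) = (if i = j then 1 else 0)"
    then show "P * A = 1\<^sub>m n" using P A mult_mat_index[OF P A] by (intro eq_matI) auto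
  qed
  define sol where "sol i v \<longleftrightarrow> (\<forall>j<n. (\<Sum>k<m. v k * A $$ (k, j)) = (if i = j then 1 else 0))"
    for i and v :: "nat \<Rightarrow> real"
  have "\<exists>v. sol i v \<and> (\<forall>q. sol i q \<longrightarrow> (\<Sum>k<m. \<bar>v k\<bar>) \<le> (\<Sum>k<m. \<bar>q k\<bar>))" if "i < n" for i
    unfolding sol_def using left_inv_iff[OF Q(1)] Q(2) that
    by (intro exists_min_abs_sum_solution[where ?q0.0 = "\<lambda>k. Q $$ (i, k)"]) auto
  then obtain v where v: "\<And>i. i < n \<Longrightarrow> sol i (v i)"
    and v_min: "\<And>i q. i < n \<Longrightarrow> sol i q \<Longrightarrow> (\<Sum>k<m. \<bar>v i k\<bar>) \<le> (\<Sum>k<m. \<bar>q k\<bar>)"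
    by metis
  define P where "P = Matrix.mat n m (\<lambda>(i, k). v i k)"
  have P: "P \<in> carrier_mat n m" by (simp add: P_def)
  show ?thesis unfolding is_min_left_inverse_def
  proof (intro exI[of _ P] conjI ballI impI)
    show "P \<in> carrier_mat (dim_col A) (dim_row A)" using P A by auto
    show "P * A = 1\<^sub>m (dim_col A)" using left_inv_iff[OF P] v A by (simp add: P_def sol_def)
    fix R assume R: "R \<in> carrier_mat (dim_col A) (dim_row A)" "R * A = 1\<^sub>m (dim_col A)"
    then have R': "R \<in> carrier_mat n m" "R * A = 1\<^sub>m n" using A by auto
    have "(\<Sum>k<m. \<bar>P $$ (i, k)\<bar>) \<le> norm_infty R" if i: "i < n" for i
    proof -
      have "(\<Sum>k<m. \<bar>P $$ (i, k)\<bar>) \<le> (\<Sum>k<m. \<bar>R $$ (i, k)\<bar>)"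
        using v_min[OF i, of "\<lambda>k. R $$ (i, k)"] left_inv_iff[OF R'(1)] R'(2) i by (simp add: P_def sol_def)
      also have "\<dots> \<le> norm_infty R" by (rule row_sum_le_norm_infty[OF R'(1) i])
      finally show ?thesis .
    qed
    then show "norm_infty P \<le> norm_infty R" using norm_infty_le_iff[OF P n] by blast
  qed
qed

section \<open>Perturbed diagonal systems\<close>

text \<open>Here \<open>v\<close> is row \<open>j\<close> of the decoding matrix, a solution of v (S
  + E) = e_j - R. Taking absolute values and summing over the entries, the E-term costs at most e
  times the l1 norm of \<open>v\<close> and can be absorbed. Leaving out entry \<open>j\<close>
  removes the 1 on the right, so the off-diagonal sum is small.\<close>

lemma row_solution_bounds:
  fixes v S R :: "nat \<Rightarrow> real" and E :: "nat \<Rightarrow> nat \<Rightarrow> real"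
  assumes eq: "\<And>i. i < n \<Longrightarrow> v i * S i + (\<Sum>k<n. v k * E k i) = (if i = j then 1 else 0) - R i"
    and S: "\<And>i. i < n \<Longrightarrow> 9/10 \<le> S i" and E: "\<And>k. k < n \<Longrightarrow> (\<Sum>i<n. \<bar>E k i\<bar>) \<le> e"
    and R: "(\<Sum>i<n. \<bar>R i\<bar>) \<le> q" and j: "j < n"
  shows "(9/10 - e) * (\<Sum>i<n. \<bar>v i\<bar>) \<le> 1 + q"
    and "9/10 * (\<Sum>i\<in>{..<n} - {j}. \<bar>v i\<bar>) \<le> q + e * (\<Sum>i<n. \<bar>v i\<bar>)"
proof -
  have abs_le: "9/10 * \<bar>v i\<bar> \<le> (if i = j then 1 else 0) + \<bar>R i\<bar> + (\<Sum>k<n. \<bar>v k\<bar> * \<bar>E k i\<bar>)" if i: "i < n" for i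
  proof -
    have "9/10 * \<bar>v i\<bar> \<le> \<bar>v i\<bar> * S i" using S[OF i] mult_left_mono[of "9/10" "S i" "\<bar>v i\<bar>"] by (simp add: mult.commute)
    also have "\<dots> = \<bar>v i * S i\<bar>" using S[OF i] by (simp add: abs_mult)
    also have "v i * S i = (if i = j then 1 else 0) - R i - (\<Sum>k<n. v k * E k i)" using eq[OF i] by simp
    also have "\<bar>\<dots>\<bar> \<le> (if i = j then 1 else 0) + \<bar>R i\<bar> + \<bar>\<Sum>k<n. v k * E k i\<bar>" by auto
    also have "\<bar>\<Sum>k<n. v k * E k i\<bar> \<le> (\<Sum>k<n. \<bar>v k\<bar> * \<bar>E k i\<bar>)"
      by (rule order_trans[OF sum_abs]) (simp add: abs_mult)
    finally show ?thesis by simp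
  qed
  have sumE: "(\<Sum>i<n. \<Sum>k<n. \<bar>v k\<bar> * \<bar>E k i\<bar>) \<le> e * (\<Sum>k<n. \<bar>v k\<bar>)"
  proof -
    have "(\<Sum>i<n. \<Sum>k<n. \<bar>v k\<bar> * \<bar>E k i\<bar>) = (\<Sum>k<n. \<bar>v k\<bar> * (\<Sum>i<n. \<bar>E k i\<bar>))"
      by (subst sum.swap) (simp add: sum_distrib_left)
    also have "\<dots> \<le> (\<Sum>k<n. \<bar>v k\<bar> * e)" by (intro sum_mono mult_left_mono E) auto
    finally show ?thesis by (simp add: sum_distrib_left mult.commute)
  qed
  have "9/10 * (\<Sum>i<n. \<bar>v i\<bar>) \<le> (\<Sum>i<n. (if i = j then 1 else 0) + \<bar>R i\<bar> + (\<Sum>k<n. \<bar>v k\<bar> * \<bar>E k i\<bar>))"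
    unfolding sum_distrib_left by (intro sum_mono abs_le) auto
  also have "\<dots> = 1 + (\<Sum>i<n. \<bar>R i\<bar>) + (\<Sum>i<n. \<Sum>k<n. \<bar>v k\<bar> * \<bar>E k i\<bar>)"
    using j by (simp add: sum.distrib)
  finally show "(9/10 - e) * (\<Sum>i<n. \<bar>v i\<bar>) \<le> 1 + q" using sumE R by (simp add: algebra_simps)
  have "9/10 * (\<Sum>i\<in>{..<n} - {j}. \<bar>v i\<bar>) \<le> (\<Sum>i\<in>{..<n} - {j}. (if i = j then 1 else 0) + \<bar>R i\<bar> + (\<Sum>k<n. \<bar>v k\<bar> * \<bar>E k i\<bar>))"
    unfolding sum_distrib_left by (intro sum_mono abs_le) auto
  also have "\<dots> = (\<Sum>i\<in>{..<n} - {j}. \<bar>R i\<bar> + (\<Sum>k<n. \<bar>v k\<bar> * \<bar>E k i\<bar>))" by (intro sum.cong) auto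
  also have "\<dots> \<le> (\<Sum>i<n. \<bar>R i\<bar> + (\<Sum>k<n. \<bar>v k\<bar> * \<bar>E k i\<bar>))"
    by (intro sum_mono2) (auto intro!: add_nonneg_nonneg sum_nonneg)
  finally show "9/10 * (\<Sum>i\<in>{..<n} - {j}. \<bar>v i\<bar>) \<le> q + e * (\<Sum>i<n. \<bar>v i\<bar>)"
    using sumE R by (simp add: sum.distrib)
qed

text \<open>Unlike rows, the columns of \<open>W\<close> are coupled: summing the equations for
  column \<open>i\<close> over \<open>j\<close> brings in the sums of all other columns, weighted by
  column \<open>i\<close> of \<open>E\<close>. The largest column sum absorbs them all, which yields
  (1 + q) / (9/10 - e) for it; this is then inserted into the equation without its diagonal
  entry.\<close>

lemma column_solution_bounds:
  fixes S :: "nat \<Rightarrow> real" and W E R :: "nat \<Rightarrow> nat \<Rightarrow> real"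
  assumes eq: "\<And>i j. i < n \<Longrightarrow> j < n \<Longrightarrow> W j i * S i + (\<Sum>k<n. W j k * E k i) = (if i = j then 1 else 0) - R j i"
    and S: "\<And>i. i < n \<Longrightarrow> 9/10 \<le> S i" and E: "\<And>i. i < n \<Longrightarrow> (\<Sum>k<n. \<bar>E k i\<bar>) \<le> e"
    and R: "\<And>i. i < n \<Longrightarrow> (\<Sum>j<n. \<bar>R j i\<bar>) \<le> q" and e: "0 \<le> e" "e < 9/10" and i: "i < n"
  shows "9/10 * (\<Sum>j\<in>{..<n} - {i}. \<bar>W j i\<bar>) \<le> q + e * ((1 + q) / (9/10 - e))"
proof -
  let ?c = "\<lambda>i. \<Sum>j<n. \<bar>W j i\<bar>"
  have abs_le: "9/10 * \<bar>W j i\<bar> \<le> (if i = j then 1 else 0) + \<bar>R j i\<bar> + (\<Sum>k<n. \<bar>W j k\<bar> * \<bar>E k i\<bar>)" if i: "i < n" and j: "j < n" for i j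
  proof -
    have "9/10 * \<bar>W j i\<bar> \<le> \<bar>W j i\<bar> * S i" using S[OF i] mult_left_mono[of "9/10" "S i" "\<bar>W j i\<bar>"] by (simp add: mult.commute)
    also have "\<dots> = \<bar>W j i * S i\<bar>" using S[OF i] by (simp add: abs_mult)
    also have "W j i * S i = (if i = j then 1 else 0) - R j i - (\<Sum>k<n. W j k * E k i)" using eq[OF i j] by simp
    also have "\<bar>\<dots>\<bar> \<le> (if i = j then 1 else 0) + \<bar>R j i\<bar> + \<bar>\<Sum>k<n. W j k * E k i\<bar>" by auto
    also have "\<bar>\<Sum>k<n. W j k * E k i\<bar> \<le> (\<Sum>k<n. \<bar>W j k\<bar> * \<bar>E k i\<bar>)"
      by (rule order_trans[OF sum_abs]) (simp add: abs_mult)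
    finally show ?thesis by simp
  qed
  define c where "c = Max (?c ` {..<n})"
  have c_ge: "?c k \<le> c" if "k < n" for k unfolding c_def using that by (intro Max_ge) auto
  have sumE: "(\<Sum>j<n. \<Sum>k<n. \<bar>W j k\<bar> * \<bar>E k i\<bar>) \<le> e * c" if i: "i < n" for i
  proof -
    have c0: "0 \<le> c" using order_trans[OF sum_nonneg c_ge[OF i]] by auto
    have "(\<Sum>j<n. \<Sum>k<n. \<bar>W j k\<bar> * \<bar>E k i\<bar>) = (\<Sum>k<n. ?c k * \<bar>E k i\<bar>)"
      by (subst sum.swap) (simp add: sum_distrib_right)
    also have "\<dots> \<le> (\<Sum>k<n. c * \<bar>E k i\<bar>)" by (intro sum_mono mult_right_mono c_ge) auto
    also have "\<dots> \<le> c * e" unfolding sum_distrib_left[symmetric] by (intro mult_left_mono E i c0)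
    finally show ?thesis by (simp add: mult.commute)
  qed
  obtain i0 where i0: "i0 < n" "c = ?c i0"
  proof -
    have "c \<in> ?c ` {..<n}" unfolding c_def using i by (intro Max_in) auto
    then show thesis using that by auto
  qed
  have "9/10 * ?c i0 \<le> (\<Sum>j<n. (if i0 = j then 1 else 0) + \<bar>R j i0\<bar> + (\<Sum>k<n. \<bar>W j k\<bar> * \<bar>E k i0\<bar>))"
    unfolding sum_distrib_left by (intro sum_mono abs_le i0) auto
  also have "\<dots> = 1 + (\<Sum>j<n. \<bar>R j i0\<bar>) + (\<Sum>j<n. \<Sum>k<n. \<bar>W j k\<bar> * \<bar>E k i0\<bar>)"
    using i0 by (simp add: sum.distrib)
  finally have "9/10 * c \<le> 1 + q + e * c" using sumE[OF i0(1)] R[OF i0(1)] i0(2) by linarith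
  then have c_le: "c \<le> (1 + q) / (9/10 - e)" using e by (simp add: field_simps)
  have "9/10 * (\<Sum>j\<in>{..<n} - {i}. \<bar>W j i\<bar>) \<le> (\<Sum>j\<in>{..<n} - {i}. (if i = j then 1 else 0) + \<bar>R j i\<bar> + (\<Sum>k<n. \<bar>W j k\<bar> * \<bar>E k i\<bar>))"
    unfolding sum_distrib_left by (intro sum_mono abs_le i) auto
  also have "\<dots> = (\<Sum>j\<in>{..<n} - {i}. \<bar>R j i\<bar> + (\<Sum>k<n. \<bar>W j k\<bar> * \<bar>E k i\<bar>))" by (intro sum.cong) auto
  also have "\<dots> \<le> (\<Sum>j<n. \<bar>R j i\<bar> + (\<Sum>k<n. \<bar>W j k\<bar> * \<bar>E k i\<bar>))"
    by (intro sum_mono2) (auto intro!: add_nonneg_nonneg sum_nonneg)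
  also have "\<dots> \<le> q + e * c" using sumE[OF i] R[OF i] by (simp add: sum.distrib)
  also have "\<dots> \<le> q + e * ((1 + q) / (9/10 - e))" using c_le e by (intro add_left_mono mult_left_mono) auto
  finally show ?thesis .
qed

text \<open>Levy-Desplanques theorem: at an entry of maximal modulus of a kernel vector, the
  diagonal term could not be cancelled by the others.\<close>

lemma diagonally_dominant_left_inverse:
  fixes M :: "real mat"
  assumes M: "M \<in> carrier_mat n n"
    and dom: "\<And>i. i < n \<Longrightarrow> (\<Sum>k\<in>{..<n} - {i}. \<bar>M $$ (i, k)\<bar>) < \<bar>M $$ (i, i)\<bar>"
  shows "\<exists>X\<in>carrier_mat n n. X * M = 1\<^sub>m n"
proof -
  have "det M \<noteq> 0"
  proof
    assume "det M = 0"
    then obtain v where v: "v \<in> carrier_vec n" "v \<noteq> 0\<^sub>v n" "M *\<^sub>v v = 0\<^sub>v n"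
      using det_0_iff_vec_prod_zero_field[OF M] by blast
    let ?a = "\<lambda>i. \<bar>vec_index v i\<bar>"
    have n: "0 < n"
    proof (rule ccontr)
      assume "\<not> 0 < n"
      then have "v = 0\<^sub>v n" using v(1) by (intro eq_vecI) auto
      with v(2) show False by simp
    qed
    define c where "c = Max (?a ` {..<n})"
    have c_ge: "?a k \<le> c" if "k < n" for k unfolding c_def using that by (intro Max_ge) auto
    obtain i where i: "i < n" "c = ?a i"
    proof -
      have "c \<in> ?a ` {..<n}" unfolding c_def using n by (intro Max_in) auto
      then show thesis using that by auto
    qed
    have c_pos: "c > 0"
    proof (rule ccontr)
      assume "\<not> c > 0"
      then have "vec_index v k = 0" if "k < n" for k using c_ge[OF that] by linarith
      then have "v = 0\<^sub>v n" using v(1) by (intro eq_vecI) auto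
      with v show False by simp
    qed
    have "vec_index (M *\<^sub>v v) i = (\<Sum>k<n. M $$ (i, k) * vec_index v k)"
      using M v(1) i by (auto simp: scalar_prod_def atLeast0LessThan intro!: sum.cong)
    then have "0 = (\<Sum>k<n. M $$ (i, k) * vec_index v k)" using v i by simp
    also have "\<dots> = M $$ (i, i) * vec_index v i + (\<Sum>k\<in>{..<n} - {i}. M $$ (i, k) * vec_index v k)"
      using i by (simp add: sum.remove)
    finally have "\<bar>M $$ (i, i)\<bar> * c = \<bar>\<Sum>k\<in>{..<n} - {i}. M $$ (i, k) * vec_index v k\<bar>"
      unfolding i(2) abs_mult[symmetric] by linarith
    also have "\<dots> \<le> (\<Sum>k\<in>{..<n} - {i}. \<bar>M $$ (i, k)\<bar> * c)"
      by (rule order_trans[OF sum_abs]) (auto simp: abs_mult intro!: sum_mono mult_left_mono c_ge)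
    also have "\<dots> < \<bar>M $$ (i, i)\<bar> * c"
      using dom[OF i(1)] c_pos by (simp flip: sum_distrib_right)
    finally show False by simp
  qed
  from det_non_zero_imp_unit[OF M this, of "()"] show ?thesis
    unfolding Units_def by (auto simp: ring_mat_def)
qed

section \<open>Representative samples\<close>

lemma sum_lessThan_add: "(\<Sum>i<n + m. f i) = (\<Sum>i<n. f i) + (\<Sum>i<m. f (n + i))" for f :: "nat \<Rightarrow> real"
  by (induction m) (auto simp: algebra_simps)

text \<open>Differences over all ordered pairs centre the data without knowledge of the means. Each
  of the two diagonal terms of the expanded product contributes once, which gives twice the
  empirical covariance.\<close>

lemma pairwise_difference_average:
  fixes a b :: "nat \<Rightarrow> real"
  assumes "N > 0"
  shows "(\<Sum>k<N. \<Sum>l<N. (a k - a l) * (b k - b l)) / (real N)\<^sup>2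
       = 2 * ((\<Sum>k<N. a k * b k) / real N - (\<Sum>k<N. a k) / real N * ((\<Sum>k<N. b k) / real N))"
proof -
  have "(\<Sum>k<N. \<Sum>l<N. (a k - a l) * (b k - b l))
      = (\<Sum>k<N. \<Sum>l<N. a k * b k + a l * b l - a k * b l - a l * b k)"
    by (simp add: algebra_simps)
  also have "\<dots> = (\<Sum>k<N. real N * (a k * b k) + (\<Sum>l<N. a l * b l) - a k * (\<Sum>l<N. b l) - (\<Sum>l<N. a l) * b k)"
    by (simp add: sum.distrib sum_subtractf sum_distrib_left sum_distrib_right)
  also have "\<dots> = 2 * (real N * (\<Sum>k<N. a k * b k) - (\<Sum>k<N. a k) * (\<Sum>k<N. b k))"
    by (simp add: sum.distrib sum_subtractf flip: sum_distrib_left sum_distrib_right)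
  finally show ?thesis using assms by (simp add: field_simps power2_eq_square)
qed

context sparse_model
begin

text \<open>The weights are quantified inside, so that one sample serves decoding matrices computed
  from any other samples. The allowances for the noise terms carry the factor \<open>C\<close>
  because the residual of an iterate has to stay proportional to \<open>C\<close>.\<close>

definition representative :: "real \<Rightarrow> real \<Rightarrow> nat \<Rightarrow> (nat \<Rightarrow> latent) \<Rightarrow> bool" where
  "representative \<alpha> \<tau> N y \<longleftrightarrow>
     (\<forall>k<N. y k \<in> typical) \<and>
     (\<forall>i<n. \<bar>(\<Sum>k<N. fst (y k) i) / real N - p\<bar> \<le> \<tau>) \<and>
     (\<forall>i<m. \<bar>(\<Sum>k<N. snd (y k) i) / real N\<bar> \<le> C * \<tau>) \<and>
     (\<forall>w u. (\<forall>k<n. \<bar>w k\<bar> \<le> 2) \<longrightarrow> (\<forall>k<m. \<bar>u k\<bar> * C \<le> 2) \<longrightarrow>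
        \<bar>(\<Sum>k<N. decoded \<alpha> w u (y k)) / real N - (\<integral>\<omega>. decoded \<alpha> w u \<omega> \<partial>D)\<bar> \<le> \<tau> \<and>
        (\<forall>i<n. \<bar>(\<Sum>k<N. fst (y k) i * decoded \<alpha> w u (y k)) / real N
                  - (\<integral>\<omega>. fst \<omega> i * decoded \<alpha> w u \<omega> \<partial>D)\<bar> \<le> \<tau>) \<and>
        (\<forall>i<m. \<bar>(\<Sum>k<N. snd (y k) i * decoded \<alpha> w u (y k)) / real N
                  - (\<integral>\<omega>. snd \<omega> i * decoded \<alpha> w u \<omega> \<partial>D)\<bar> \<le> C * \<tau>))"

text \<open>
  The noise is rescaled to the interval from -1 to 1, so that the deviations of the noise terms
  come out proportional to \<open>C\<close>; for \<open>C = 0\<close> the division returns 0, which is right because the noise then vanishes.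
\<close>

definition feature :: "nat \<Rightarrow> latent \<Rightarrow> real" where
  "feature i \<omega> = (if i < n then (if fst \<omega> i = 1 then 1 else 0) else max (- 1) (min 1 (snd \<omega> (i - n) / C)))"

lemma feature_code: "\<omega> \<in> typical \<Longrightarrow> i < n \<Longrightarrow> feature i \<omega> = fst \<omega> i"
  using code_typical[of \<omega> i] by (auto simp: feature_def)

lemma feature_noise:
  assumes "\<omega> \<in> typical" "i < m"
  shows "C * feature (n + i) \<omega> = snd \<omega> i"
proof (cases "C = 0")
  case True
  then show ?thesis using noise_abs_le[OF assms] by simp
next
  case False
  then have "C > 0" using C_nonneg by simp
  then have "\<bar>snd \<omega> i / C\<bar> \<le> 1" using noise_abs_le[OF assms] by simp
  then have "max (- 1) (min 1 (snd \<omega> i / C)) = snd \<omega> i / C" by linarith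
  then show ?thesis using \<open>C > 0\<close> by (simp add: feature_def)
qed

lemma feature_abs_le: "\<bar>feature i \<omega>\<bar> \<le> 1"
  by (auto simp: feature_def)

lemma measurable_feature[measurable]: "i < n + m \<Longrightarrow> feature i \<in> borel_measurable D"
proof -
  assume i: "i < n + m"
  show ?thesis
  proof (cases "i < n")
    case True
    then show ?thesis unfolding feature_def[abs_def] by simp
  next
    case False
    then have "i - n < m" using i by auto
    with False show ?thesis unfolding feature_def[abs_def] by simp
  qed
qed

text \<open>In terms of the normalised features the noise weights become \<open>u k * C\<close>.
  This is why \<open>representative\<close> bounds that product by 2.\<close>

lemma decoded_eq_feature_unit:
  assumes "\<omega> \<in> typical"
  shows "decoded \<alpha> w u \<omega> = relu \<alpha> (\<Sum>i<n + m. (if i < n then w i else u (i - n) * C) * feature i \<omega>)"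
proof -
  have "(\<Sum>i<n. (if i < n then w i else u (i - n) * C) * feature i \<omega>) = (\<Sum>k<n. w k * fst \<omega> k)"
    by (intro sum.cong) (auto simp: feature_code[OF assms])
  moreover have "(\<Sum>i<m. (if n + i < n then w (n + i) else u (n + i - n) * C) * feature (n + i) \<omega>) = (\<Sum>k<m. u k * snd \<omega> k)"
    by (intro sum.cong) (auto simp: mult.assoc feature_noise[OF assms])
  ultimately show ?thesis by (simp add: decoded_def sum_lessThan_add)
qed

lemma representative_samples:
  assumes "0 \<le> \<alpha>" "N > 0" "0 < \<tau>" "\<tau> \<le> 1"
    and bound: "6 * real T * real (n + m) * (17 * real (n + m) / \<tau>) ^ (n + m)
                  * exp (- (real N * \<tau>\<^sup>2 / (162 * (real (n + m))\<^sup>2))) \<le> \<delta>"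
  shows "\<exists>S\<in>sets (sample_law D T N). measure (sample_law D T N) S \<ge> 1 - \<delta> \<and>
           (\<forall>\<omega>\<in>S. \<forall>t<T. representative \<alpha> \<tau> N (\<lambda>k. \<omega> (t, k)))"
proof -
  let ?u = "\<lambda>\<theta> x. relu \<alpha> (\<Sum>i<n + m. \<theta> i * feature i x)"
  let ?near = "\<lambda>\<omega> t f. \<bar>(\<Sum>k<N. f (\<omega> (t, k))) / real N - (\<integral>x. f x \<partial>D)\<bar> \<le> \<tau>"
  have "\<exists>S\<in>sets (\<Pi>\<^sub>M tk\<in>{..<T} \<times> {..<N}. D). measure (\<Pi>\<^sub>M tk\<in>{..<T} \<times> {..<N}. D) S \<ge> 1 - \<delta> \<and>
           (\<forall>\<omega>\<in>S. \<forall>t<T. (\<forall>k<N. \<omega> (t, k) \<in> typical) \<and> (\<forall>i<n + m. ?near \<omega> t (feature i)) \<and>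
              (\<forall>\<theta>. (\<forall>i<n + m. \<bar>\<theta> i\<bar> \<le> 2) \<longrightarrow>
                 ?near \<omega> t (?u \<theta>) \<and> (\<forall>i<n + m. ?near \<omega> t (\<lambda>x. feature i x * ?u \<theta> x))))"
    by (rule relu_units_concentration[OF prob_space_axioms])
      (use assms n_pos typical_sets AE_typical feature_abs_le in auto)
  then obtain S where S: "S \<in> sets (\<Pi>\<^sub>M tk\<in>{..<T} \<times> {..<N}. D)" "measure (\<Pi>\<^sub>M tk\<in>{..<T} \<times> {..<N}. D) S \<ge> 1 - \<delta>"
    and typic: "\<And>\<omega> t k. \<omega> \<in> S \<Longrightarrow> t < T \<Longrightarrow> k < N \<Longrightarrow> \<omega> (t, k) \<in> typical"
    and feat: "\<And>\<omega> t i. \<omega> \<in> S \<Longrightarrow> t < T \<Longrightarrow> i < n + m \<Longrightarrow> ?near \<omega> t (feature i)"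
    and unit: "\<And>\<omega> t \<theta>. \<omega> \<in> S \<Longrightarrow> t < T \<Longrightarrow> \<forall>i<n + m. \<bar>\<theta> i\<bar> \<le> 2 \<Longrightarrow> ?near \<omega> t (?u \<theta>)"
    and feat_unit: "\<And>\<omega> t i \<theta>. \<omega> \<in> S \<Longrightarrow> t < T \<Longrightarrow> \<forall>i<n + m. \<bar>\<theta> i\<bar> \<le> 2 \<Longrightarrow> i < n + m \<Longrightarrow>
         ?near \<omega> t (\<lambda>x. feature i x * ?u \<theta> x)"
    by blast
  have u_meas[measurable]: "?u \<theta> \<in> borel_measurable D" for \<theta> by measurable
  \<comment> \<open>Features and latent variables agree on \<open>typical\<close> up to the factor
    \<open>a\<close>, which is 1 for the code and \<open>C\<close> for the noise; both the samples
    and almost all of the space lie there.\<close>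
  have near_scale: "\<bar>(\<Sum>k<N. g (\<omega> (t, k))) / real N - (\<integral>x. g x \<partial>D)\<bar> \<le> a * \<tau>"
    if "\<omega> \<in> S" "t < T" "?near \<omega> t f" "\<And>x. x \<in> typical \<Longrightarrow> g x = a * f x" "0 \<le> a"
      "f \<in> borel_measurable D" "g \<in> borel_measurable D" for \<omega> t a and f g :: "latent \<Rightarrow> real"
  proof -
    have "(\<Sum>k<N. g (\<omega> (t, k))) = a * (\<Sum>k<N. f (\<omega> (t, k)))"
      using typic that(1,2,4) by (simp add: sum_distrib_left)
    moreover have "(\<integral>x. g x \<partial>D) = (\<integral>x. a * f x \<partial>D)"
      by (rule integral_cong_typical) (use that in auto)
    ultimately have "\<bar>(\<Sum>k<N. g (\<omega> (t, k))) / real N - (\<integral>x. g x \<partial>D)\<bar>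
        = \<bar>a * ((\<Sum>k<N. f (\<omega> (t, k))) / real N - (\<integral>x. f x \<partial>D))\<bar>"
      by (simp add: right_diff_distrib)
    also have "\<dots> \<le> a * \<tau>" using that(3,5) by (simp add: abs_mult mult_left_mono)
    finally show ?thesis .
  qed
  have "representative \<alpha> \<tau> N (\<lambda>k. \<omega> (t, k))" if \<omega>: "\<omega> \<in> S" "t < T" for \<omega> t
    unfolding representative_def
  proof (intro conjI allI impI)
    show "\<omega> (t, k) \<in> typical" if "k < N" for k by (rule typic[OF \<omega> that])
    show "\<bar>(\<Sum>k<N. fst (\<omega> (t, k)) i) / real N - p\<bar> \<le> \<tau>" if "i < n" for i
      using near_scale[OF \<omega> feat[OF \<omega>, of i], of "\<lambda>x. fst x i" 1] that feature_code expectation_code by simp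
    show "\<bar>(\<Sum>k<N. snd (\<omega> (t, k)) i) / real N\<bar> \<le> C * \<tau>" if "i < m" for i
      using near_scale[OF \<omega> feat[OF \<omega>, of "n + i"], of "\<lambda>x. snd x i" C] that feature_noise expectation_noise C_nonneg by simp
    fix w u :: "nat \<Rightarrow> real" assume w: "\<forall>k<n. \<bar>w k\<bar> \<le> 2" and u: "\<forall>k<m. \<bar>u k\<bar> * C \<le> 2"
    define \<theta> where "\<theta> i = (if i < n then w i else u (i - n) * C)" for i
    have \<theta>: "\<forall>i<n + m. \<bar>\<theta> i\<bar> \<le> 2" using w u C_nonneg by (auto simp: \<theta>_def abs_mult)
    have dec: "decoded \<alpha> w u x = ?u \<theta> x" if "x \<in> typical" for x
      using decoded_eq_feature_unit[OF that] by (simp add: \<theta>_def)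
    show "\<bar>(\<Sum>k<N. decoded \<alpha> w u (\<omega> (t, k))) / real N - (\<integral>\<omega>. decoded \<alpha> w u \<omega> \<partial>D)\<bar> \<le> \<tau>"
      using near_scale[OF \<omega> unit[OF \<omega> \<theta>], of "decoded \<alpha> w u" 1] dec by simp
    show "\<bar>(\<Sum>k<N. fst (\<omega> (t, k)) i * decoded \<alpha> w u (\<omega> (t, k))) / real N
                  - (\<integral>\<omega>. fst \<omega> i * decoded \<alpha> w u \<omega> \<partial>D)\<bar> \<le> \<tau>" if "i < n" for i
      using near_scale[OF \<omega> feat_unit[OF \<omega> \<theta>, of i], of "\<lambda>x. fst x i * decoded \<alpha> w u x" 1] dec feature_code that
      by simp
    show "\<bar>(\<Sum>k<N. snd (\<omega> (t, k)) i * decoded \<alpha> w u (\<omega> (t, k))) / real N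
                  - (\<integral>\<omega>. snd \<omega> i * decoded \<alpha> w u \<omega> \<partial>D)\<bar> \<le> C * \<tau>" if "i < m" for i
      using near_scale[OF \<omega> feat_unit[OF \<omega> \<theta>, of "n + i"], of "\<lambda>x. snd x i * decoded \<alpha> w u x" C]
        dec feature_noise[symmetric] that C_nonneg
      by simp
  qed
  with S show ?thesis unfolding sample_law_def by blast
qed

end

section \<open>Iterates and their decoding matrices\<close>

text \<open>\<open>noise_decoded\<close> and \<open>noise_total\<close> unfold the two entries of
  the maximum in the noise level. The first limits the noise in a decoded coordinate, the second the
  column sums of the residual. \<open>sparse\<close> expresses that n is large compared with s: its
  two parts give p <= 1/100 and 4 s \<xi> = O(c) for decoding noise \<xi> = O(c / sqrt n).\<close>

locale purification_setup = sparse_model +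
  fixes Astar Adag :: "real mat" and c :: real
  assumes Astar: "Astar \<in> carrier_mat m n" and Adag: "Adag \<in> carrier_mat n m"
    and Adag_Astar: "Adag * Astar = 1\<^sub>m n"
    and c_nonneg: "0 \<le> c" and c_le: "c \<le> 1"
    and noise_decoded: "norm_infty Adag * C \<le> c / (1000 * sqrt (real n))"
    and noise_total: "real m * C \<le> c * sqrt (real n) / 1000"
    and sparse: "100 * s \<le> real n" "2 * s \<le> sqrt (real n)"
begin

text \<open>The invariant of the algorithm. \<open>S\<close> is kept as the bare diagonal and has no
  upper bound, because the initialisation has none. The residual is bounded entrywise, since
  \<open>P R\<close> has to be small in its row sums and in its column sums.\<close>

definition iterate :: "real \<Rightarrow> real mat \<Rightarrow> (nat \<Rightarrow> real) \<Rightarrow> (nat \<Rightarrow> nat \<Rightarrow> real) \<Rightarrow> (nat \<Rightarrow> nat \<Rightarrow> real) \<Rightarrow> bool" where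
  "iterate e A S E R \<longleftrightarrow>
     A \<in> carrier_mat m n \<and>
     (\<forall>i<m. \<forall>j<n. A $$ (i, j) = (\<Sum>h<n. Astar $$ (i, h) * ((if h = j then S j else 0) + E h j)) + R i j) \<and>
     (\<forall>j<n. 9/10 \<le> S j \<and> E j j = 0) \<and>
     (\<forall>h<n. (\<Sum>j<n. \<bar>E h j\<bar>) \<le> e) \<and> (\<forall>j<n. (\<Sum>h<n. \<bar>E h j\<bar>) \<le> e) \<and>
     (\<forall>i<m. \<forall>j<n. \<bar>R i j\<bar> \<le> 10 * C / sqrt (real n))"

lemma sqrt_n: "1 \<le> sqrt (real n)" "sqrt (real n) * sqrt (real n) = real n"
  using n_pos by auto

text \<open>Entrywise form of P A = W (\<Sigma> + E) + P R. For a left inverse of the iterate this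
  is the linear system for \<open>W\<close>; for \<open>Adag\<close>, where \<open>W\<close> is the
  identity, it exhibits \<open>Adag * A\<close> as nearly diagonal.\<close>

lemma left_mult_iterate:
  assumes it: "iterate e A S E R" and P: "P \<in> carrier_mat n m" and j: "j < n" and i: "i < n"
  shows "(P * A) $$ (j, i) = (P * Astar) $$ (j, i) * S i + (\<Sum>h<n. (P * Astar) $$ (j, h) * E h i) + (\<Sum>k<m. P $$ (j, k) * R k i)"
proof -
  have A: "A \<in> carrier_mat m n"
    and A_eq: "\<And>k. k < m \<Longrightarrow> A $$ (k, i) = (\<Sum>h<n. Astar $$ (k, h) * ((if h = i then S i else 0) + E h i)) + R k i"
    using it i by (auto simp: iterate_def)
  have "(P * A) $$ (j, i) = (\<Sum>k<m. P $$ (j, k) * A $$ (k, i))" by (rule mult_mat_index[OF P A j i])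
  also have "\<dots> = (\<Sum>k<m. (\<Sum>h<n. P $$ (j, k) * Astar $$ (k, h) * ((if h = i then S i else 0) + E h i)) + P $$ (j, k) * R k i)"
    by (intro sum.cong) (auto simp: A_eq distrib_left sum_distrib_left mult.assoc)
  also have "\<dots> = (\<Sum>k<m. \<Sum>h<n. P $$ (j, k) * Astar $$ (k, h) * ((if h = i then S i else 0) + E h i)) + (\<Sum>k<m. P $$ (j, k) * R k i)"
    by (simp add: sum.distrib)
  also have "(\<Sum>k<m. \<Sum>h<n. P $$ (j, k) * Astar $$ (k, h) * ((if h = i then S i else 0) + E h i))
      = (\<Sum>h<n. (P * Astar) $$ (j, h) * ((if h = i then S i else 0) + E h i))"
    by (subst sum.swap) (auto simp: mult_mat_index[OF P Astar j] sum_distrib_right intro!: sum.cong)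
  also have "\<dots> = (\<Sum>h<n. (if h = i then (P * Astar) $$ (j, h) * S i else 0) + (P * Astar) $$ (j, h) * E h i)"
    by (intro sum.cong) (auto simp: distrib_left)
  also have "\<dots> = (P * Astar) $$ (j, i) * S i + (\<Sum>h<n. (P * Astar) $$ (j, h) * E h i)"
    using i by (simp add: sum.distrib)
  finally show ?thesis .
qed

text \<open>The two factors 1 / sqrt n, one from the residual and one from
  \<open>noise_decoded\<close>, combine to 1/n, so that a row or a column of n such entries sums to
  at most c/50. The norm condition covers both \<open>Adag\<close> itself and the minimum-norm left
  inverse.\<close>

lemma residual_le:
  assumes it: "iterate e A S E R" and P: "P \<in> carrier_mat n m" and j: "j < n" and i: "i < n"
    and K: "norm_infty P \<le> 2 * norm_infty Adag"
  shows "\<bar>\<Sum>k<m. P $$ (j, k) * R k i\<bar> \<le> c / 50 / real n"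
proof -
  have "\<bar>\<Sum>k<m. P $$ (j, k) * R k i\<bar> \<le> (\<Sum>k<m. \<bar>P $$ (j, k)\<bar> * (10 * C / sqrt (real n)))"
  proof (rule order_trans[OF sum_abs], rule sum_mono)
    fix k assume "k \<in> {..<m}"
    then have "\<bar>R k i\<bar> \<le> 10 * C / sqrt (real n)" using it i by (simp add: iterate_def)
    then show "\<bar>P $$ (j, k) * R k i\<bar> \<le> \<bar>P $$ (j, k)\<bar> * (10 * C / sqrt (real n))"
      unfolding abs_mult by (rule mult_left_mono) simp
  qed
  also have "\<dots> \<le> (2 * norm_infty Adag) * (10 * C / sqrt (real n))"
    unfolding sum_distrib_right[symmetric]
    by (intro mult_right_mono order_trans[OF row_sum_le_norm_infty[OF P j] K]) (use C_nonneg in auto)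
  also have "\<dots> = 20 / sqrt (real n) * (norm_infty Adag * C)" by simp
  also have "\<dots> \<le> 20 / sqrt (real n) * (c / (1000 * sqrt (real n)))"
    by (intro mult_left_mono noise_decoded) auto
  also have "\<dots> = c / 50 / (sqrt (real n) * sqrt (real n))" by simp
  finally show ?thesis unfolding sqrt_n by simp
qed

lemma Adag_pos: "0 \<le> norm_infty Adag" by (rule norm_infty_nonneg[OF Adag n_pos])

text \<open>The competitor for the minimum norm. \<open>Adag * A\<close> has diagonal at least 9/10
  up to a perturbation with row sums at most 1/10 + 1/50, so it has a left inverse X, and X
  \<open>Adag\<close> inverts the iterate. The rows of X sum to at most 1 / (9/10 - 12/100) <
  2.\<close>

lemma iterate_left_inverse:
  assumes it: "iterate e A S E R" and e: "e \<le> 1/10"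
  shows "\<exists>Q\<in>carrier_mat n m. Q * A = 1\<^sub>m n \<and> norm_infty Q \<le> 2 * norm_infty Adag"
proof -
  have A: "A \<in> carrier_mat m n" using it by (simp add: iterate_def)
  have S: "\<And>i. i < n \<Longrightarrow> 9/10 \<le> S i" and E: "\<And>k. k < n \<Longrightarrow> (\<Sum>i<n. \<bar>E k i\<bar>) \<le> e"
    using it by (auto simp: iterate_def)
  let ?F = "\<lambda>j i. \<Sum>k<m. Adag $$ (j, k) * R k i"
  let ?M = "Adag * A"
  have M: "?M \<in> carrier_mat n n" using Adag A by simp
  have F: "\<bar>?F j i\<bar> \<le> 1 / 50 / real n" if "j < n" "i < n" for i j
  proof -
    have "\<bar>?F j i\<bar> \<le> c / 50 / real n" using residual_le[OF it Adag that] Adag_pos by simp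
    also have "\<dots> \<le> 1 / 50 / real n" using c_le by (intro divide_right_mono) auto
    finally show ?thesis .
  qed
  have F_sum: "(\<Sum>i<n. \<bar>?F j i\<bar>) \<le> 1/50" if "j < n" for j
    using sum_mono[of "{..<n}" "\<lambda>i. \<bar>?F j i\<bar>" "\<lambda>_. 1 / 50 / real n"] F[OF that] n_pos by simp
  have M_eq: "?M $$ (j, i) = (if j = i then S i else 0) + (E j i + ?F j i)" if "j < n" "i < n" for i j
  proof -
    have "(\<Sum>h<n. (Adag * Astar) $$ (j, h) * E h i) = (\<Sum>h<n. if h = j then E h i else 0)"
      using that unfolding Adag_Astar by (intro sum.cong) auto
    then show ?thesis using left_mult_iterate[OF it Adag that] that by (simp add: Adag_Astar)
  qed
  have EF_sum: "(\<Sum>i<n. \<bar>E j i + ?F j i\<bar>) \<le> 12/100" if "j < n" for j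
  proof -
    have "(\<Sum>i<n. \<bar>E j i + ?F j i\<bar>) \<le> (\<Sum>i<n. \<bar>E j i\<bar> + \<bar>?F j i\<bar>)" by (intro sum_mono) auto
    then show ?thesis using E[OF that] F_sum[OF that] e by (simp add: sum.distrib)
  qed
  have "(\<Sum>k\<in>{..<n} - {i}. \<bar>?M $$ (i, k)\<bar>) < \<bar>?M $$ (i, i)\<bar>" if i: "i < n" for i
  proof -
    have "(\<Sum>k\<in>{..<n} - {i}. \<bar>?M $$ (i, k)\<bar>) = (\<Sum>k\<in>{..<n} - {i}. \<bar>E i k + ?F i k\<bar>)"
      by (intro sum.cong) (use M_eq i in auto)
    also have "\<dots> = (\<Sum>k<n. \<bar>E i k + ?F i k\<bar>) - \<bar>E i i + ?F i i\<bar>" using i by (simp add: sum.remove)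
    also have "\<dots> < \<bar>?M $$ (i, i)\<bar>" using EF_sum[OF i] S[OF i] M_eq[OF i i] by simp
    finally show ?thesis .
  qed
  from diagonally_dominant_left_inverse[OF M this]
  obtain X where X: "X \<in> carrier_mat n n" "X * ?M = 1\<^sub>m n" by auto
  have "(\<Sum>i<n. \<bar>X $$ (j, i)\<bar>) \<le> 2" if j: "j < n" for j
  proof -
    have eq: "X $$ (j, i) * S i + (\<Sum>k<n. X $$ (j, k) * (E k i + ?F k i)) = (if i = j then 1 else 0) - 0" if i: "i < n" for i
    proof -
      have "(X * ?M) $$ (j, i) = (\<Sum>k<n. X $$ (j, k) * ?M $$ (k, i))" by (rule mult_mat_index[OF X(1) M j i])
      also have "\<dots> = (\<Sum>k<n. (if k = i then X $$ (j, k) * S i else 0) + X $$ (j, k) * (E k i + ?F k i))"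
        by (intro sum.cong) (use M_eq i in \<open>auto simp: distrib_left\<close>)
      also have "\<dots> = X $$ (j, i) * S i + (\<Sum>k<n. X $$ (j, k) * (E k i + ?F k i))"
        unfolding sum.distrib using i by simp
      finally show ?thesis using X(2) i j by (simp add: eq_commute[of i j])
    qed
    from row_solution_bounds(1)[where E = "\<lambda>k i. E k i + ?F k i", OF eq S EF_sum _ j, of 0]
    show ?thesis by simp
  qed
  then have X_norm: "norm_infty X \<le> 2" using norm_infty_le_iff[OF X(1) n_pos] by blast
  show ?thesis
  proof (intro bexI conjI)
    show "X * Adag \<in> carrier_mat n m" using X Adag by simp
    show "(X * Adag) * A = 1\<^sub>m n" using assoc_mult_mat[OF X(1) Adag A] X(2) by simp
    have "norm_infty (X * Adag) \<le> norm_infty X * norm_infty Adag"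
      by (rule norm_infty_mult_le[OF X(1) Adag n_pos n_pos])
    also have "\<dots> \<le> 2 * norm_infty Adag" by (intro mult_right_mono X_norm Adag_pos)
    finally show "norm_infty (X * Adag) \<le> 2 * norm_infty Adag" .
  qed
qed

lemma iterate_min_left_inverse_exists:
  assumes "iterate e A S E R" "e \<le> 1/10"
  shows "\<exists>P. is_min_left_inverse A P"
  using iterate_left_inverse[OF assms] assms(1) n_pos by (auto simp: iterate_def intro: exists_min_left_inverse)

lemma min_left_inverse_norm_le:
  assumes it: "iterate e A S E R" "e \<le> 1/10" and P: "is_min_left_inverse A P"
  shows "P \<in> carrier_mat n m" "P * A = 1\<^sub>m n" "norm_infty P \<le> 2 * norm_infty Adag"
proof -
  have "A \<in> carrier_mat m n" using it by (simp add: iterate_def)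
  then have dims: "dim_row A = m" "dim_col A = n" by auto
  show "P \<in> carrier_mat n m" "P * A = 1\<^sub>m n" using P unfolding is_min_left_inverse_def dims by auto
  show "norm_infty P \<le> 2 * norm_infty Adag"
    using iterate_left_inverse[OF it] P unfolding is_min_left_inverse_def dims by force
qed

text \<open>With e <= 1/10 and q = c/50 the general bounds become 51/40 = (1 + 1/50) / (4/5), 17/12
  = (51/40) / (9/10) and c/45 = (c/50) / (9/10). On the diagonal only the product
  \<open>W j j * S j\<close> can be bounded below, as \<open>S j\<close> may be large; it differs
  from 1 by the residual, at most 1/50, and by off-diagonal weights times entries of
  \<open>E\<close>, a second-order term.\<close>

lemma decoding_matrix_bounds:
  assumes it: "iterate e A S E R" and e: "0 \<le> e" "e \<le> 1/10" and P: "is_min_left_inverse A P"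
  defines "W \<equiv> \<lambda>j i. (P * Astar) $$ (j, i)"
  shows "j < n \<Longrightarrow> (\<Sum>i<n. \<bar>W j i\<bar>) \<le> 51/40"
    and "j < n \<Longrightarrow> (\<Sum>i\<in>{..<n} - {j}. \<bar>W j i\<bar>) \<le> c/45 + 17/12 * e"
    and "i < n \<Longrightarrow> (\<Sum>j\<in>{..<n} - {i}. \<bar>W j i\<bar>) \<le> c/45 + 17/12 * e"
    and "j < n \<Longrightarrow> 24/25 \<le> W j j * S j"
proof -
  note P' = min_left_inverse_norm_le[OF it e(2) P]
  have S: "\<And>i. i < n \<Longrightarrow> 9/10 \<le> S i" and E0: "\<And>i. i < n \<Longrightarrow> E i i = 0"
    and E_row: "\<And>k. k < n \<Longrightarrow> (\<Sum>i<n. \<bar>E k i\<bar>) \<le> e" and E_col: "\<And>i. i < n \<Longrightarrow> (\<Sum>k<n. \<bar>E k i\<bar>) \<le> e"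
    using it by (auto simp: iterate_def)
  define F where "F j i = (\<Sum>k<m. P $$ (j, k) * R k i)" for j i
  have F: "\<bar>F j i\<bar> \<le> c / 50 / real n" if "j < n" "i < n" for i j
    unfolding F_def by (rule residual_le[OF it P'(1) that P'(3)])
  have F_row: "(\<Sum>i<n. \<bar>F j i\<bar>) \<le> c/50" if "j < n" for j
    using sum_mono[of "{..<n}" "\<lambda>i. \<bar>F j i\<bar>" "\<lambda>_. c / 50 / real n"] F[OF that] n_pos by simp
  have F_col: "(\<Sum>j<n. \<bar>F j i\<bar>) \<le> c/50" if "i < n" for i
    using sum_mono[of "{..<n}" "\<lambda>j. \<bar>F j i\<bar>" "\<lambda>_. c / 50 / real n"] F that n_pos by simp
  have eq: "W j i * S i + (\<Sum>k<n. W j k * E k i) = (if i = j then 1 else 0) - F j i" if "i < n" "j < n" for i j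
    using left_mult_iterate[OF it P'(1) that(2,1)] that unfolding P'(2) by (auto simp: W_def F_def)
  show W1: "(\<Sum>i<n. \<bar>W j i\<bar>) \<le> 51/40" if j: "j < n" for j
  proof -
    have "4/5 * (\<Sum>i<n. \<bar>W j i\<bar>) \<le> (9/10 - e) * (\<Sum>i<n. \<bar>W j i\<bar>)"
      using e by (intro mult_right_mono sum_nonneg) auto
    with row_solution_bounds(1)[where v = "W j" and R = "F j" and j = j, OF eq[OF _ j] S E_row F_row[OF j] j] c_le
    show ?thesis by simp
  qed
  show W2: "(\<Sum>i\<in>{..<n} - {j}. \<bar>W j i\<bar>) \<le> c/45 + 17/12 * e" if j: "j < n" for j
  proof -
    have "e * (\<Sum>i<n. \<bar>W j i\<bar>) \<le> e * (51/40)" using W1[OF j] e by (intro mult_left_mono) auto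
    with row_solution_bounds(2)[where v = "W j" and R = "F j" and j = j, OF eq[OF _ j] S E_row F_row[OF j] j]
    show ?thesis by simp
  qed
  show "(\<Sum>j\<in>{..<n} - {i}. \<bar>W j i\<bar>) \<le> c/45 + 17/12 * e" if i: "i < n" for i
  proof -
    have "9/10 * (\<Sum>j\<in>{..<n} - {i}. \<bar>W j i\<bar>) \<le> c/50 + e * ((1 + c/50) / (9/10 - e))"
      using column_solution_bounds[of n W S E F e "c/50" i, OF eq S E_col F_col _ _ i] e by simp
    also have "(1 + c/50) / (9/10 - e) \<le> (51/50) / (4/5)" using e c_le c_nonneg by (intro frac_le) auto
    then have "e * ((1 + c/50) / (9/10 - e)) \<le> e * ((51/50) / (4/5))" using e by (intro mult_left_mono)
    finally show ?thesis by simp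
  qed
  show "24/25 \<le> W j j * S j" if j: "j < n" for j
  proof -
    have "(\<Sum>k<n. W j k * E k j) = (\<Sum>k\<in>{..<n} - {j}. W j k * E k j)"
      using j E0[OF j] by (simp add: sum.remove)
    also have "\<bar>\<dots>\<bar> \<le> (\<Sum>k\<in>{..<n} - {j}. \<bar>W j k\<bar> * e)"
    proof (rule order_trans[OF sum_abs], rule sum_mono)
      fix k assume "k \<in> {..<n} - {j}"
      then have k: "k < n" by simp
      have "\<bar>E k j\<bar> \<le> (\<Sum>i<n. \<bar>E k i\<bar>)" using j by (intro member_le_sum) auto
      then have "\<bar>E k j\<bar> \<le> e" using E_row[OF k] by linarith
      then show "\<bar>W j k * E k j\<bar> \<le> \<bar>W j k\<bar> * e" by (simp add: abs_mult mult_left_mono)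
    qed
    also have "\<dots> \<le> (c/45 + 17/12 * e) * e" unfolding sum_distrib_right[symmetric]
      using W2[OF j] e by (intro mult_right_mono) auto
    also have "\<dots> \<le> (1/45 + 17/120) * (1/10)" using c_le c_nonneg e by (intro mult_mono) auto
    finally have "\<bar>\<Sum>k<n. W j k * E k j\<bar> \<le> (1/45 + 17/120) * (1/10)" .
    moreover have "\<bar>F j j\<bar> \<le> 1/50"
    proof -
      have "\<bar>F j j\<bar> \<le> (\<Sum>i<n. \<bar>F j i\<bar>)" using j by (intro member_le_sum) auto
      then show ?thesis using F_row[OF j] c_le by linarith
    qed
    ultimately show ?thesis using eq[OF j j] by simp
  qed
qed

end

section \<open>One iteration\<close>

text \<open>Twice the empirical covariance; the factor is kept because averaging over ordered pairs
  produces it.\<close>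

definition sample_cov :: "nat \<Rightarrow> (nat \<Rightarrow> real) \<Rightarrow> (nat \<Rightarrow> real) \<Rightarrow> real" where
  "sample_cov N f g = 2 * ((\<Sum>k<N. f k * g k) / real N - (\<Sum>k<N. f k) / real N * ((\<Sum>k<N. g k) / real N))"

lemma sample_cov_linear:
  "sample_cov N (\<lambda>k. (\<Sum>h<n. a h * f h k) + v k) g = (\<Sum>h<n. a h * sample_cov N (f h) g) + sample_cov N v g"
proof -
  have 1: "(\<Sum>k<N. ((\<Sum>h<n. a h * f h k) + v k) * g k) = (\<Sum>h<n. a h * (\<Sum>k<N. f h k * g k)) + (\<Sum>k<N. v k * g k)"
    by (simp add: distrib_right sum.distrib sum_distrib_left sum_distrib_right mult.assoc) (rule sum.swap)
  have 2: "(\<Sum>k<N. (\<Sum>h<n. a h * f h k) + v k) = (\<Sum>h<n. a h * (\<Sum>k<N. f h k)) + (\<Sum>k<N. v k)"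
    by (simp add: sum.distrib sum_distrib_left) (rule sum.swap)
  show ?thesis
    unfolding sample_cov_def 1 2
    by (simp add: add_divide_distrib sum_divide_distrib distrib_right sum_distrib_right sum_distrib_left
        right_diff_distrib sum_subtractf algebra_simps)
qed

text \<open>The separate tolerance \<open>d\<close> allows for noise, where it is
  \<open>C * \<tau>\<close>; for the code it is \<tau>. The mean of \<open>g\<close> is at most
  13/10 + 1, so the product of means is off by at most (23/10 + 1) d, and 2 (1 + 33/10) d <= 10
  d.\<close>

lemma sample_cov_deviation:
  assumes "\<bar>(\<Sum>k<N. f k * g k) / real N - a\<bar> \<le> d" "\<bar>(\<Sum>k<N. f k) / real N - b\<bar> \<le> d"
    "\<bar>(\<Sum>k<N. g k) / real N - y\<bar> \<le> \<tau>" "\<bar>b\<bar> * \<tau> \<le> d" "\<bar>y\<bar> \<le> 13/10" "0 \<le> \<tau>" "\<tau> \<le> 1"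
  shows "\<bar>sample_cov N f g - 2 * (a - b * y)\<bar> \<le> 10 * d"
proof -
  define F G H where "F = (\<Sum>k<N. f k) / real N" and "G = (\<Sum>k<N. g k) / real N" and "H = (\<Sum>k<N. f k * g k) / real N"
  have d: "0 \<le> d" using assms(1) by linarith
  have "\<bar>F - b\<bar> * \<bar>G\<bar> \<le> d * (23/10)" using assms unfolding F_def[symmetric] G_def[symmetric]
    by (intro mult_mono) auto
  moreover have "\<bar>b\<bar> * \<bar>G - y\<bar> \<le> \<bar>b\<bar> * \<tau>" using assms unfolding G_def[symmetric]
    by (intro mult_left_mono) auto
  moreover have "F * G - b * y = (F - b) * G + b * (G - y)" by (simp add: algebra_simps)
  then have "\<bar>F * G - b * y\<bar> \<le> \<bar>F - b\<bar> * \<bar>G\<bar> + \<bar>b\<bar> * \<bar>G - y\<bar>"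
    unfolding abs_mult[symmetric] by linarith
  ultimately have FG: "\<bar>F * G - b * y\<bar> \<le> 33/10 * d" using assms(4) by linarith
  have "2 * (H - F * G) - 2 * (a - b * y) = 2 * (H - a) - 2 * (F * G - b * y)" by (simp add: algebra_simps)
  also have "\<bar>\<dots>\<bar> \<le> 2 * \<bar>H - a\<bar> + 2 * \<bar>F * G - b * y\<bar>"
  proof -
    have "\<bar>2 * u - 2 * v\<bar> \<le> 2 * \<bar>u\<bar> + 2 * \<bar>v\<bar>" for u v :: real by linarith
    then show ?thesis .
  qed
  also have "\<dots> \<le> 10 * d"
  proof -
    have "2 * u + 2 * v \<le> 10 * d" if "u \<le> d" "v \<le> 33/10 * d" for u v using that d by linarith
    then show ?thesis using FG assms(1) unfolding H_def[symmetric] by blast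
  qed
  finally have "\<bar>2 * (H - F * G) - 2 * (a - b * y)\<bar> \<le> 10 * d" .
  then show ?thesis by (simp add: sample_cov_def F_def G_def H_def)
qed

context purification_setup
begin

lemma decode_data_point:
  assumes P: "P \<in> carrier_mat n m" and j: "j < n"
  shows "vec_index (decode \<alpha> P (data_point Astar \<omega>)) j
       = decoded \<alpha> (\<lambda>h. (P * Astar) $$ (j, h)) (\<lambda>k. P $$ (j, k)) \<omega>"
proof -
  have y: "vec_index (data_point Astar \<omega>) k = (\<Sum>h<n. Astar $$ (k, h) * fst \<omega> h) + snd \<omega> k" if "k < m" for k
    using Astar that by (auto simp: data_point_def scalar_prod_def atLeast0LessThan intro!: sum.cong)
  have "vec_index (P *\<^sub>v data_point Astar \<omega>) j = (\<Sum>k<m. P $$ (j, k) * vec_index (data_point Astar \<omega>) k)"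
    using P Astar j by (auto simp: data_point_def scalar_prod_def atLeast0LessThan intro!: sum.cong)
  also have "\<dots> = (\<Sum>k<m. (\<Sum>h<n. P $$ (j, k) * Astar $$ (k, h) * fst \<omega> h) + P $$ (j, k) * snd \<omega> k)"
    by (intro sum.cong) (auto simp: y distrib_left sum_distrib_left mult.assoc)
  also have "\<dots> = (\<Sum>k<m. \<Sum>h<n. P $$ (j, k) * Astar $$ (k, h) * fst \<omega> h) + (\<Sum>k<m. P $$ (j, k) * snd \<omega> k)"
    by (simp add: sum.distrib)
  also have "(\<Sum>k<m. \<Sum>h<n. P $$ (j, k) * Astar $$ (k, h) * fst \<omega> h) = (\<Sum>h<n. (P * Astar) $$ (j, h) * fst \<omega> h)"
    by (subst sum.swap) (auto simp: mult_mat_index[OF P Astar j] sum_distrib_right intro!: sum.cong)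
  finally show ?thesis using P j by (simp add: decode_def decoded_def)
qed

text \<open>The covariance is bilinear and a data point is linear in code and noise. Hence the
  update is again \<open>Astar\<close> times a matrix plus a residual: code covariances enter the
  former, noise covariances the latter.\<close>

lemma purification_step_index:
  fixes \<omega> :: "nat \<Rightarrow> latent" and \<alpha> \<eta> r :: real
  assumes A: "A \<in> carrier_mat m n" and P: "P \<in> carrier_mat n m" and N: "N > 0" and i: "i < m" and j: "j < n"
  defines "X \<equiv> \<lambda>k. decoded \<alpha> (\<lambda>h. (P * Astar) $$ (j, h)) (\<lambda>k. P $$ (j, k)) (\<omega> k)"
  shows "purification_step \<alpha> \<eta> r N A P (\<lambda>k. data_point Astar (\<omega> k)) $$ (i, j)
       = (1 - \<eta>) * A $$ (i, j) + r * \<eta> * ((\<Sum>h<n. Astar $$ (i, h) * sample_cov N (\<lambda>k. fst (\<omega> k) h) X)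
           + sample_cov N (\<lambda>k. snd (\<omega> k) i) X)"
proof -
  let ?y = "\<lambda>k. data_point Astar (\<omega> k)" and ?x = "\<lambda>k. decode \<alpha> P (data_point Astar (\<omega> k))"
  have dim_y: "dim_vec (?y k) = m" and dim_x: "dim_vec (?x k) = n" for k
    using Astar P by (auto simp: data_point_def decode_def)
  have y: "vec_index (?y k) i = (\<Sum>h<n. Astar $$ (i, h) * fst (\<omega> k) h) + snd (\<omega> k) i" for k
    using Astar i by (auto simp: data_point_def scalar_prod_def atLeast0LessThan intro!: sum.cong)
  have x: "vec_index (?x k) j = X k" for k
    unfolding X_def by (rule decode_data_point[OF P j])
  have "empirical_corr m n N ?y ?x $$ (i, j)
      = (\<Sum>k<N. \<Sum>l<N. (vec_index (?y k) i - vec_index (?y l) i) * (X k - X l)) / (real N)\<^sup>2"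
    using i j by (simp add: empirical_corr_def dim_x dim_y x)
  also have "\<dots> = sample_cov N (\<lambda>k. vec_index (?y k) i) X"
    unfolding pairwise_difference_average[OF N] sample_cov_def ..
  also have "\<dots> = (\<Sum>h<n. Astar $$ (i, h) * sample_cov N (\<lambda>k. fst (\<omega> k) h) X) + sample_cov N (\<lambda>k. snd (\<omega> k) i) X"
    unfolding y by (rule sample_cov_linear)
  finally show ?thesis
    using A i j unfolding purification_step_def by (simp add: empirical_corr_def)
qed

text \<open>Nine tenths of the old error survive. The new covariances add 1/10 of 2 p (c/45 + 17/12
  e) + 4 s \<xi> + \<epsilon>/1000, which p <= 1/100 and 4 s \<xi> <= c/250 push below the remaining
  allowances e/20, c/400 and \<epsilon>/400.\<close>

lemma step_iterate:
  assumes it: "iterate e A S E R" and e: "0 \<le> e" "e \<le> 1/10" and P: "is_min_left_inverse A P"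
    and rep: "representative (1/5) \<tau> N \<omega>" and N: "N > 0"
    and \<epsilon>: "0 < \<epsilon>" "\<epsilon> \<le> 1" and \<tau>: "\<tau> = s * \<epsilon> / (10000 * (real n)\<^sup>2)"
  shows "\<exists>S' E' R'. iterate (19/20 * e + c / 400 + \<epsilon> / 400)
           (purification_step (1/5) (1/10) (real n / s) N A P (\<lambda>k. data_point Astar (\<omega> k))) S' E' R'"
proof -
  note P' = min_left_inverse_norm_le[OF it e(2) P]
  note W_bounds = decoding_matrix_bounds[OF it e P]
  have A: "A \<in> carrier_mat m n" using it by (simp add: iterate_def)
  define W where "W j i = (P * Astar) $$ (j, i)" for j i
  define u where "u j k = P $$ (j, k)" for j k
  \<comment> \<open>Bounds the noise in a decoded coordinate: rows of \<open>P\<close> have l1 norm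
    at most twice \<open>norm_infty Adag\<close>.\<close>
  define \<xi> where "\<xi> = 2 * norm_infty Adag * C"
  define X where "X j = decoded (1/5) (W j) (u j)" for j
  define B where "B h j = sample_cov N (\<lambda>k. fst (\<omega> k) h) (\<lambda>k. X j (\<omega> k))" for h j
  define V where "V i j = sample_cov N (\<lambda>k. snd (\<omega> k) i) (\<lambda>k. X j (\<omega> k))" for i j
  \<comment> \<open>The sampling error of one entry after multiplication by r, that is 10 \<tau> /
    p. The tolerance \<tau> is chosen so that n such errors in a row or column add up to \<epsilon>
    / 1000.\<close>
  define \<kappa> where "\<kappa> = \<epsilon> / (1000 * real n)"
  have n1: "1 \<le> real n" using n_pos by simp
  have pn: "p * real n = s" using n_pos by (simp add: p_def)
  have p_small: "p \<le> 1/100" using sparse(1) n_pos by (simp add: p_def field_simps)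
  have r_p: "real n / s = 1 / p" by (simp add: p_def)
  have \<tau>_pos: "0 < \<tau>" using \<tau> \<epsilon> s_pos n_pos by simp
  have \<tau>_r: "10 * \<tau> / p = \<kappa>" unfolding \<tau> \<kappa>_def p_def using n_pos s_pos by (simp add: field_simps power2_eq_square)
  have \<kappa>: "0 < \<kappa>" "\<kappa> \<le> 1/1000" "\<kappa> * real n = \<epsilon> / 1000"
    using \<epsilon> n1 by (auto simp: \<kappa>_def field_simps)
  have \<tau>_le: "\<tau> \<le> 1"
  proof -
    have "10 * \<tau> = \<kappa> * p" using \<tau>_r p_pos by (simp add: field_simps)
    also have "\<dots> \<le> 1 * 1" using \<kappa> p_pos p_small by (intro mult_mono) auto
    finally show ?thesis by simp
  qed
  have \<xi>0: "0 \<le> \<xi>" using Adag_pos C_nonneg by (simp add: \<xi>_def)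
  have \<xi>_le: "\<xi> \<le> c / (500 * sqrt (real n))" using noise_decoded by (simp add: \<xi>_def)
  have \<xi>_small: "\<xi> \<le> 1/500"
  proof -
    have "c / (500 * sqrt (real n)) \<le> 1 / (500 * 1)" using c_le c_nonneg sqrt_n by (intro frac_le) auto
    then show ?thesis using \<xi>_le by simp
  qed
  have s\<xi>: "4 * s * \<xi> \<le> c / 250"
  proof -
    have "4 * s \<le> 2 * sqrt (real n)" using sparse(2) by linarith
    then have "4 * s * \<xi> \<le> (2 * sqrt (real n)) * (c / (500 * sqrt (real n)))"
      by (rule mult_mono) (use \<xi>_le \<xi>0 sqrt_n in auto)
    also have "\<dots> = c / 250" using n_pos by simp
    finally show ?thesis .
  qed
  have W_row: "(\<Sum>i<n. \<bar>W j i\<bar>) \<le> 51/40" if "j < n" for j using W_bounds(1)[OF that] by (simp add: W_def)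
  have W_off_row: "(\<Sum>i\<in>{..<n} - {j}. \<bar>W j i\<bar>) \<le> c/45 + 17/12 * e" if "j < n" for j
    using W_bounds(2)[OF that] by (simp add: W_def)
  have W_off_col: "(\<Sum>j\<in>{..<n} - {i}. \<bar>W j i\<bar>) \<le> c/45 + 17/12 * e" if "i < n" for i
    using W_bounds(3)[OF that] by (simp add: W_def)
  have W_diag: "24/25 \<le> W j j * S j" if "j < n" for j using W_bounds(4)[OF that] by (simp add: W_def)
  have W_entry: "\<forall>k<n. \<bar>W j k\<bar> \<le> 2" if "j < n" for j
  proof (intro allI impI)
    fix k assume "k < n"
    then have "\<bar>W j k\<bar> \<le> (\<Sum>i<n. \<bar>W j i\<bar>)" by (intro member_le_sum) auto
    then show "\<bar>W j k\<bar> \<le> 2" using W_row[OF that] by linarith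
  qed
  have u_sum: "(\<Sum>k<m. \<bar>u j k\<bar>) * C \<le> \<xi>" if "j < n" for j
    unfolding \<xi>_def using row_sum_le_norm_infty[OF P'(1) that] P'(3) C_nonneg
    by (intro mult_right_mono) (auto simp: u_def)
  have u_entry: "\<forall>k<m. \<bar>u j k\<bar> * C \<le> 2" if "j < n" for j
  proof (intro allI impI)
    fix k assume "k < m"
    then have "\<bar>u j k\<bar> \<le> (\<Sum>k<m. \<bar>u j k\<bar>)" by (intro member_le_sum) auto
    then have "\<bar>u j k\<bar> * C \<le> (\<Sum>k<m. \<bar>u j k\<bar>) * C" using C_nonneg by (intro mult_right_mono)
    then show "\<bar>u j k\<bar> * C \<le> 2" using u_sum[OF that] \<xi>_small by linarith
  qed
  \<comment> \<open>This fixes the threshold: the off-diagonal weights and the noise sum to at most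
    1/45 + 17/120 + 1/500 < 1/5.\<close>
  have off: "(\<Sum>k\<in>{..<n} - {j}. \<bar>W j k\<bar>) + \<xi> \<le> 1/5" if "j < n" for j
    using W_off_row[OF that] \<xi>_small c_le e by simp
  have gap: "(0::real) \<le> 1/5" by simp
  have EX: "\<bar>\<integral>\<omega>. X j \<omega> \<partial>D\<bar> \<le> 13/10" if j: "j < n" for j
  proof -
    note int = integrable_decoded[OF gap j off[OF j] u_sum[OF j], folded X_def]
    have "(\<integral>\<omega>. X j \<omega> \<partial>D) \<le> (\<integral>\<omega>. 13/10 \<partial>D)"
    proof (rule integral_mono_typical[OF int])
      fix x assume "x \<in> typical"
      from decoded_abs_le[OF gap j off[OF j] u_sum[OF j] this] W_row[OF j] \<xi>_small
      show "X j x \<le> 13/10" unfolding X_def by linarith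
    qed simp
    moreover have "0 \<le> (\<integral>\<omega>. X j \<omega> \<partial>D)"
      using expectation_decoded_nonneg[OF gap j off[OF j] u_sum[OF j], folded X_def] .
    ultimately show ?thesis by (simp add: prob_space)
  qed
  have rep_X: "\<bar>(\<Sum>k<N. X j (\<omega> k)) / real N - (\<integral>\<omega>. X j \<omega> \<partial>D)\<bar> \<le> \<tau>"
    and rep_code: "i < n \<Longrightarrow> \<bar>(\<Sum>k<N. fst (\<omega> k) i * X j (\<omega> k)) / real N - (\<integral>\<omega>. fst \<omega> i * X j \<omega> \<partial>D)\<bar> \<le> \<tau>"
    and rep_noise: "i < m \<Longrightarrow> \<bar>(\<Sum>k<N. snd (\<omega> k) i * X j (\<omega> k)) / real N - (\<integral>\<omega>. snd \<omega> i * X j \<omega> \<partial>D)\<bar> \<le> C * \<tau>"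
    if "j < n" for i j
    using rep W_entry[OF that] u_entry[OF that] unfolding representative_def X_def by blast+
  have B_dev: "\<bar>B h j - 2 * ((\<integral>\<omega>. fst \<omega> h * X j \<omega> \<partial>D) - p * (\<integral>\<omega>. X j \<omega> \<partial>D))\<bar> \<le> 10 * \<tau>" if "h < n" "j < n" for h j
    unfolding B_def
  proof (rule sample_cov_deviation[OF rep_code[OF that(2,1)] _ rep_X[OF that(2)] _ EX[OF that(2)]])
    show "\<bar>(\<Sum>k<N. fst (\<omega> k) h) / real N - p\<bar> \<le> \<tau>" using rep that by (simp add: representative_def)
    show "\<bar>p\<bar> * \<tau> \<le> \<tau>" using p_pos p_le \<tau>_pos by simp
  qed (use \<tau>_pos \<tau>_le in auto)
  have V_dev: "\<bar>V i j - 2 * (\<integral>\<omega>. snd \<omega> i * X j \<omega> \<partial>D)\<bar> \<le> 10 * (C * \<tau>)" if "i < m" "j < n" for i j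
  proof -
    have "\<bar>V i j - 2 * ((\<integral>\<omega>. snd \<omega> i * X j \<omega> \<partial>D) - 0 * (\<integral>\<omega>. X j \<omega> \<partial>D))\<bar> \<le> 10 * (C * \<tau>)"
      unfolding V_def
    proof (rule sample_cov_deviation[OF rep_noise[OF that(2,1)] _ rep_X[OF that(2)] _ EX[OF that(2)]])
      show "\<bar>(\<Sum>k<N. snd (\<omega> k) i) / real N - 0\<bar> \<le> C * \<tau>" using rep that by (simp add: representative_def)
    qed (use \<tau>_pos \<tau>_le C_nonneg in auto)
    then show ?thesis by simp
  qed
  have dev_bound: "\<bar>b\<bar> \<le> 2 * y + t" if "\<bar>b - 2 * x\<bar> \<le> t" "\<bar>x\<bar> \<le> y" for b x y t :: real
    using that by linarith
  have B_off: "\<bar>B h j\<bar> / p \<le> 2 * p * \<bar>W j h\<bar> + 4 * p * \<xi> + \<kappa>" if "h < n" "j < n" "h \<noteq> j" for h j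
  proof -
    have "\<bar>B h j\<bar> \<le> 2 * (p\<^sup>2 * (\<bar>W j h\<bar> + 2 * \<xi>)) + 10 * \<tau>"
      by (rule dev_bound[OF B_dev[OF that(1,2)]
          covariance_code_decoded_diff[OF gap that(2) off[OF that(2)] u_sum[OF that(2)] that(1,3), folded X_def]])
    then have "\<bar>B h j\<bar> / p \<le> (2 * (p\<^sup>2 * (\<bar>W j h\<bar> + 2 * \<xi>)) + 10 * \<tau>) / p"
      using p_pos by (intro divide_right_mono) auto
    also have "\<dots> = 2 * p * \<bar>W j h\<bar> + 4 * p * \<xi> + \<kappa>"
      unfolding \<tau>_r[symmetric] using p_pos by (simp add: field_simps power2_eq_square)
    finally show ?thesis .
  qed
  have V_le: "\<bar>V i j\<bar> / p \<le> 10 * C / sqrt (real n)" if "i < m" "j < n" for i j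
  proof -
    have "\<bar>V i j\<bar> \<le> 2 * (C * p * \<xi>) + 10 * (C * \<tau>)"
      by (rule dev_bound[OF V_dev[OF that]
          covariance_noise_decoded[OF gap that(2) off[OF that(2)] u_sum[OF that(2)] that(1), folded X_def]])
    then have "\<bar>V i j\<bar> / p \<le> (2 * (C * p * \<xi>) + 10 * (C * \<tau>)) / p"
      using p_pos by (intro divide_right_mono) auto
    also have "\<dots> = C * (2 * \<xi> + \<kappa>)"
      unfolding \<tau>_r[symmetric] using p_pos by (simp add: field_simps)
    also have "\<dots> \<le> C * (10 / sqrt (real n))"
    proof (intro mult_left_mono C_nonneg)
      have "2 * \<xi> \<le> 1 / sqrt (real n)"
      proof -
        have "2 * \<xi> \<le> c / (250 * sqrt (real n))" using \<xi>_le by simp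
        also have "\<dots> \<le> 1 / (1 * sqrt (real n))" using c_le c_nonneg sqrt_n by (intro frac_le mult_right_mono) auto
        finally show ?thesis by simp
      qed
      moreover have "\<kappa> \<le> 1 / sqrt (real n)"
      proof -
        have "sqrt (real n) \<le> 1000 * real n" using sqrt_n mult_mono[of 1 "sqrt (real n)" "sqrt (real n)" "sqrt (real n)"] by simp
        then show ?thesis unfolding \<kappa>_def using \<epsilon> sqrt_n by (intro frac_le) auto
      qed
      ultimately show "2 * \<xi> + \<kappa> \<le> 10 / sqrt (real n)"
        using add_mono[of "2 * \<xi>" "1 / sqrt (real n)" \<kappa> "1 / sqrt (real n)"] sqrt_n
        by (simp add: field_simps)
    qed
    finally show ?thesis by (simp add: mult.commute)
  qed
  \<comment> \<open>The first bound holds however small \<open>W j j\<close> is, as the unit is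
    nonnegative. The second is 2 (1 - p) (W j j - 2 \<alpha>) with 1 - p >= 99/100 and \<alpha> =
    1/5.\<close>
  have B_diag: "0 - \<kappa> \<le> B j j / p" "198/100 * W j j - 99/125 - \<kappa> \<le> B j j / p" if j: "j < n" for j
  proof -
    let ?E = "\<integral>\<omega>. X j \<omega> \<partial>D"
    note E0 = expectation_decoded_nonneg[OF gap j off[OF j] u_sum[OF j], folded X_def]
    have "2 * ((1 - p) * ?E) - 10 * \<tau> \<le> B j j"
      using B_dev[OF j j] covariance_code_decoded_same[OF gap j off[OF j] u_sum[OF j], folded X_def]
      by (simp add: left_diff_distrib)
    then have "(2 * ((1 - p) * ?E) - 10 * \<tau>) / p \<le> B j j / p" using p_pos by (intro divide_right_mono) auto
    then have ge: "2 * ((1 - p) * (?E / p)) - \<kappa> \<le> B j j / p" by (simp add: diff_divide_distrib \<tau>_r)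
    have nn: "0 \<le> ?E / p" using E0 p_pos by simp
    then have "0 \<le> (1 - p) * (?E / p)" using p_small by (intro mult_nonneg_nonneg) auto
    with ge show "0 - \<kappa> \<le> B j j / p" by linarith
    have "p * (W j j - 2 * (1/5)) \<le> ?E"
      using expectation_decoded_ge[OF gap j off[OF j] u_sum[OF j], folded X_def] .
    then have "W j j - 2/5 \<le> ?E / p" using p_pos by (simp add: field_simps)
    moreover have "99/100 * (?E / p) \<le> (1 - p) * (?E / p)" using p_small nn by (intro mult_right_mono) auto
    moreover have "198/100 * v - 99/125 - \<kappa> \<le> z" if "v - 2/5 \<le> y" "99/100 * y \<le> x" "2 * x - \<kappa> \<le> z" for v x y z
      using that by linarith
    ultimately show "198/100 * W j j - 99/125 - \<kappa> \<le> B j j / p" using ge by blast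
  qed
  \<comment> \<open>As r = 1 / p, the step is a convex combination with weights 9/10 and 1/10 of the
    old parts and the covariances divided by p. The diagonal of \<open>B\<close> goes to
    \<open>S'\<close> and the rest to \<open>E'\<close>. For the residual, a bound common to
    \<open>R\<close> and \<open>V\<close> / p persists.\<close>
  define S' where "S' j = 9/10 * S j + 1/10 * (B j j / p)" for j
  define E' where "E' h j = (if h = j then 0 else 9/10 * E h j + 1/10 * (B h j / p))" for h j
  define R' where "R' i j = 9/10 * R i j + 1/10 * (V i j / p)" for i j
  let ?A' = "purification_step (1/5) (1/10) (real n / s) N A P (\<lambda>k. data_point Astar (\<omega> k))"
  let ?e' = "19/20 * e + c / 400 + \<epsilon> / 400"
  have bd: "1/10 * (\<Sum>k\<in>K. 2 * p * \<bar>f k\<bar> + 4 * p * \<xi> + \<kappa>) \<le> 1/20 * e + c / 400 + \<epsilon> / 400"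
    if f: "(\<Sum>k\<in>K. \<bar>f k\<bar>) \<le> c/45 + 17/12 * e" and K: "K \<subseteq> {..<n}" for K f
  proof -
    have K_card: "real (card K) \<le> real n" using card_mono[OF _ K] by simp
    have "(\<Sum>k\<in>K. 2 * p * \<bar>f k\<bar> + 4 * p * \<xi> + \<kappa>) = 2 * p * (\<Sum>k\<in>K. \<bar>f k\<bar>) + real (card K) * (4 * p * \<xi> + \<kappa>)"
      by (simp add: sum.distrib sum_distrib_left algebra_simps)
    also have "\<dots> \<le> 2 * (1/100) * (c/45 + 17/12 * e) + real n * (4 * p * \<xi> + \<kappa>)"
      using p_small p_pos f \<xi>0 \<kappa> c_nonneg e K_card
      by (intro add_mono mult_mono mult_right_mono sum_nonneg add_nonneg_nonneg mult_nonneg_nonneg) auto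
    also have "real n * (4 * p * \<xi> + \<kappa>) = 4 * (p * real n) * \<xi> + \<kappa> * real n" by (simp add: algebra_simps)
    also have "\<dots> = 4 * s * \<xi> + \<epsilon> / 1000" unfolding pn \<kappa>(3) ..
    also have "2 * (1/100) * (c/45 + 17/12 * e) = c / 2250 + 17/600 * e" by (simp add: algebra_simps)
    finally show ?thesis using s\<xi> c_nonneg e \<epsilon> by linarith
  qed
  have E'_le: "\<bar>E' h j\<bar> \<le> 9/10 * \<bar>E h j\<bar> + 1/10 * (2 * p * \<bar>W j h\<bar> + 4 * p * \<xi> + \<kappa>)" if "h < n" "j < n" "h \<noteq> j" for h j
  proof -
    have "\<bar>B h j / p\<bar> \<le> 2 * p * \<bar>W j h\<bar> + 4 * p * \<xi> + \<kappa>" using B_off[OF that] p_pos by simp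
    moreover have "\<bar>9/10 * x + 1/10 * y\<bar> \<le> 9/10 * \<bar>x\<bar> + 1/10 * z" if "\<bar>y\<bar> \<le> z" for x y z :: real
      using that by linarith
    ultimately have "\<bar>9/10 * E h j + 1/10 * (B h j / p)\<bar> \<le> 9/10 * \<bar>E h j\<bar> + 1/10 * (2 * p * \<bar>W j h\<bar> + 4 * p * \<xi> + \<kappa>)"
      by blast
    then show ?thesis unfolding E'_def if_not_P[OF that(3)] .
  qed
  have "iterate ?e' ?A' S' E' R'" unfolding iterate_def
  proof (intro conjI allI impI)
    show "?A' \<in> carrier_mat m n" using A unfolding purification_step_def by (auto simp: empirical_corr_def)
    fix i j assume i: "i < m" and j: "j < n"
    have A_eq: "A $$ (i, j) = (\<Sum>h<n. Astar $$ (i, h) * ((if h = j then S j else 0) + E h j)) + R i j"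
      using it i j by (simp add: iterate_def)
    have Ejj: "E j j = 0" using it j by (simp add: iterate_def)
    have "?A' $$ (i, j) = 9/10 * A $$ (i, j) + 1 / p * (1/10) * ((\<Sum>h<n. Astar $$ (i, h) * B h j) + V i j)"
      using purification_step_index[OF A P'(1) N i j, of "1/5" "1/10" "real n / s" \<omega>]
      unfolding r_p B_def V_def X_def W_def u_def by simp
    also have "\<dots> = (\<Sum>h<n. 9/10 * (Astar $$ (i, h) * ((if h = j then S j else 0) + E h j)) + 1 / p * (1/10) * (Astar $$ (i, h) * B h j))
        + (9/10 * R i j + 1 / p * (1/10) * V i j)"
      unfolding A_eq by (simp add: distrib_left sum.distrib sum_distrib_left)
    also have "\<dots> = (\<Sum>h<n. Astar $$ (i, h) * ((if h = j then S' j else 0) + E' h j)) + R' i j"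
    proof -
      have "9/10 * (Astar $$ (i, h) * ((if h = j then S j else 0) + E h j)) + 1 / p * (1/10) * (Astar $$ (i, h) * B h j)
          = Astar $$ (i, h) * ((if h = j then S' j else 0) + E' h j)" for h
        using Ejj by (cases "h = j") (simp_all add: S'_def E'_def algebra_simps)
      then show ?thesis by (simp add: R'_def)
    qed
    finally show "?A' $$ (i, j) = (\<Sum>h<n. Astar $$ (i, h) * ((if h = j then S' j else 0) + E' h j)) + R' i j" .
  next
    fix j assume j: "j < n"
    show "E' j j = 0" by (simp add: E'_def)
    have Sj: "9/10 \<le> S j" using it j by (simp add: iterate_def)
    \<comment> \<open>If S j > 26/25, then 9/10 of it leaves room for the sampling error even when
      the covariance is near 0. Otherwise \<open>W j j\<close> is at least (24/25) / (26/25) =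
      12/13, so the second bound in \<open>B_diag\<close> puts the covariance term above 1.\<close>
    show "9/10 \<le> S' j"
    proof (cases "S j \<le> 26/25")
      case True
      have "W j j \<ge> 0"
      proof (rule ccontr)
        assume "\<not> 0 \<le> W j j"
        then have "W j j * S j \<le> 0" using Sj by (intro mult_nonpos_nonneg) auto
        then show False using W_diag[OF j] by simp
      qed
      then have "W j j * S j \<le> W j j * (26/25)" using True by (intro mult_left_mono)
      then have "12/13 \<le> W j j" using W_diag[OF j] by simp
      then show ?thesis using B_diag(2)[OF j] Sj \<kappa>(2) unfolding S'_def by linarith
    next
      case False
      then show ?thesis using B_diag(1)[OF j] \<kappa> unfolding S'_def by simp
    qed
  next
    fix h assume h: "h < n"
    have "(\<Sum>j<n. \<bar>E' h j\<bar>) = (\<Sum>j\<in>{..<n} - {h}. \<bar>E' h j\<bar>)" using h by (simp add: sum.remove[of _ h] E'_def)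
    also have "\<dots> \<le> (\<Sum>j\<in>{..<n} - {h}. 9/10 * \<bar>E h j\<bar> + 1/10 * (2 * p * \<bar>W j h\<bar> + 4 * p * \<xi> + \<kappa>))"
      by (intro sum_mono E'_le) (use h in auto)
    also have "\<dots> = 9/10 * (\<Sum>j\<in>{..<n} - {h}. \<bar>E h j\<bar>) + 1/10 * (\<Sum>j\<in>{..<n} - {h}. 2 * p * \<bar>W j h\<bar> + 4 * p * \<xi> + \<kappa>)"
      unfolding sum.distrib[of "\<lambda>j. 9/10 * \<bar>E h j\<bar>"] sum_distrib_left ..
    also have "(\<Sum>j\<in>{..<n} - {h}. \<bar>E h j\<bar>) \<le> (\<Sum>j<n. \<bar>E h j\<bar>)" by (intro sum_mono2) auto
    also have "(\<Sum>j<n. \<bar>E h j\<bar>) \<le> e" using it h by (simp add: iterate_def)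
    finally have "(\<Sum>j<n. \<bar>E' h j\<bar>) \<le> 9/10 * e + 1/10 * (\<Sum>j\<in>{..<n} - {h}. 2 * p * \<bar>W j h\<bar> + 4 * p * \<xi> + \<kappa>)" by simp
    \<comment> \<open>The transposition: along row \<open>h\<close> of \<open>E'\<close> the weights
      \<open>W j h\<close> run through column \<open>h\<close> of \<open>W\<close>.\<close>
    also have "\<dots> \<le> 9/10 * e + (1/20 * e + c / 400 + \<epsilon> / 400)" by (intro add_left_mono bd W_off_col h) auto
    finally show "(\<Sum>j<n. \<bar>E' h j\<bar>) \<le> ?e'" by simp
  next
    fix j assume j: "j < n"
    have "(\<Sum>h<n. \<bar>E' h j\<bar>) = (\<Sum>h\<in>{..<n} - {j}. \<bar>E' h j\<bar>)" using j by (simp add: sum.remove[of _ j] E'_def)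
    also have "\<dots> \<le> (\<Sum>h\<in>{..<n} - {j}. 9/10 * \<bar>E h j\<bar> + 1/10 * (2 * p * \<bar>W j h\<bar> + 4 * p * \<xi> + \<kappa>))"
      by (intro sum_mono E'_le) (use j in auto)
    also have "\<dots> = 9/10 * (\<Sum>h\<in>{..<n} - {j}. \<bar>E h j\<bar>) + 1/10 * (\<Sum>h\<in>{..<n} - {j}. 2 * p * \<bar>W j h\<bar> + 4 * p * \<xi> + \<kappa>)"
      unfolding sum.distrib[of "\<lambda>h. 9/10 * \<bar>E h j\<bar>"] sum_distrib_left ..
    also have "(\<Sum>h\<in>{..<n} - {j}. \<bar>E h j\<bar>) \<le> (\<Sum>h<n. \<bar>E h j\<bar>)" by (intro sum_mono2) auto
    also have "(\<Sum>h<n. \<bar>E h j\<bar>) \<le> e" using it j by (simp add: iterate_def)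
    finally have "(\<Sum>h<n. \<bar>E' h j\<bar>) \<le> 9/10 * e + 1/10 * (\<Sum>h\<in>{..<n} - {j}. 2 * p * \<bar>W j h\<bar> + 4 * p * \<xi> + \<kappa>)" by simp
    also have "\<dots> \<le> 9/10 * e + (1/20 * e + c / 400 + \<epsilon> / 400)" by (intro add_left_mono bd W_off_row j) auto
    finally show "(\<Sum>h<n. \<bar>E' h j\<bar>) \<le> ?e'" by simp
  next
    fix i j assume i: "i < m" and j: "j < n"
    have "\<bar>R i j\<bar> \<le> 10 * C / sqrt (real n)" using it i j by (simp add: iterate_def)
    moreover have "\<bar>V i j / p\<bar> \<le> 10 * C / sqrt (real n)" using V_le[OF i j] p_pos by simp
    ultimately show "\<bar>R' i j\<bar> \<le> 10 * C / sqrt (real n)" unfolding R'_def by linarith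
  qed
  then show ?thesis by blast
qed

end

section \<open>Convergence\<close>

text \<open>The quadratic form of a diagonal matrix is a weighted sum of squares, and unit vectors
  read off the weights.\<close>

lemma loewner_ge_diagonal_iff:
  fixes M :: "real mat"
  assumes M: "M \<in> carrier_mat n n" and diag: "diagonal_mat M"
  shows "loewner_ge M (a \<cdot>\<^sub>m 1\<^sub>m n) \<longleftrightarrow> (\<forall>i<n. a \<le> M $$ (i, i))"
proof -
  let ?K = "M - a \<cdot>\<^sub>m 1\<^sub>m n"
  have K: "?K \<in> carrier_mat n n" using M by (intro minus_carrier_mat) auto
  have K_eq: "?K $$ (i, j) = (if i = j then M $$ (i, i) - a else 0)" if "i < n" "j < n" for i j
    using that M diag by (auto simp: diagonal_mat_def)
  have form: "scalar_prod v (?K *\<^sub>v v) = (\<Sum>i<n. (M $$ (i, i) - a) * (vec_index v i)\<^sup>2)" if v: "v \<in> carrier_vec n" for v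
  proof -
    have "vec_index (?K *\<^sub>v v) i = (M $$ (i, i) - a) * vec_index v i" if i: "i < n" for i
    proof -
      have "vec_index (?K *\<^sub>v v) i = (\<Sum>j<n. ?K $$ (i, j) * vec_index v j)"
        using K v i by (auto simp: scalar_prod_def atLeast0LessThan simp del: index_minus_mat intro!: sum.cong)
      also have "\<dots> = (\<Sum>j<n. if i = j then (M $$ (i, i) - a) * vec_index v i else 0)"
        by (intro sum.cong) (use K_eq i in auto)
      finally show ?thesis using i by simp
    qed
    then show ?thesis using K v
      by (auto simp: scalar_prod_def atLeast0LessThan power2_eq_square mult_ac intro!: sum.cong)
  qed
  show ?thesis
  proof
    assume "loewner_ge M (a \<cdot>\<^sub>m 1\<^sub>m n)"
    then have pos: "0 \<le> scalar_prod v (?K *\<^sub>v v)" if "v \<in> carrier_vec n" for v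
      using M that unfolding loewner_ge_def by (metis carrier_matD(1))
    show "\<forall>i<n. a \<le> M $$ (i, i)"
    proof (intro allI impI)
      fix i assume i: "i < n"
      have "(\<Sum>k<n. (M $$ (k, k) - a) * (vec_index (unit_vec n i) k)\<^sup>2) = (\<Sum>k<n. if k = i then M $$ (i, i) - a else 0)"
        using i by (intro sum.cong) auto
      then have "0 \<le> (\<Sum>k<n. if k = i then M $$ (i, i) - a else 0)"
        using pos[of "unit_vec n i"] form[of "unit_vec n i"] by simp
      then show "a \<le> M $$ (i, i)" using i by simp
    qed
  next
    assume ge: "\<forall>i<n. a \<le> M $$ (i, i)"
    have "transpose_mat ?K = ?K"
      using K K_eq by (intro eq_matI) (auto simp del: index_minus_mat)
    moreover have "0 \<le> scalar_prod v (?K *\<^sub>v v)" if "v \<in> carrier_vec n" for v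
      unfolding form[OF that] using ge by (intro sum_nonneg mult_nonneg_nonneg) auto
    ultimately show "loewner_ge M (a \<cdot>\<^sub>m 1\<^sub>m n)"
      unfolding loewner_ge_def using M by (intro exI[of _ n]) auto
  qed
qed

context purification_setup
begin

lemma iterate_initialization:
  assumes init: "initialization Astar (1/10) A0 \<Sigma>0 E0 N0" and N0: "N0 = 0\<^sub>m m n"
  shows "iterate (1/10) A0 (\<lambda>j. \<Sigma>0 $$ (j, j)) (\<lambda>h j. E0 $$ (h, j)) (\<lambda>i j. 0)"
proof -
  have dims: "dim_row Astar = m" "dim_col Astar = n" using Astar by auto
  have \<Sigma>0: "\<Sigma>0 \<in> carrier_mat n n" "diagonal_mat \<Sigma>0" "loewner_ge \<Sigma>0 (9/10 \<cdot>\<^sub>m 1\<^sub>m n)"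
    and E0: "E0 \<in> carrier_mat n n" "zero_diagonal E0" "norm_s E0 \<le> 1/10"
    and A0: "A0 = Astar * (\<Sigma>0 + E0) + N0"
    using init unfolding initialization_def Let_def dims by auto
  have SE: "\<Sigma>0 + E0 \<in> carrier_mat n n" using \<Sigma>0 E0 by simp
  have "A0 $$ (i, j) = (\<Sum>h<n. Astar $$ (i, h) * ((if h = j then \<Sigma>0 $$ (j, j) else 0) + E0 $$ (h, j))) + 0"
    if i: "i < m" and j: "j < n" for i j
  proof -
    have "A0 $$ (i, j) = (Astar * (\<Sigma>0 + E0)) $$ (i, j)" using A0 N0 Astar SE i j by simp
    also have "\<dots> = (\<Sum>h<n. Astar $$ (i, h) * (\<Sigma>0 + E0) $$ (h, j))" by (rule mult_mat_index[OF Astar SE i j])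
    also have "\<dots> = (\<Sum>h<n. Astar $$ (i, h) * ((if h = j then \<Sigma>0 $$ (j, j) else 0) + E0 $$ (h, j)))"
      using \<Sigma>0 E0 j by (intro sum.cong) (auto simp: diagonal_mat_def)
    finally show ?thesis by simp
  qed
  moreover have "A0 \<in> carrier_mat m n" using A0 N0 Astar SE by simp
  moreover have "9/10 \<le> \<Sigma>0 $$ (j, j) \<and> E0 $$ (j, j) = 0" if "j < n" for j
    using loewner_ge_diagonal_iff[OF \<Sigma>0(1,2)] \<Sigma>0(3) E0 that by (auto simp: zero_diagonal_def)
  moreover have "norm_infty E0 \<le> 1/10" "norm_one E0 \<le> 1/10" using E0(3) by (auto simp: norm_s_def)
  then have "\<forall>h<n. (\<Sum>j<n. \<bar>E0 $$ (h, j)\<bar>) \<le> 1/10" "\<forall>j<n. (\<Sum>h<n. \<bar>E0 $$ (h, j)\<bar>) \<le> 1/10"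
    using norm_infty_le_iff[OF E0(1) n_pos] norm_one_le_iff[OF E0(1) n_pos] by blast+
  ultimately show ?thesis unfolding iterate_def using C_nonneg by simp
qed

text \<open>For the residual, a column of m entries of size 10 C / sqrt n sums to at most c/100 by
  \<open>noise_total\<close>.\<close>

lemma iterate_purified:
  assumes it: "iterate e A S E R" and e': "e \<le> e'"
  shows "purified Astar (1/10) e' c A"
proof -
  have dims: "dim_row Astar = m" "dim_col Astar = n" using Astar by auto
  define SM where "SM = Matrix.mat n n (\<lambda>(i, j). if i = j then S j else 0)"
  define EM where "EM = Matrix.mat n n (\<lambda>(i, j). E i j)"
  define RM where "RM = Matrix.mat m n (\<lambda>(i, j). R i j)"
  have carr: "SM \<in> carrier_mat n n" "EM \<in> carrier_mat n n" "RM \<in> carrier_mat m n"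
    by (simp_all add: SM_def EM_def RM_def)
  have SE: "SM + EM \<in> carrier_mat n n" using carr by simp
  have A: "A \<in> carrier_mat m n" using it by (simp add: iterate_def)
  have diag: "diagonal_mat SM" by (auto simp: diagonal_mat_def SM_def)
  have "A = Astar * (SM + EM) + RM"
  proof (rule eq_matI)
    show "dim_row A = dim_row (Astar * (SM + EM) + RM)" "dim_col A = dim_col (Astar * (SM + EM) + RM)"
      using A carr by auto
    fix i j assume "i < dim_row (Astar * (SM + EM) + RM)" "j < dim_col (Astar * (SM + EM) + RM)"
    then have i: "i < m" and j: "j < n" using carr by auto
    have "(Astar * (SM + EM)) $$ (i, j) = (\<Sum>h<n. Astar $$ (i, h) * (SM + EM) $$ (h, j))"
      by (rule mult_mat_index[OF Astar SE i j])
    also have "\<dots> = (\<Sum>h<n. Astar $$ (i, h) * ((if h = j then S j else 0) + E h j))"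
      using j by (intro sum.cong) (auto simp: SM_def EM_def)
    finally show "A $$ (i, j) = (Astar * (SM + EM) + RM) $$ (i, j)"
      using it i j carr Astar SE by (simp add: iterate_def RM_def)
  qed
  moreover have "zero_diagonal EM" using it by (auto simp: zero_diagonal_def EM_def iterate_def)
  moreover have "loewner_ge SM ((1 - 1/10) \<cdot>\<^sub>m 1\<^sub>m n)"
    using loewner_ge_diagonal_iff[OF carr(1) diag] it by (auto simp: SM_def iterate_def)
  moreover have "norm_one EM \<le> e'"
    using norm_one_le_iff[OF carr(2) n_pos, of e'] it e' by (force simp: EM_def iterate_def)
  moreover have "norm_one RM \<le> c"
  proof -
    have "(\<Sum>i<m. \<bar>RM $$ (i, j)\<bar>) \<le> c" if j: "j < n" for j
    proof -
      have "(\<Sum>i<m. \<bar>RM $$ (i, j)\<bar>) \<le> (\<Sum>i<m. 10 * C / sqrt (real n))"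
        using it j by (intro sum_mono) (auto simp: RM_def iterate_def)
      also have "\<dots> = 10 / sqrt (real n) * (real m * C)" by simp
      also have "\<dots> \<le> 10 / sqrt (real n) * (c * sqrt (real n) / 1000)" by (intro mult_left_mono noise_total) auto
      also have "\<dots> = c / 100" using n_pos by simp
      finally show ?thesis using c_nonneg by simp
    qed
    then show ?thesis using norm_one_le_iff[OF carr(3) n_pos] by blast
  qed
  ultimately show ?thesis unfolding purified_def Let_def dims using carr diag by blast
qed

text \<open>The recursion of \<open>step_iterate\<close>, with fixed point (c + \<epsilon>) / 20.
  Its increments are the largest of equal size that keep 1/10 invariant for c = \<epsilon> = 1:
  19/200 + 1/400 + 1/400 = 1/10.\<close>

primrec err :: "real \<Rightarrow> nat \<Rightarrow> real" where
  "err \<epsilon> 0 = 1/10"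
| "err \<epsilon> (Suc t) = 19/20 * err \<epsilon> t + c / 400 + \<epsilon> / 400"

lemma err_bounds:
  assumes "0 \<le> \<epsilon>" "\<epsilon> \<le> 1"
  shows "0 \<le> err \<epsilon> t" "err \<epsilon> t \<le> 1/10" "err \<epsilon> t \<le> (19/20) ^ t / 10 + c / 20 + \<epsilon> / 20"
  using c_nonneg c_le assms by (induction t) auto

text \<open>A deterministic induction: the samples enter only through \<open>rep\<close>, which
  holds for all admissible weights at once. It therefore covers every choice of left inverses and
  any dependence of an iterate on the samples.\<close>

lemma run_iterate:
  assumes run: "purification (1/5) (1/10) (real n / s) N A0 (\<lambda>t k. data_point Astar (\<omega> t k)) t A"
    and init: "iterate (1/10) A0 S E R" and t: "t \<le> T"
    and rep: "\<And>t. t < T \<Longrightarrow> representative (1/5) \<tau> N (\<omega> t)" and N: "N > 0"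
    and \<epsilon>: "0 < \<epsilon>" "\<epsilon> \<le> 1" and \<tau>: "\<tau> = s * \<epsilon> / (10000 * (real n)\<^sup>2)"
  shows "\<exists>S E R. iterate (err \<epsilon> t) A S E R"
  using run t
proof (induction rule: purification.induct)
  case start
  then show ?case using init by auto
next
  case (step t A P)
  then obtain S E R where it: "iterate (err \<epsilon> t) A S E R" by auto
  have "t < T" using step.prems by simp
  from step_iterate[OF it err_bounds(1,2) step.hyps(2) rep[OF this] N \<epsilon> \<tau>] \<epsilon>
  show ?case by (simp add: add.assoc)
qed

lemma purification_succeeds_samples:
  assumes init: "initialization Astar (1/10) A0 \<Sigma>0 E0 N0" "N0 = 0\<^sub>m m n" and N: "N > 0"
    and \<epsilon>: "0 < \<epsilon>" "\<epsilon> \<le> 1" and \<tau>: "\<tau> = s * \<epsilon> / (10000 * (real n)\<^sup>2)" and T: "err \<epsilon> T \<le> \<epsilon> + c"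
    and bound: "6 * real T * real (n + m) * (17 * real (n + m) / \<tau>) ^ (n + m)
                  * exp (- (real N * \<tau>\<^sup>2 / (162 * (real (n + m))\<^sup>2))) \<le> \<delta>"
  shows "purification_succeeds Astar D (1/5) (1/10) (real n / s) N A0 T (purified Astar (1/10) (\<epsilon> + c) c) (1 - \<delta>)"
proof -
  note it0 = iterate_initialization[OF init]
  have \<tau>_pos: "0 < \<tau>" using \<tau> \<epsilon> s_pos n_pos by simp
  have "s * \<epsilon> \<le> (real n)\<^sup>2 * 1"
  proof (rule mult_mono)
    have "real n * 1 \<le> real n * real n" using n_pos by (intro mult_left_mono) auto
    then show "s \<le> (real n)\<^sup>2" using s_le by (simp add: power2_eq_square)
  qed (use \<epsilon> in auto)
  also have "\<dots> \<le> 10000 * (real n)\<^sup>2" by simp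
  finally have \<tau>_le: "\<tau> \<le> 1" unfolding \<tau> using n_pos by (simp add: divide_le_eq)
  from representative_samples[OF _ N \<tau>_pos \<tau>_le bound, of "1/5"]
  obtain S where S: "S \<in> sets (sample_law D T N)" "measure (sample_law D T N) S \<ge> 1 - \<delta>"
    and rep: "\<And>\<omega> t. \<omega> \<in> S \<Longrightarrow> t < T \<Longrightarrow> representative (1/5) \<tau> N (\<lambda>k. \<omega> (t, k))"
    by auto
  show ?thesis
    unfolding purification_succeeds_def Let_def
  proof (intro bexI[OF _ S(1)] conjI S(2) ballI allI impI)
    fix \<omega> t A assume \<omega>: "\<omega> \<in> S" and t: "t < T"
      and run: "purification (1/5) (1/10) (real n / s) N A0 (\<lambda>t k. data_point Astar (\<omega> (t, k))) t A"
    obtain S E R where "iterate (err \<epsilon> t) A S E R"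
      using run_iterate[OF run it0, of T \<tau> \<epsilon>] t rep[OF \<omega>] N \<epsilon> \<tau> by auto
    then show "\<exists>P. is_min_left_inverse A P"
      by (rule iterate_min_left_inverse_exists) (rule err_bounds, use \<epsilon> in auto)
  next
    fix \<omega> A assume \<omega>: "\<omega> \<in> S"
      and run: "purification (1/5) (1/10) (real n / s) N A0 (\<lambda>t k. data_point Astar (\<omega> (t, k))) T A"
    obtain S E R where "iterate (err \<epsilon> T) A S E R"
      using run_iterate[OF run it0, of T \<tau> \<epsilon>] rep[OF \<omega>] N \<epsilon> \<tau> by auto
    then show "purified Astar (1/10) (\<epsilon> + c) c A" by (rule iterate_purified) (rule T)
  qed
qed

end

text \<open>The grid has exponentially many points, but only its logarithm competes with the
  Hoeffding exponent. By y <= exp y the prefactor divided by \<delta> is at most exp (252 Q^4) and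
  the grid factor at most exp (68 a Q^4). Beating both takes N \<tau>^2 / (162 M^2) >= (252 + 68 a)
  Q^4, and 162 M^2 / \<tau>^2 <= 648 a^2 Q^6 leads to Q^10.\<close>

lemma exp_bound_sample_size:
  fixes M T :: nat and Q \<tau> a \<delta> N :: real
  assumes M: "1 \<le> real M" "real M \<le> 2 * Q" and T: "real T \<le> 21 * Q" and Q: "1 \<le> Q"
    and \<delta>: "0 < \<delta>" "1 / \<delta> \<le> Q" and \<tau>: "0 < \<tau>" "1 / \<tau> \<le> a * Q ^ 2" and a: "0 < a"
    and N: "648 * a\<^sup>2 * (252 + 68 * a) * Q ^ 10 \<le> N"
  shows "6 * real T * real M * (17 * real M / \<tau>) ^ M * exp (- (N * \<tau>\<^sup>2 / (162 * (real M)\<^sup>2))) \<le> \<delta>"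
proof (cases "T = 0")
  case True
  then show ?thesis using \<delta> by simp
next
  case False
  have TM: "6 * real T * real M / \<delta> \<le> 252 * Q ^ 4"
  proof -
    have "6 * real T * real M * (1 / \<delta>) \<le> 6 * (21 * Q) * (2 * Q) * Q"
      using M T \<delta> Q by (intro mult_mono) auto
    also have "\<dots> = 252 * Q ^ 3" by (simp add: power3_eq_cube)
    also have "\<dots> \<le> 252 * Q ^ 4" using Q by (intro mult_left_mono power_increasing) auto
    finally show ?thesis by simp
  qed
  have 1: "6 * real T * real M \<le> \<delta> * exp (252 * Q ^ 4)"
  proof -
    have "6 * real T * real M / \<delta> \<le> exp (252 * Q ^ 4)" using TM exp_ge_add_one_self[of "252 * Q ^ 4"] by linarith
    then show ?thesis using \<delta> by (simp add: divide_le_eq mult.commute)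
  qed
  have 2: "(17 * real M / \<tau>) ^ M \<le> exp (68 * a * Q ^ 4)"
  proof -
    have "17 * real M / \<tau> \<le> exp (17 * real M / \<tau>)" using exp_ge_add_one_self[of "17 * real M / \<tau>"] by linarith
    then have "(17 * real M / \<tau>) ^ M \<le> exp (17 * real M / \<tau>) ^ M" using \<tau> by (intro power_mono) auto
    also have "\<dots> = exp (17 * real M * real M * (1 / \<tau>))" by (simp add: exp_of_nat_mult[symmetric] mult_ac)
    also have "\<dots> \<le> exp (17 * (2 * Q) * (2 * Q) * (a * Q ^ 2))"
      using M \<tau> Q by (subst exp_le_cancel_iff) (intro mult_mono, auto)
    also have "17 * (2 * Q) * (2 * Q) * (a * Q ^ 2) = 68 * a * Q ^ 4" by (simp add: power2_eq_square power4_eq_xxxx)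
    finally show ?thesis .
  qed
  have 3: "(252 + 68 * a) * Q ^ 4 \<le> N * \<tau>\<^sup>2 / (162 * (real M)\<^sup>2)"
  proof -
    have M2: "(real M)\<^sup>2 \<le> (2 * Q)\<^sup>2" using M by (intro power_mono) auto
    have t2: "(1 / \<tau>)\<^sup>2 \<le> (a * Q ^ 2)\<^sup>2" using \<tau> by (intro power_mono) auto
    have "(252 + 68 * a) * Q ^ 4 * (162 * (real M)\<^sup>2) * (1 / \<tau>)\<^sup>2
        \<le> (252 + 68 * a) * Q ^ 4 * (162 * (2 * Q)\<^sup>2) * (a * Q ^ 2)\<^sup>2"
      using M2 t2 a Q by (intro mult_mono) auto
    also have "\<dots> = 648 * a\<^sup>2 * (252 + 68 * a) * (Q ^ 4 * Q ^ 2 * Q ^ 4)"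
      by (simp add: power_mult_distrib)
    also have "Q ^ 4 * Q ^ 2 * Q ^ 4 = Q ^ 10" by (simp flip: power_add)
    also note N
    finally have "(252 + 68 * a) * Q ^ 4 * (162 * (real M)\<^sup>2) * (1 / \<tau>)\<^sup>2 \<le> N" .
    then show ?thesis using \<tau> M by (simp add: field_simps power_divide)
  qed
  have "6 * real T * real M * (17 * real M / \<tau>) ^ M * exp (- (N * \<tau>\<^sup>2 / (162 * (real M)\<^sup>2)))
      \<le> (\<delta> * exp (252 * Q ^ 4)) * exp (68 * a * Q ^ 4) * exp (- ((252 + 68 * a) * Q ^ 4))"
  proof (rule mult_mono)
    show "6 * real T * real M * (17 * real M / \<tau>) ^ M \<le> (\<delta> * exp (252 * Q ^ 4)) * exp (68 * a * Q ^ 4)"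
      using 1 2 \<delta> \<tau> by (intro mult_mono[of "6 * real T * real M"]) auto
  qed (use 3 \<delta> in auto)
  also have "\<dots> = \<delta> * exp (252 * Q ^ 4 + 68 * a * Q ^ 4 - (252 + 68 * a) * Q ^ 4)"
    by (simp add: exp_add exp_diff exp_minus field_simps)
  also have "252 * Q ^ 4 + 68 * a * Q ^ 4 - (252 + 68 * a) * Q ^ 4 = 0" by (simp add: algebra_simps)
  finally show ?thesis by simp
qed

text \<open>From 19/20 <= exp (- 1/20), 20 ln (1 / \<epsilon>) iterations suffice. For \<epsilon> <
  1/10 the logarithm is at least 1 and pays for rounding up.\<close>

lemma iteration_count:
  fixes \<epsilon> :: real
  assumes "0 < \<epsilon>" "\<epsilon> < 1/10"
  shows "real (nat \<lceil>20 * ln (1 / \<epsilon>)\<rceil>) \<le> 21 * ln (1 / \<epsilon>)" "(19/20) ^ nat \<lceil>20 * ln (1 / \<epsilon>)\<rceil> \<le> \<epsilon>"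
proof -
  have "exp 1 \<le> (3::real)" by (rule exp_le)
  also have "3 \<le> 1 / \<epsilon>" using assms by (simp add: field_simps)
  finally have "exp 1 \<le> 1 / \<epsilon>" .
  then have ln1: "1 \<le> ln (1 / \<epsilon>)" using assms by (subst ln_ge_iff) auto
  have T: "20 * ln (1 / \<epsilon>) \<le> real (nat \<lceil>20 * ln (1 / \<epsilon>)\<rceil>)" "real (nat \<lceil>20 * ln (1 / \<epsilon>)\<rceil>) \<le> 20 * ln (1 / \<epsilon>) + 1"
    using ln1 by linarith+
  show "real (nat \<lceil>20 * ln (1 / \<epsilon>)\<rceil>) \<le> 21 * ln (1 / \<epsilon>)" using T ln1 by linarith
  let ?T = "nat \<lceil>20 * ln (1 / \<epsilon>)\<rceil>"
  have "19/20 \<le> exp (- 1/20 :: real)" using exp_ge_add_one_self[of "- 1/20 :: real"] by simp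
  then have "(19/20) ^ ?T \<le> exp (- 1/20 :: real) ^ ?T" by (intro power_mono) auto
  also have "\<dots> = exp (real ?T * (- 1/20))" by (simp only: exp_of_nat_mult)
  also have "\<dots> \<le> exp (- ln (1 / \<epsilon>))" using T by (subst exp_le_cancel_iff) simp
  also have "\<dots> = \<epsilon>" using assms by (simp add: ln_div)
  finally show "(19/20) ^ ?T \<le> \<epsilon>" .
qed


theorem theorem2:
  "\<exists>G::real. G > 0 \<and> (\<forall>s::real. s > 0 \<longrightarrow>
     (\<exists>(n0::nat) (C_T::real) (C_N::real) (d::nat).
       \<forall>(n::nat) (m::nat) (Astar::real mat) (Adag::real mat) (c::real) (D::latent measure)
         (A0::real mat) (\<Sigma>0::real mat) (E0::real mat) (N0::real mat).
         n \<ge> n0 \<longrightarrow>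
         Astar \<in> carrier_mat m n \<longrightarrow>
         lin_indpt_cols Astar \<longrightarrow>
         is_min_left_inverse Astar Adag \<longrightarrow>
         0 \<le> c \<longrightarrow> c \<le> 1 \<longrightarrow>
         latent_law n m D \<longrightarrow>
         bernoulli_code n s D \<longrightarrow>
         unbiased_noise n m
           (G * c * sqrt (real n) / max (real m) (real n * norm_infty Adag)) D \<longrightarrow>
         initialization Astar (1/10) A0 \<Sigma>0 E0 N0 \<longrightarrow>
         N0 = 0\<^sub>m m n \<longrightarrow>
         (\<exists>(\<alpha>::real) (\<eta>::real) (r::real). 0 \<le> \<alpha> \<and> 0 < \<eta> \<and> 0 < r \<and>
           (\<forall>\<epsilon>::real. 0 < \<epsilon> \<longrightarrow> \<epsilon> < 1 \<longrightarrow>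
             (\<exists>T::nat. real T \<le> C_T * ln (1 / \<epsilon>) \<and>
               (\<forall>(\<delta>::real) (N::nat). 0 < \<delta> \<longrightarrow> \<delta> < 1 \<longrightarrow>
                  real N \<ge> C_N * (real n * real m * (1 / \<epsilon>) * (1 / \<delta>)) ^ d \<longrightarrow>
                  purification_succeeds Astar D \<alpha> \<eta> r N A0 T
                    (purified Astar (1/10) (\<epsilon> + c) c) (1 - \<delta>)))))))"
proof (intro exI[of _ "1/1000"] conjI allI impI)
  fix s :: real assume s: "s > 0"
  \<comment> \<open>Chosen so that 1 / \<tau> = a n^2 / \<epsilon> for the tolerance of
    \<open>step_iterate\<close>; through it s enters the sample size.\<close>
  define a where "a = 10000 / s"
  have a: "0 < a" using s by (simp add: a_def)
  show "\<exists>(n0::nat) (C_T::real) (C_N::real) (d::nat).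
       \<forall>(n::nat) (m::nat) (Astar::real mat) (Adag::real mat) (c::real) (D::latent measure)
         (A0::real mat) (\<Sigma>0::real mat) (E0::real mat) (N0::real mat).
         n \<ge> n0 \<longrightarrow>
         Astar \<in> carrier_mat m n \<longrightarrow>
         lin_indpt_cols Astar \<longrightarrow>
         is_min_left_inverse Astar Adag \<longrightarrow>
         0 \<le> c \<longrightarrow> c \<le> 1 \<longrightarrow>
         latent_law n m D \<longrightarrow>
         bernoulli_code n s D \<longrightarrow>
         unbiased_noise n m
           (1/1000 * c * sqrt (real n) / max (real m) (real n * norm_infty Adag)) D \<longrightarrow>
         initialization Astar (1/10) A0 \<Sigma>0 E0 N0 \<longrightarrow>
         N0 = 0\<^sub>m m n \<longrightarrow>
         (\<exists>(\<alpha>::real) (\<eta>::real) (r::real). 0 \<le> \<alpha> \<and> 0 < \<eta> \<and> 0 < r \<and>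
           (\<forall>\<epsilon>::real. 0 < \<epsilon> \<longrightarrow> \<epsilon> < 1 \<longrightarrow>
             (\<exists>T::nat. real T \<le> C_T * ln (1 / \<epsilon>) \<and>
               (\<forall>(\<delta>::real) (N::nat). 0 < \<delta> \<longrightarrow> \<delta> < 1 \<longrightarrow>
                  real N \<ge> C_N * (real n * real m * (1 / \<epsilon>) * (1 / \<delta>)) ^ d \<longrightarrow>
                  purification_succeeds Astar D \<alpha> \<eta> r N A0 T
                    (purified Astar (1/10) (\<epsilon> + c) c) (1 - \<delta>)))))"
  \<comment> \<open>The bound on n yields both parts of \<open>sparse\<close>: 100 s <= n, and 4 s^2
    <= n, whose square root is the other one.\<close>
  proof (rule exI[of _ "nat \<lceil>100 * s + 4 * s\<^sup>2\<rceil> + 1"], rule exI[of _ 21],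
      rule exI[of _ "648 * a\<^sup>2 * (252 + 68 * a)"], rule exI[of _ 10], intro allI impI)
    fix n m :: nat and Astar Adag :: "real mat" and c :: real and D :: "latent measure"
      and A0 \<Sigma>0 E0 N0 :: "real mat"
    assume n0: "nat \<lceil>100 * s + 4 * s\<^sup>2\<rceil> + 1 \<le> n" and Astar: "Astar \<in> carrier_mat m n"
      and "lin_indpt_cols Astar" and Adag: "is_min_left_inverse Astar Adag" and c: "0 \<le> c" "c \<le> 1"
      and law: "latent_law n m D" and bern: "bernoulli_code n s D"
      and unb: "unbiased_noise n m (1/1000 * c * sqrt (real n) / max (real m) (real n * norm_infty Adag)) D"
      and init: "initialization Astar (1/10) A0 \<Sigma>0 E0 N0" "N0 = 0\<^sub>m m n"
    define C where "C = 1/1000 * c * sqrt (real n) / max (real m) (real n * norm_infty Adag)"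
    have dims: "dim_row Astar = m" "dim_col Astar = n" using Astar by auto
    have Adag_carr: "Adag \<in> carrier_mat n m" and Adag_inv: "Adag * Astar = 1\<^sub>m n"
      using Adag unfolding is_min_left_inverse_def dims by auto
    have "100 * s + 4 * s\<^sup>2 \<le> real n" using n0 by linarith
    moreover have "0 \<le> s\<^sup>2" by simp
    ultimately have n_ge: "100 * s \<le> real n" "4 * s\<^sup>2 \<le> real n" using s by linarith+
    have n_pos: "0 < n" using n0 by simp
    have "2 * s = sqrt (4 * s\<^sup>2)" using s by (simp add: real_sqrt_mult)
    also have "\<dots> \<le> sqrt (real n)" using n_ge by (intro real_sqrt_le_mono)
    finally have s_sqrt: "2 * s \<le> sqrt (real n)" .
    \<comment> \<open>With m = 0 the product \<open>Adag * Astar\<close> would consist of empty sums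
      and could not be the identity. So the maximum in the noise level is positive and can be
      divided by.\<close>
    have m_pos: "0 < m"
    proof (rule ccontr)
      assume "\<not> 0 < m"
      then have "(Adag * Astar) $$ (0, 0) = 0"
        using mult_mat_index[OF Adag_carr Astar n_pos n_pos] by simp
      then show False using n_pos by (simp add: Adag_inv)
    qed
    define K where "K = max (real m) (real n * norm_infty Adag)"
    have K: "0 < K" "real m \<le> K" "real n * norm_infty Adag \<le> K" using m_pos by (auto simp: K_def)
    have C: "C = c * sqrt (real n) / (1000 * K)" by (simp add: C_def K_def)
    have C_nonneg: "0 \<le> C" using c K by (simp add: C)
    have noise_total: "real m * C \<le> c * sqrt (real n) / 1000"
    proof -
      have "real m * C \<le> K * C" using K C_nonneg by (intro mult_right_mono)
      then show ?thesis using K by (simp add: C)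
    qed
    have noise_decoded: "norm_infty Adag * C \<le> c / (1000 * sqrt (real n))"
    proof -
      have "real n * norm_infty Adag * C \<le> K * C" using K C_nonneg by (intro mult_right_mono)
      also have "\<dots> = c * sqrt (real n) / 1000" using K by (simp add: C)
      finally have "norm_infty Adag * C \<le> c * sqrt (real n) / 1000 / real n"
        using n_pos by (simp add: pos_le_divide_eq mult_ac)
      also have "\<dots> = c / (1000 * sqrt (real n))"
        using n_pos by (simp add: field_simps)
      finally show ?thesis .
    qed
    interpret D: prob_space D using law by (simp add: latent_law_def)
    interpret purification_setup D n m s C Astar Adag c
    proof unfold_locales
      show "sets D = sets (latent_space n m)" using law by (simp add: latent_law_def)
      show "unbiased_noise n m C D" using unb by (simp add: C_def)
    qed (use bern C_nonneg s n_ge Astar Adag_carr Adag_inv c noise_decoded noise_total s_sqrt in auto)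
    show "\<exists>(\<alpha>::real) (\<eta>::real) (r::real). 0 \<le> \<alpha> \<and> 0 < \<eta> \<and> 0 < r \<and>
           (\<forall>\<epsilon>::real. 0 < \<epsilon> \<longrightarrow> \<epsilon> < 1 \<longrightarrow>
             (\<exists>T::nat. real T \<le> 21 * ln (1 / \<epsilon>) \<and>
               (\<forall>(\<delta>::real) (N::nat). 0 < \<delta> \<longrightarrow> \<delta> < 1 \<longrightarrow>
                  real N \<ge> 648 * a\<^sup>2 * (252 + 68 * a) * (real n * real m * (1 / \<epsilon>) * (1 / \<delta>)) ^ 10 \<longrightarrow>
                  purification_succeeds Astar D \<alpha> \<eta> r N A0 T
                    (purified Astar (1/10) (\<epsilon> + c) c) (1 - \<delta>))))"
    proof (rule exI[of _ "1/5"], rule exI[of _ "1/10"], rule exI[of _ "real n / s"], intro conjI allI impI)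
      fix \<epsilon> :: real assume \<epsilon>: "0 < \<epsilon>" "\<epsilon> < 1"
      have ln_pos: "0 \<le> ln (1 / \<epsilon>)" using \<epsilon> by simp
      \<comment> \<open>For \<epsilon> >= 1/10 the initialisation is already good enough. As ln (1 /
        \<epsilon>) tends to 0 when \<epsilon> approaches 1, a positive number of iterations would
        violate the bound there.\<close>
      define T where "T = (if \<epsilon> < 1/10 then nat \<lceil>20 * ln (1 / \<epsilon>)\<rceil> else 0)"
      have T: "real T \<le> 21 * ln (1 / \<epsilon>)" using iteration_count(1)[of \<epsilon>] \<epsilon> ln_pos by (simp add: T_def)
      have err_T: "err \<epsilon> T \<le> \<epsilon> + c"
      proof (cases "\<epsilon> < 1/10")
        case True
        then have "(19/20) ^ T \<le> \<epsilon>" using iteration_count(2) \<epsilon> by (simp add: T_def)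
        then show ?thesis using err_bounds(3)[of \<epsilon> T] \<epsilon> c by simp
      next
        case False
        then show ?thesis using c by (simp add: T_def)
      qed
      show "\<exists>T::nat. real T \<le> 21 * ln (1 / \<epsilon>) \<and>
               (\<forall>(\<delta>::real) (N::nat). 0 < \<delta> \<longrightarrow> \<delta> < 1 \<longrightarrow>
                  real N \<ge> 648 * a\<^sup>2 * (252 + 68 * a) * (real n * real m * (1 / \<epsilon>) * (1 / \<delta>)) ^ 10 \<longrightarrow>
                  purification_succeeds Astar D (1/5) (1/10) (real n / s) N A0 T
                    (purified Astar (1/10) (\<epsilon> + c) c) (1 - \<delta>))"
      proof (intro exI[of _ T] conjI T allI impI)
        fix \<delta> :: real and N :: nat
        assume \<delta>: "0 < \<delta>" "\<delta> < 1"
          and N: "real N \<ge> 648 * a\<^sup>2 * (252 + 68 * a) * (real n * real m * (1 / \<epsilon>) * (1 / \<delta>)) ^ 10"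
        define Q where "Q = real n * real m * (1 / \<epsilon>) * (1 / \<delta>)"
        have n1: "1 \<le> real n" and m1: "1 \<le> real m" using n_pos m_pos by auto
        have nm: "1 \<le> real n * real m" "real n \<le> real n * real m" "real m \<le> real n * real m"
          using n1 m1 mult_mono[of 1 "real n" 1 "real m"] by auto
        have \<epsilon>1: "1 \<le> 1 / \<epsilon>" and \<delta>1: "1 \<le> 1 / \<delta>" using \<epsilon> \<delta> by auto
        have \<epsilon>\<delta>: "1 \<le> 1 / \<epsilon> * (1 / \<delta>)" "1 / \<epsilon> \<le> 1 / \<epsilon> * (1 / \<delta>)" "1 / \<delta> \<le> 1 / \<epsilon> * (1 / \<delta>)"
          using mult_mono[OF \<epsilon>1 \<delta>1] mult_left_mono[OF \<delta>1, of "1 / \<epsilon>"] mult_right_mono[OF \<epsilon>1, of "1 / \<delta>"] \<epsilon> \<delta> by simp_all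
        have Q_eq: "Q = (real n * real m) * (1 / \<epsilon> * (1 / \<delta>))" by (simp add: Q_def)
        have Q1: "1 \<le> Q" unfolding Q_eq using mult_mono[OF nm(1) \<epsilon>\<delta>(1)] nm by simp
        have Q_nm: "real n * real m \<le> Q"
          unfolding Q_eq using mult_left_mono[OF \<epsilon>\<delta>(1), of "real n * real m"] nm by simp
        have Q_\<epsilon>: "real n * (1 / \<epsilon>) \<le> Q"
          unfolding Q_eq using mult_mono[OF nm(2) \<epsilon>\<delta>(2)] \<epsilon> by simp
        have Q_\<delta>: "1 / \<delta> \<le> Q"
          unfolding Q_eq using mult_mono[OF nm(1) \<epsilon>\<delta>(3)] \<delta> nm by simp
        have Q_inv: "1 / \<epsilon> \<le> Q"
          using mult_right_mono[OF n1, of "1 / \<epsilon>"] Q_\<epsilon> \<epsilon> by simp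
        define \<tau> where "\<tau> = s * \<epsilon> / (10000 * (real n)\<^sup>2)"
        have \<tau>: "0 < \<tau>" using s \<epsilon> n_pos by (simp add: \<tau>_def)
        have "1 / \<tau> = a * ((real n)\<^sup>2 * (1 / \<epsilon>))" by (simp add: \<tau>_def a_def)
        also have "(real n)\<^sup>2 * (1 / \<epsilon>) = real n * (real n * (1 / \<epsilon>))" by (simp add: power2_eq_square)
        \<comment> \<open>One factor \<open>Q\<close> absorbs n, the other n / \<epsilon>.\<close>
        also have "\<dots> \<le> Q * Q" using nm Q_nm Q_\<epsilon> Q1 \<epsilon> by (intro mult_mono) auto
        finally have \<tau>_inv: "1 / \<tau> \<le> a * Q ^ 2" using a by (simp add: power2_eq_square)
        have "ln (1 / \<epsilon>) \<le> 1 / \<epsilon>" using ln_le_minus_one[of "1 / \<epsilon>"] \<epsilon> by simp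
        then have TQ: "real T \<le> 21 * Q" using T Q_inv by linarith
        have N_pos: "N > 0"
        proof -
          have "0 < 648 * a\<^sup>2 * (252 + 68 * a) * Q ^ 10" using a Q1 by (intro mult_pos_pos add_pos_pos) auto
          then have "0 < real N" using N unfolding Q_def[symmetric] by (rule less_le_trans)
          then show ?thesis by simp
        qed
        have M_le: "real (n + m) \<le> 2 * Q"
          using order_trans[OF nm(2) Q_nm] order_trans[OF nm(3) Q_nm] by simp
        have "6 * real T * real (n + m) * (17 * real (n + m) / \<tau>) ^ (n + m)
                  * exp (- (real N * \<tau>\<^sup>2 / (162 * (real (n + m))\<^sup>2))) \<le> \<delta>"
          by (rule exp_bound_sample_size[where Q = Q and a = a])
            (use M_le n1 TQ Q1 \<delta> Q_\<delta> \<tau> \<tau>_inv a N[folded Q_def] in auto)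
        from purification_succeeds_samples[OF init N_pos \<epsilon>(1) _ \<tau>_def err_T this] \<epsilon>
        show "purification_succeeds Astar D (1/5) (1/10) (real n / s) N A0 T
                    (purified Astar (1/10) (\<epsilon> + c) c) (1 - \<delta>)" by simp
      qed
    qed (use s n_pos in auto)
  qed
qed simp

end
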